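(* If the number of global states $|H|$ is polynomially bounded in the size of the input instance, then both the single-round maximization problem $\text{SRm}(t,b)$ and SBMSm are fixed-parameter tractable with respect to the number of items $n$; that is, each can be solved optimally in time $F(n)\cdot|I|^{O(1)}$ for some computable function $F$, where $|I|$ is the input size.
   Context: An instance of SBMSm is $I=(T,B,V,H,(\mathcal P_t)_{t\in[T]},(f_t)_{t\in[T]})$: $T\ge2$ rounds; integer budget $B\ge0$; a finite set $V$ of $n\ge2$ items; each item $v$ has a set $H(v)$ of local states, $H=\prod_vH(v)$ the global states; at round $t$ a state $\eta_t\in H$ is drawn from $\mathcal P_t$, independently across rounds; $f_t:2^V\times H\to\mathbb R_{\ge0}$. A multi-round adaptive policy starts at round $1$ with all $S_t=\emptyset$; at each step it either selects an item $v\notin S_t$ of the current round $t$, adds it to $S_t$ and observes $\eta_t(v)$, or moves on to round $t+1$; it stops when $t>T$ or $\sum_t|S_t|=B$; decisions may depend on all observations so far. Solving SBMSm means computing a policy maximizing $\sigma(\pi)=\mathbb E[\sum_tf_t(S_t,\eta_t)]$. For a round $t$ and budget $b\le B$, let $R(t+1,i)$ ($i\in\{0,\dots,b\}$) be the optimal expected value of $\sum_{t'=t+1}^Tf_{t'}$ achievable in rounds $t+1,\dots,T$ with at most $i$ units of budget ($R(T+1,i)=0$). Given these values, $\text{SRm}(t,b)$ asks for a single-round adaptive policy $\pi_t$ at round $t$ (adaptively selecting $i(\pi_t,\eta_t)\le b$ items at round $t$) maximizing $\mathbb E_{\eta_t\sim\mathcal P_t}[f_t(\pi_t(\eta_t),\eta_t)+R(t+1,b-i(\pi_t,\eta_t))]$.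 No monotonicity or submodularity assumptions are needed. It is assumed that $B<nT$ and that the input size is polynomial in $n$ and $T$. *)

theory Defs
  imports
    "HOL-Probability.Probability"
    "HOL-Library.Log_Nat"
    "HOL-Computational_Algebra.Polynomial"
begin

section \<open>Model of computation\<close>

text \<open>
  Programs of a first-order, call-by-value functional language over binary trees with numbers at
  the leaves. All steps take constant time apart from arithmetic, comparison and external
  queries, which are charged for the numbers involved according to a weight \<open>w\<close>. Two weights are
  used: \<open>unit_weight\<close> gives the real RAM (a number occupies one cell and an operation takes one
  step), and \<open>bit_weight\<close> charges the binary length of a rational in lowest terms. The latter
  model is polynomially equivalent to Turing machines with external value queries: structure
  sharing makes \<open>NodeE\<close> a constant-time operation, and the size of the result is charged
  separately in \<open>solvable_fpt\<close>. Literals are integers, so rational inputs only ever yield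
  rationals.
\<close>

datatype data = Leaf | Num real | Node data data

datatype arith = Add | Sub | Mul | Div

datatype expr =
    Var nat
  | LeafE
  | NumE int
  | NodeE expr expr
  | Fst expr
  | Snd expr
  | IfE expr expr expr
  | LetE expr expr
  | Arith arith expr expr
  | Less expr expr
  | Call nat "expr list"
  | Query expr

type_synonym program = "expr list"

fun num_of :: "data \<Rightarrow> real" where
  "num_of (Num x) = x"
| "num_of _ = 0"

fun fst_of :: "data \<Rightarrow> data" where
  "fst_of (Node x y) = x"
| "fst_of _ = Leaf"

fun snd_of :: "data \<Rightarrow> data" where
  "snd_of (Node x y) = y"
| "snd_of _ = Leaf"

fun apply_arith :: "arith \<Rightarrow> real \<Rightarrow> real \<Rightarrow> real" where
  "apply_arith Add x y = x + y"
| "apply_arith Sub x y = x - y"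
| "apply_arith Mul x y = x * y"
| "apply_arith Div x y = x / y"

definition unit_weight :: "real \<Rightarrow> nat" where
  "unit_weight x = 1"

text \<open>Meaningful for rational arguments only.\<close>

definition bit_weight :: "real \<Rightarrow> nat" where
  "bit_weight x = (let (a, b) = quotient_of (THE q. of_rat q = x)
     in floorlog 2 (nat \<bar>a\<bar>) + floorlog 2 (nat b))"

fun data_size :: "(real \<Rightarrow> nat) \<Rightarrow> data \<Rightarrow> nat" where
  "data_size w Leaf = 1"
| "data_size w (Num x) = 1 + w x"
| "data_size w (Node x y) = 1 + data_size w x + data_size w y"

text \<open>
  \<open>eval w prog orc env e v c\<close>: expression \<open>e\<close> evaluates to \<open>v\<close> at cost \<open>c\<close>.
  \<open>LetE\<close> pushes onto the environment, \<open>Var\<close> indexes it; \<open>IfE\<close> tests for being different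
  from \<open>Leaf\<close>; the body of function \<open>i\<close> is \<open>prog ! i\<close>.
\<close>

inductive
  eval :: "(real \<Rightarrow> nat) \<Rightarrow> program \<Rightarrow> (data \<Rightarrow> data) \<Rightarrow> data list \<Rightarrow> expr \<Rightarrow> data \<Rightarrow> nat \<Rightarrow> bool" and
  evals :: "(real \<Rightarrow> nat) \<Rightarrow> program \<Rightarrow> (data \<Rightarrow> data) \<Rightarrow> data list \<Rightarrow> expr list \<Rightarrow> data list \<Rightarrow> nat \<Rightarrow> bool"
  for w :: "real \<Rightarrow> nat" and prog :: program and orc :: "data \<Rightarrow> data"
where
  Var: "i < length env \<Longrightarrow> eval w prog orc env (Var i) (env ! i) 1"
| LeafE: "eval w prog orc env LeafE Leaf 1"
| NumE: "eval w prog orc env (NumE k) (Num (of_int k)) (1 + w (of_int k))"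
| NodeE: "\<lbrakk>eval w prog orc env e1 v1 c1; eval w prog orc env e2 v2 c2\<rbrakk>
    \<Longrightarrow> eval w prog orc env (NodeE e1 e2) (Node v1 v2) (1 + c1 + c2)"
| Fst: "eval w prog orc env e v c \<Longrightarrow> eval w prog orc env (Fst e) (fst_of v) (1 + c)"
| Snd: "eval w prog orc env e v c \<Longrightarrow> eval w prog orc env (Snd e) (snd_of v) (1 + c)"
| If_True: "\<lbrakk>eval w prog orc env e1 v1 c1; v1 \<noteq> Leaf; eval w prog orc env e2 v2 c2\<rbrakk>
    \<Longrightarrow> eval w prog orc env (IfE e1 e2 e3) v2 (1 + c1 + c2)"
| If_False: "\<lbrakk>eval w prog orc env e1 Leaf c1; eval w prog orc env e3 v3 c3\<rbrakk>
    \<Longrightarrow> eval w prog orc env (IfE e1 e2 e3) v3 (1 + c1 + c3)"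
| LetE: "\<lbrakk>eval w prog orc env e1 v1 c1; eval w prog orc (v1 # env) e2 v2 c2\<rbrakk>
    \<Longrightarrow> eval w prog orc env (LetE e1 e2) v2 (1 + c1 + c2)"
| Arith: "\<lbrakk>eval w prog orc env e1 v1 c1; eval w prog orc env e2 v2 c2\<rbrakk>
    \<Longrightarrow> eval w prog orc env (Arith op e1 e2) (Num (apply_arith op (num_of v1) (num_of v2)))
          (1 + c1 + c2 + w (num_of v1) + w (num_of v2))"
| Less: "\<lbrakk>eval w prog orc env e1 v1 c1; eval w prog orc env e2 v2 c2\<rbrakk>
    \<Longrightarrow> eval w prog orc env (Less e1 e2) (if num_of v1 < num_of v2 then Num 1 else Leaf)
          (1 + c1 + c2 + w (num_of v1) + w (num_of v2))"
| Call: "\<lbrakk>evals w prog orc env es vs c1; i < length prog; eval w prog orc vs (prog ! i) v c2\<rbrakk>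
    \<Longrightarrow> eval w prog orc env (Call i es) v (1 + c1 + c2)"
| Query: "eval w prog orc env e v c
    \<Longrightarrow> eval w prog orc env (Query e) (orc v) (1 + c + data_size w v + data_size w (orc v))"
| Empty: "evals w prog orc env [] [] 0"
| Cons: "\<lbrakk>eval w prog orc env e v c1; evals w prog orc env es vs c2\<rbrakk>
    \<Longrightarrow> evals w prog orc env (e # es) (v # vs) (c1 + c2)"

text \<open>Function 0 is the entry point of a program.\<close>

definition runs ::
  "(real \<Rightarrow> nat) \<Rightarrow> program \<Rightarrow> (data \<Rightarrow> data) \<Rightarrow> data \<Rightarrow> data \<Rightarrow> nat \<Rightarrow> bool" where
  "runs w prog orc x y c \<longleftrightarrow> eval w prog orc [x] (Call 0 [Var 0]) y c"

definition computable :: "(nat \<Rightarrow> nat) \<Rightarrow> bool" where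
  "computable F \<longleftrightarrow>
     (\<exists>prog. \<forall>n. \<exists>c. runs unit_weight prog (\<lambda>_. Leaf) (Num (real n)) (Num (real (F n))) c)"

text \<open>
  A parameterized problem consists of a set \<open>X\<close> of instances, each having an external source of
  answers to queries, an explicitly written input, a parameter, a size and a set of correct outputs.
\<close>

definition solvable_fpt ::
  "(real \<Rightarrow> nat) \<Rightarrow> 'i set \<Rightarrow> ('i \<Rightarrow> data \<Rightarrow> data) \<Rightarrow> ('i \<Rightarrow> data) \<Rightarrow>
   ('i \<Rightarrow> nat) \<Rightarrow> ('i \<Rightarrow> nat) \<Rightarrow> ('i \<Rightarrow> data \<Rightarrow> bool) \<Rightarrow> bool" where
  "solvable_fpt w X orc inp par sz correct \<longleftrightarrow>
     (\<exists>prog F k. computable F \<and>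
        (\<forall>x\<in>X. \<exists>y c. runs w prog (orc x) (inp x) y c \<and> correct x y \<and>
           c + data_size w y \<le> F (par x) * sz x ^ k))"


section \<open>The optimization problems\<close>

text \<open>
  Items are named \<open>0, \<dots>, n - 1\<close> and the local states of \<open>v\<close> are named \<open>0, \<dots>, nstates I v - 1\<close>.
\<close>

type_synonym state = "nat \<Rightarrow> nat"

record sbmsm =
  rounds :: nat
  budget :: nat
  nitems :: nat
  nstates :: "nat \<Rightarrow> nat"
  state_dist :: "nat \<Rightarrow> state pmf"
  reward :: "nat \<Rightarrow> nat set \<Rightarrow> state \<Rightarrow> real"

definition items :: "sbmsm \<Rightarrow> nat set" where
  "items I = {..<nitems I}"

definition global_states :: "sbmsm \<Rightarrow> state set" where
  "global_states I = PiE (items I) (\<lambda>v. {..<nstates I v})"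

definition valid_instance :: "sbmsm \<Rightarrow> bool" where
  "valid_instance I \<longleftrightarrow>
     rounds I \<ge> 2 \<and> nitems I \<ge> 2 \<and> budget I < nitems I * rounds I \<and>
     (\<forall>t\<in>{1..rounds I}. set_pmf (state_dist I t) \<subseteq> global_states I) \<and>
     (\<forall>t\<in>{1..rounds I}. \<forall>S\<subseteq>items I. \<forall>\<eta>\<in>global_states I. reward I t S \<eta> \<ge> 0)"

definition rational_instance :: "sbmsm \<Rightarrow> bool" where
  "rational_instance I \<longleftrightarrow>
     (\<forall>t\<in>{1..rounds I}. \<forall>\<eta>\<in>global_states I. pmf (state_dist I t) \<eta> \<in> \<rat>) \<and>
     (\<forall>t\<in>{1..rounds I}. \<forall>S\<subseteq>items I. \<forall>\<eta>\<in>global_states I. reward I t S \<eta> \<in> \<rat>)"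

datatype action = Select nat | Move

subsection \<open>Multi-round policies\<close>

text \<open>
  An observation \<open>(t, v, s)\<close> records that \<open>v\<close> was selected at round \<open>t\<close> and found in state \<open>s\<close>.
  A policy decides on the basis of the current round and the list of all observations so far.
\<close>

type_synonym obs = "(nat \<times> nat \<times> nat) list"
type_synonym policy = "nat \<Rightarrow> obs \<Rightarrow> action"

definition selected :: "nat \<Rightarrow> obs \<Rightarrow> nat set" where
  "selected t os = {v. \<exists>s. (t, v, s) \<in> set os}"

definition is_policy :: "sbmsm \<Rightarrow> policy \<Rightarrow> bool" where
  "is_policy I \<pi> \<longleftrightarrow>
     (\<forall>t\<in>{1..rounds I}. \<forall>os v. length os < budget I \<longrightarrow> \<pi> t os = Select v \<longrightarrow>
        v \<in> items I - selected t os)"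

text \<open>
  The observations made by \<open>\<pi>\<close> from round \<open>t\<close> on, with total budget \<open>b\<close>, when \<open>\<omega> t\<close>
  is the state of round \<open>t\<close>.
\<close>

function play :: "sbmsm \<Rightarrow> policy \<Rightarrow> (nat \<Rightarrow> state) \<Rightarrow> nat \<Rightarrow> nat \<Rightarrow> obs \<Rightarrow> obs" where
  "play I \<pi> \<omega> b t os =
     (if t > rounds I \<or> length os \<ge> b then os
      else case \<pi> t os of
        Select v \<Rightarrow> play I \<pi> \<omega> b t (os @ [(t, v, \<omega> t v)])
      | Move \<Rightarrow> play I \<pi> \<omega> b (Suc t) os)"
  by pat_completeness auto
termination
  by (relation "Wellfounded.measure (\<lambda>(I, \<pi>, \<omega>, b, t, os). (Suc (rounds I) - t) + (b - length os))") auto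

declare play.simps [simp del]

definition all_rounds :: "sbmsm \<Rightarrow> (nat \<Rightarrow> state) pmf" where
  "all_rounds I = Pi_pmf {1..rounds I} undefined (state_dist I)"

definition value_from :: "sbmsm \<Rightarrow> nat \<Rightarrow> nat \<Rightarrow> policy \<Rightarrow> real" where
  "value_from I t b \<pi> = measure_pmf.expectation (all_rounds I)
     (\<lambda>\<omega>. \<Sum>t'=t..rounds I. reward I t' (selected t' (play I \<pi> \<omega> b t [])) (\<omega> t'))"

definition sigma :: "sbmsm \<Rightarrow> policy \<Rightarrow> real" where
  "sigma I \<pi> = value_from I 1 (budget I) \<pi>"

definition optimal_policy :: "sbmsm \<Rightarrow> policy \<Rightarrow> bool" where
  "optimal_policy I \<pi> \<longleftrightarrow>
     is_policy I \<pi> \<and> (\<forall>\<pi>'. is_policy I \<pi>' \<longrightarrow> sigma I \<pi>' \<le> sigma I \<pi>)"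

definition opt_value :: "sbmsm \<Rightarrow> nat \<Rightarrow> nat \<Rightarrow> real" where
  "opt_value I t i = (SUP \<pi>\<in>{\<pi>. is_policy I \<pi>}. value_from I t i \<pi>)"

subsection \<open>Single-round policies\<close>

text \<open>Here \<open>Move\<close> ends the round.\<close>

type_synonym obs1 = "(nat \<times> nat) list"
type_synonym policy1 = "obs1 \<Rightarrow> action"

definition is_policy1 :: "sbmsm \<Rightarrow> policy1 \<Rightarrow> bool" where
  "is_policy1 I \<pi> \<longleftrightarrow> (\<forall>os v. \<pi> os = Select v \<longrightarrow> v \<in> items I - fst ` set os)"

function play1 :: "policy1 \<Rightarrow> state \<Rightarrow> nat \<Rightarrow> obs1 \<Rightarrow> obs1" where
  "play1 \<pi> \<eta> b os =
     (if length os \<ge> b then os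
      else case \<pi> os of
        Select v \<Rightarrow> play1 \<pi> \<eta> b (os @ [(v, \<eta> v)])
      | Move \<Rightarrow> os)"
  by pat_completeness auto
termination
  by (relation "Wellfounded.measure (\<lambda>(\<pi>, \<eta>, b, os). b - length os)") auto

declare play1.simps [simp del]

definition value1 :: "sbmsm \<Rightarrow> nat \<Rightarrow> nat \<Rightarrow> policy1 \<Rightarrow> real" where
  "value1 I t b \<pi> = measure_pmf.expectation (state_dist I t)
     (\<lambda>\<eta>. let os = play1 \<pi> \<eta> b []
          in reward I t (fst ` set os) \<eta> + opt_value I (t + 1) (b - length os))"

definition optimal_policy1 :: "sbmsm \<Rightarrow> nat \<Rightarrow> nat \<Rightarrow> policy1 \<Rightarrow> bool" where
  "optimal_policy1 I t b \<pi> \<longleftrightarrow>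
     is_policy1 I \<pi> \<and> (\<forall>\<pi>'. is_policy1 I \<pi>' \<longrightarrow> value1 I t b \<pi>' \<le> value1 I t b \<pi>)"


section \<open>Inputs and outputs\<close>

fun enc_list :: "data list \<Rightarrow> data" where
  "enc_list [] = Leaf"
| "enc_list (x # xs) = Node x (enc_list xs)"

definition enc_nat :: "nat \<Rightarrow> data" where
  "enc_nat n = Num (real n)"

text \<open>
  The explicit part of the input lists the rounds, the budget and the local states of each item.
  Listing all rounds makes the size at least \<open>T\<close>: the input comprises \<open>T\<close> distributions
  and \<open>T\<close> reward functions.
\<close>

definition enc_instance :: "sbmsm \<Rightarrow> data" where
  "enc_instance I = enc_list
     [enc_list (map enc_nat [1..<Suc (rounds I)]),
      enc_nat (budget I),
      enc_list (map (\<lambda>v. enc_list (map enc_nat [0..<nstates I v])) [0..<nitems I])]"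

fun dec_nat :: "data \<Rightarrow> nat" where
  "dec_nat (Num x) = nat \<lfloor>x\<rfloor>"
| "dec_nat _ = 0"

fun dec_nats :: "data \<Rightarrow> nat list" where
  "dec_nats (Node x xs) = dec_nat x # dec_nats xs"
| "dec_nats _ = []"

definition state_of :: "nat list \<Rightarrow> state" where
  "state_of xs = restrict (\<lambda>v. xs ! v) {..<length xs}"

text \<open>
  Distributions and reward functions are accessed through value queries: the query
  \<open>[t, \<eta>]\<close> returns the probability of \<open>\<eta>\<close> at round \<open>t\<close>, and \<open>[t, \<eta>, S]\<close> returns
  the reward. Explicit tables of the rewards would have size at least \<open>2 ^ n\<close> and explicit
  tables of the distributions size at least \<open>|H|\<close>, which would make both the parameterization and
  the bound on \<open>|H|\<close> pointless.
\<close>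

fun answer :: "sbmsm \<Rightarrow> data \<Rightarrow> data" where
  "answer I (Node t (Node x Leaf)) =
     (let t' = dec_nat t; \<eta> = state_of (dec_nats x)
      in if t' \<in> {1..rounds I} \<and> \<eta> \<in> global_states I then Num (pmf (state_dist I t') \<eta>) else Leaf)"
| "answer I (Node t (Node x (Node s Leaf))) =
     (let t' = dec_nat t; \<eta> = state_of (dec_nats x); S = set (dec_nats s)
      in if t' \<in> {1..rounds I} \<and> \<eta> \<in> global_states I \<and> S \<subseteq> items I
         then Num (reward I t' S \<eta>) else Leaf)"
| "answer I _ = Leaf"

text \<open>The size also accounts for the largest numbers that a query may return.\<close>

definition instance_size :: "(real \<Rightarrow> nat) \<Rightarrow> sbmsm \<Rightarrow> nat" where
  "instance_size w I = data_size w (enc_instance I)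
     + Max ((\<lambda>(t, \<eta>). w (pmf (state_dist I t) \<eta>)) ` ({1..rounds I} \<times> global_states I))
     + Max ((\<lambda>(t, \<eta>, S). w (reward I t S \<eta>)) ` ({1..rounds I} \<times> global_states I \<times> Pow (items I)))"

text \<open>
  Single-round policies are output as decision trees: \<open>Pick v ts\<close> selects \<open>v\<close> and, upon
  observing state \<open>s\<close>, continues with \<open>ts ! s\<close>.
\<close>

datatype dtree = Halt | Pick nat "dtree list"

fun tree_policy :: "dtree \<Rightarrow> policy1" where
  "tree_policy Halt os = Move"
| "tree_policy (Pick v ts) [] = Select v"
| "tree_policy (Pick v ts) ((u, s) # os) =
     (if u = v \<and> s < length ts then tree_policy (ts ! s) os else Move)"

fun enc_tree :: "dtree \<Rightarrow> data" where
  "enc_tree Halt = Leaf"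
| "enc_tree (Pick v ts) = Node (enc_nat v) (enc_list (map enc_tree ts))"

text \<open>
  A multi-round policy is output as a table with a decision tree for each round and each
  budget available at the beginning of that round. An explicit decision tree for all rounds would
  be exponential in \<open>T\<close>. The table only restricts the output format: the policy it denotes
  has to be optimal among all policies.
\<close>

definition table_policy :: "sbmsm \<Rightarrow> dtree list list \<Rightarrow> policy" where
  "table_policy I tbl t os =
     tree_policy (tbl ! (t - 1) ! (budget I - length (filter (\<lambda>(t', _, _). t' < t) os)))
       (map snd (filter (\<lambda>(t', _, _). t' = t) os))"

definition is_table :: "sbmsm \<Rightarrow> dtree list list \<Rightarrow> bool" where
  "is_table I tbl \<longleftrightarrow> length tbl = rounds I \<and> (\<forall>row\<in>set tbl. length row = budget I + 1)"

definition enc_table :: "dtree list list \<Rightarrow> data" where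
  "enc_table tbl = enc_list (map (\<lambda>row. enc_list (map enc_tree row)) tbl)"

text \<open>The values \<open>R(t + 1, i)\<close> are part of the input of the single-round problem.\<close>

definition enc_SRm :: "sbmsm \<times> nat \<times> nat \<Rightarrow> data" where
  "enc_SRm = (\<lambda>(I, t, b). enc_list
     [enc_instance I, enc_nat t, enc_nat b, enc_list (map (\<lambda>i. Num (opt_value I (t + 1) i)) [0..<Suc b])])"

text \<open>
  Fixed-parameter tractability in \<open>n\<close> on the instances of a class. The single-round problem is
  measured against the size of the underlying instance alone, not counting the given values
  \<open>R(t + 1, i)\<close>.
\<close>

definition SRm_fpt :: "(real \<Rightarrow> nat) \<Rightarrow> sbmsm set \<Rightarrow> bool" where
  "SRm_fpt w C \<longleftrightarrow>
     solvable_fpt w {(I, t, b). I \<in> C \<and> t \<in> {1..rounds I} \<and> b \<le> budget I}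
       (\<lambda>(I, t, b). answer I) enc_SRm
       (\<lambda>(I, t, b). nitems I) (\<lambda>(I, t, b). instance_size w I)
       (\<lambda>(I, t, b) y. \<exists>tr. y = enc_tree tr \<and> optimal_policy1 I t b (tree_policy tr))"

definition SBMSm_fpt :: "(real \<Rightarrow> nat) \<Rightarrow> sbmsm set \<Rightarrow> bool" where
  "SBMSm_fpt w C \<longleftrightarrow>
     solvable_fpt w C answer enc_instance nitems (instance_size w)
       (\<lambda>I y. \<exists>tbl. y = enc_table tbl \<and> is_table I tbl \<and> optimal_policy I (table_policy I tbl))"

end

theory Submission
  imports Defs
begin

text \<open>
  A decision tree for one round is found by plain recursion: a node keeps the list \<open>L\<close> of global
  states compatible with the observations made so far and the list \<open>S\<close> of selected items, and
  either halts or tries every item outside \<open>S\<close>, splitting \<open>L\<close> by the state of that item. Every item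
  tried splits the same \<open>L\<close>, so each further selection multiplies the work by at most about \<open>n\<close>, and
  there are at most \<open>n\<close> selections: the recursion costs \<open>(n + 2) ^ (n + 1) \<cdot> |H|\<close> times a polynomial.
  By independence of the rounds, the optimum over policies that remember everything depends only on the
  round and the budget left, so backward induction over the rounds solves SBMSm.
  In the bit model, let \<open>D\<close> be a common denominator of the at most \<open>T \<cdot> |H| \<cdot> (1 + 2 ^ n)\<close> input numbers.
  All numbers computed have denominator dividing \<open>D ^ O(T)\<close>, so their lengths are \<open>F(n)\<close> times a
  polynomial.
\<close>

section \<open>Optimal decision trees for a single round\<close>

text \<open>Values are not normalised. A node is worth the sum of \<open>p x * (f S x + R)\<close>
  over the compatible states, not a conditional expectation: conditioning would scale all
  alternatives of a node by the same factor, so the maximiser is the same, no division occurs,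
  events of probability zero need no special case, and the values of the children of a selection
  simply add up. The local states of the selected item might seem to multiply the work as well. They
  do not, because the children share out \<open>L\<close> and are together no longer than
  \<open>L\<close>. The obstacle in the bit model is that values are added along the whole
  recursion, so a bound that grows with every addition would grow with every selection. Regrouping
  removes it: the value of a tree is a sum of at most \<open>length L\<close> halting terms, one for
  each state, and every term is built directly from the values of the next round. Only a constant
  number of nesting levels is therefore added per round, however many selections are made in
  it.\<close>

definition better :: "real \<times> dtree \<Rightarrow> real \<times> dtree \<Rightarrow> real \<times> dtree" where
  "better a c = (if fst a < fst c then c else a)"

definition combine :: "nat \<Rightarrow> (real \<times> dtree) list \<Rightarrow> real \<times> dtree" where
  "combine v cs = (sum_list (map fst cs), Pick v (map snd cs))"

definition halt_value ::
  "(nat list \<Rightarrow> real) \<Rightarrow> (nat set \<Rightarrow> nat list \<Rightarrow> real) \<Rightarrow> real \<Rightarrow> nat list \<Rightarrow> nat list list \<Rightarrow> real" where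
  "halt_value p f R S L = (\<Sum>x\<leftarrow>L. p x * (f (set S) x + R))"

text \<open>
  The list of rewards is \<open>[R b, \<dots>, R 0]\<close> for the remaining budget \<open>b\<close>, so that selecting an item
  drops its head. States \<open>L\<close> are those compatible with the observations, and stopping at an empty
  \<open>L\<close> makes the cost of the recursion proportional to the length of \<open>L\<close>.
\<close>

primrec best ::
  "(nat list \<Rightarrow> real) \<Rightarrow> (nat set \<Rightarrow> nat list \<Rightarrow> real) \<Rightarrow> (nat \<times> nat list) list \<Rightarrow>
   real list \<Rightarrow> nat list \<Rightarrow> nat list list \<Rightarrow> real \<times> dtree" where
  "best p f its [] S L = (0, Halt)"
| "best p f its (R # Rs) S L =
     (if L = [] then (0, Halt)
      else if Rs = [] then (halt_value p f R S L, Halt)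
      else foldl (\<lambda>a (v, sl). if v \<in> set S then a
             else better a (combine v (map (\<lambda>s. best p f its Rs (v # S) [x\<leftarrow>L. x ! v = s]) sl)))
           (halt_value p f R S L, Halt) its)"

text \<open>The fold in \<open>best\<close> is a running maximum. The two inequalities give
  optimality; the case distinction transfers to the result whatever holds for every candidate, such
  as validity of the tree, depth of the numbers and size of the output.\<close>

lemma foldl_better:
  fixes S :: "nat list" and h :: "nat \<Rightarrow> nat list \<Rightarrow> real \<times> dtree"
  defines "F \<equiv> foldl (\<lambda>a (v, sl). if v \<in> set S then a else better a (h v sl))"
  shows foldl_better_ge_init: "fst a \<le> fst (F a its)"
    and foldl_better_ge: "(v, sl) \<in> set its \<Longrightarrow> v \<notin> set S \<Longrightarrow> fst (h v sl) \<le> fst (F a its)"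
    and foldl_better_cases:
      "F a its = a \<or> (\<exists>v sl. (v, sl) \<in> set its \<and> v \<notin> set S \<and> F a its = h v sl)"
proof -
  show ge: "fst a \<le> fst (F a its)" for a its
    unfolding F_def
  proof (induction its arbitrary: a)
    case (Cons i its)
    have "fst a \<le> fst (if fst i \<in> set S then a else better a (h (fst i) (snd i)))"
      by (simp add: better_def)
    then show ?case using Cons[of "if fst i \<in> set S then a else better a (h (fst i) (snd i))"]
      by (simp add: case_prod_beta)
  qed simp
  show "(v, sl) \<in> set its \<Longrightarrow> v \<notin> set S \<Longrightarrow> fst (h v sl) \<le> fst (F a its)"
  proof (induction its arbitrary: a)
    case (Cons i its)
    show ?case
    proof (cases "i = (v, sl)")
      case True
      have "fst (h v sl) \<le> fst (better a (h v sl))" by (simp add: better_def)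
      also have "\<dots> \<le> fst (F (better a (h v sl)) its)" by (rule ge)
      finally show ?thesis using True Cons.prems by (simp add: F_def)
    next
      case False
      then show ?thesis using Cons by (auto simp: F_def)
    qed
  qed simp
  show "F a its = a \<or> (\<exists>v sl. (v, sl) \<in> set its \<and> v \<notin> set S \<and> F a its = h v sl)"
  proof (induction its arbitrary: a)
    case (Cons i its)
    define a' where "a' = (if fst i \<in> set S then a else better a (h (fst i) (snd i)))"
    have a': "F a (i # its) = F a' its" by (simp add: F_def a'_def case_prod_beta)
    from Cons[of a'] show ?case
    proof (elim disjE)
      assume "F a' its = a'"
      then show ?thesis unfolding a' a'_def better_def
        by (smt (verit) list.set_intros(1) prod.collapse)
    qed (use a' in auto)
  qed (simp add: F_def)
qed

lemma sum_list_split_index: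
  fixes g :: "nat list \<Rightarrow> real"
  assumes "\<forall>x\<in>set L. x ! v < k"
  shows "(\<Sum>x\<leftarrow>L. g x) = (\<Sum>s\<leftarrow>[0..<k]. \<Sum>x\<leftarrow>[x\<leftarrow>L. x ! v = s]. g x)"
  using assms
proof (induction L)
  case (Cons x L)
  have "(\<Sum>s\<leftarrow>[0..<k]. \<Sum>y\<leftarrow>[y\<leftarrow>x # L. y ! v = s]. g y)
      = (\<Sum>s\<leftarrow>[0..<k]. (if s = x ! v then g x else 0) + (\<Sum>y\<leftarrow>[y\<leftarrow>L. y ! v = s]. g y))"
    by (intro arg_cong[of _ _ sum_list] map_cong) auto
  also have "\<dots> = (\<Sum>s\<leftarrow>[0..<k]. if s = x ! v then g x else 0) + (\<Sum>x\<leftarrow>L. g x)"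
    using Cons by (simp add: sum_list_addf)
  also have "(\<Sum>s\<leftarrow>[0..<k]. if s = x ! v then g x else 0) = g x"
    using Cons.prems by (simp add: interv_sum_list_conv_sum_set_nat)
  finally show ?case by simp
qed simp

text \<open>With budget left the branch for a single reward disappears, and the recursive calls
  again have a reward list of the form that the inductions below are about.\<close>

lemma best_Suc:
  "best p f its (map R (rev [0..<Suc (Suc k)])) S L =
     (if L = [] then (0, Halt)
      else foldl (\<lambda>a (v, sl). if v \<in> set S then a
             else better a (combine v (map (\<lambda>s. best p f its (map R (rev [0..<Suc k])) (v # S) [x\<leftarrow>L. x ! v = s]) sl)))
           (halt_value p f (R (Suc k)) S L, Halt) its)"
proof -
  have "map R (rev [0..<Suc (Suc k)]) = R (Suc k) # map R (rev [0..<Suc k])"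
    and "map R (rev [0..<Suc k]) \<noteq> []" by simp_all
  then show ?thesis by (simp only: best.simps if_False)
qed

text \<open>Whatever the policy does next is one of the candidates of the maximum, so induction on
  the remaining budget \<open>k\<close> works. The list \<open>L\<close> need not be compatible with
  \<open>os\<close>, because \<open>play1\<close> continues from the given history. Decisions are
  constrained only below the budget, since multi-round policies promise no more.\<close>

lemma best_upper:
  fixes \<eta> :: "nat list \<Rightarrow> state" and m :: "nat \<Rightarrow> nat" and n :: nat
  defines "its \<equiv> map (\<lambda>v. (v, [0..<m v])) [0..<n]"
  assumes pol: "\<And>os v. length os < b \<Longrightarrow> \<pi> os = Select v \<Longrightarrow> v < n \<and> v \<notin> fst ` set os"
    and "length os + k = b" "set S = fst ` set os"
    and "\<forall>x\<in>set L. \<forall>v<n. x ! v < m v \<and> \<eta> x v = x ! v"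
  shows "(\<Sum>x\<leftarrow>L. p x * (f (fst ` set (play1 \<pi> (\<eta> x) b os)) x + R (b - length (play1 \<pi> (\<eta> x) b os))))
    \<le> fst (best p f its (map R (rev [0..<Suc k])) S L)"
  using assms(3-)
proof (induction k arbitrary: os S L)
  case 0
  then have "play1 \<pi> h b os = os" for h by (subst play1.simps) simp
  then show ?case using 0 by (auto simp: halt_value_def)
next
  case (Suc k)
  let ?Rs = "map R (rev [0..<Suc k])"
  show ?case
  proof (cases "L = []")
    case False
    show ?thesis
    proof (cases "\<pi> os")
      case Move
      then have "play1 \<pi> h b os = os" for h by (subst play1.simps) simp
      moreover have "b - length os = Suc k" using Suc.prems by simp
      ultimately have "(\<Sum>x\<leftarrow>L. p x * (f (fst ` set (play1 \<pi> (\<eta> x) b os)) x + R (b - length (play1 \<pi> (\<eta> x) b os))))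
          = halt_value p f (R (Suc k)) S L" using Suc.prems by (simp add: halt_value_def)
      also have "\<dots> \<le> fst (best p f its (map R (rev [0..<Suc (Suc k)])) S L)"
        unfolding best_Suc using False
        foldl_better_ge_init[of "(halt_value p f (R (Suc k)) S L, Halt)"] by (simp del: upt_Suc)
      finally show ?thesis .
    next
      case (Select v)
      have lt: "length os < b" using Suc.prems by simp
      have v: "v < n" "v \<notin> fst ` set os" using pol[OF lt Select] by auto
      have step: "play1 \<pi> h b os = play1 \<pi> h b (os @ [(v, h v)])" for h
        using lt Select by (subst play1.simps) simp
      let ?g = "\<lambda>os x. p x * (f (fst ` set (play1 \<pi> (\<eta> x) b os)) x + R (b - length (play1 \<pi> (\<eta> x) b os)))"
      have "(\<Sum>x\<leftarrow>L. ?g os x) = (\<Sum>s\<leftarrow>[0..<m v]. \<Sum>x\<leftarrow>[x\<leftarrow>L. x ! v = s]. ?g os x)"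
        using Suc.prems v by (intro sum_list_split_index) auto
      also have "\<dots> \<le> (\<Sum>s\<leftarrow>[0..<m v]. fst (best p f its ?Rs (v # S) [x\<leftarrow>L. x ! v = s]))"
      proof (intro sum_list_mono)
        fix s
        \<comment> \<open>Every state of this class shows \<open>s\<close> at \<open>v\<close>, so
          one extended history serves the whole class.\<close>
        have "(\<Sum>x\<leftarrow>[x\<leftarrow>L. x ! v = s]. ?g os x) = (\<Sum>x\<leftarrow>[x\<leftarrow>L. x ! v = s]. ?g (os @ [(v, s)]) x)"
          using Suc.prems v by (intro arg_cong[of _ _ sum_list] map_cong refl) (subst (1 2) step, auto)
        also have "\<dots> \<le> fst (best p f its ?Rs (v # S) [x\<leftarrow>L. x ! v = s])"
          using Suc.prems by (intro Suc.IH) auto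
        finally show "(\<Sum>x\<leftarrow>[x\<leftarrow>L. x ! v = s]. ?g os x) \<le> \<dots>" .
      qed
      also have "\<dots> = fst (combine v (map (\<lambda>s. best p f its ?Rs (v # S) [x\<leftarrow>L. x ! v = s]) [0..<m v]))"
        by (simp add: combine_def o_def)
      also have "\<dots> \<le> fst (best p f its (map R (rev [0..<Suc (Suc k)])) S L)"
        unfolding best_Suc if_not_P[OF False]
        by (rule foldl_better_ge[where h = "\<lambda>v sl. combine v (map (\<lambda>s. best p f its ?Rs (v # S) [x\<leftarrow>L. x ! v = s]) sl)"])
          (use v Suc.prems in \<open>auto simp: its_def\<close>)
      finally show ?thesis .
    qed
  qed simp
qed

text \<open>Following the maximising candidate turns each estimate of \<open>best_upper\<close> into
  an equality. The policy has to agree with the tree only on the histories that extend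
  \<open>os\<close>, which lets a multi-round policy be plugged in for one of its rounds.\<close>

lemma best_attained:
  fixes \<eta> :: "nat list \<Rightarrow> state" and m :: "nat \<Rightarrow> nat" and n :: nat
  defines "its \<equiv> map (\<lambda>v. (v, [0..<m v])) [0..<n]"
  assumes "length os + k = b" "set S = fst ` set os"
    and "\<forall>x\<in>set L. \<forall>v<n. x ! v < m v \<and> \<eta> x v = x ! v"
    and "\<And>os' :: obs1. length os + length os' < b \<Longrightarrow>
      \<pi> (os @ os') = tree_policy (snd (best p f its (map R (rev [0..<Suc k])) S L)) os'"
  shows "(\<Sum>x\<leftarrow>L. p x * (f (fst ` set (play1 \<pi> (\<eta> x) b os)) x + R (b - length (play1 \<pi> (\<eta> x) b os))))
    = fst (best p f its (map R (rev [0..<Suc k])) S L)"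
  using assms(2-)
proof (induction k arbitrary: os S L)
  case 0
  then have "play1 \<pi> h b os = os" for h by (subst play1.simps) simp
  then show ?case using 0 by (auto simp: halt_value_def)
next
  case (Suc k)
  let ?Rs = "map R (rev [0..<Suc k])"
  let ?B = "best p f its (map R (rev [0..<Suc (Suc k)])) S L"
  let ?g = "\<lambda>os x. p x * (f (fst ` set (play1 \<pi> (\<eta> x) b os)) x + R (b - length (play1 \<pi> (\<eta> x) b os)))"
  show ?case
  proof (cases "L = []")
    case False
    have lt: "length os < b" using Suc.prems by simp
    have pi: "\<pi> os = tree_policy (snd ?B) []" using Suc.prems(4)[of "[]"] lt by simp
    consider "?B = (halt_value p f (R (Suc k)) S L, Halt)"
      | v where "v < n" "v \<notin> set S"
        "?B = combine v (map (\<lambda>s. best p f its ?Rs (v # S) [x\<leftarrow>L. x ! v = s]) [0..<m v])"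
      using foldl_better_cases[of S "\<lambda>v sl. combine v (map (\<lambda>s. best p f its ?Rs (v # S) [x\<leftarrow>L. x ! v = s]) sl)"
          "(halt_value p f (R (Suc k)) S L, Halt)" its] False
      unfolding best_Suc by (auto simp: its_def simp del: upt_Suc)
    then show ?thesis
    proof cases
      case 1
      then have "\<pi> os = Move" using pi by (simp del: upt_Suc)
      then have "play1 \<pi> h b os = os" for h by (subst play1.simps) simp
      moreover have "b - length os = Suc k" using Suc.prems by simp
      ultimately show ?thesis unfolding 1 using Suc.prems(2) by (simp add: halt_value_def)
    next
      case 2
      have sel: "\<pi> os = Select v" using pi 2 by (simp add: combine_def del: upt_Suc)
      have step: "play1 \<pi> h b os = play1 \<pi> h b (os @ [(v, h v)])" for h
        using lt sel by (subst play1.simps) simp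
      have "(\<Sum>x\<leftarrow>L. ?g os x) = (\<Sum>s\<leftarrow>[0..<m v]. \<Sum>x\<leftarrow>[x\<leftarrow>L. x ! v = s]. ?g os x)"
        using Suc.prems 2 by (intro sum_list_split_index) auto
      also have "\<dots> = (\<Sum>s\<leftarrow>[0..<m v]. fst (best p f its ?Rs (v # S) [x\<leftarrow>L. x ! v = s]))"
      proof (intro arg_cong[of _ _ sum_list] map_cong refl)
        fix s assume s: "s \<in> set [0..<m v]"
        have "(\<Sum>x\<leftarrow>[x\<leftarrow>L. x ! v = s]. ?g os x) = (\<Sum>x\<leftarrow>[x\<leftarrow>L. x ! v = s]. ?g (os @ [(v, s)]) x)"
          using Suc.prems 2 by (intro arg_cong[of _ _ sum_list] map_cong refl) (subst (1 2) step, auto)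
        also have "\<dots> = fst (best p f its ?Rs (v # S) [x\<leftarrow>L. x ! v = s])"
        proof (rule Suc.IH)
          \<comment> \<open>Reading the observation \<open>(v, s)\<close> descends to child number
            \<open>s\<close>, which exists because \<open>s < m v\<close>.\<close>
          fix os' :: obs1 assume "length (os @ [(v, s)]) + length os' < b"
          then show "\<pi> ((os @ [(v, s)]) @ os') =
              tree_policy (snd (best p f its ?Rs (v # S) [x\<leftarrow>L. x ! v = s])) os'"
            using Suc.prems(4)[of "(v, s) # os'"] s by (simp add: 2(3) combine_def del: upt_Suc)
        qed (use Suc.prems in auto)
        finally show "(\<Sum>x\<leftarrow>[x\<leftarrow>L. x ! v = s]. ?g os x) = \<dots>" .
      qed
      also have "\<dots> = fst ?B" unfolding 2(3) by (simp add: combine_def o_def)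
      finally show ?thesis .
    qed
  qed simp
qed

section \<open>Decision trees as policies\<close>

fun tree_ok :: "nat \<Rightarrow> nat set \<Rightarrow> dtree \<Rightarrow> bool" where
  "tree_ok n S Halt \<longleftrightarrow> True"
| "tree_ok n S (Pick v ts) \<longleftrightarrow> v < n \<and> v \<notin> S \<and> (\<forall>t\<in>set ts. tree_ok n (insert v S) t)"

lemma tree_ok_best:
  assumes "fst ` set its \<subseteq> {..<n}"
  shows "tree_ok n (set S) (snd (best p f its Rs S L))"
proof (induction Rs arbitrary: S L)
  case (Cons R Rs)
  show ?case
    using foldl_better_cases[of S "\<lambda>v sl. combine v (map (\<lambda>s. best p f its Rs (v # S) [x\<leftarrow>L. x ! v = s]) sl)"
        "(halt_value p f R S L, Halt)" its]
  proof (elim disjE exE conjE)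
    fix v sl
    assume "(v, sl) \<in> set its" "v \<notin> set S" "foldl (\<lambda>a (v, sl). if v \<in> set S then a else better a
       (combine v (map (\<lambda>s. best p f its Rs (v # S) [x\<leftarrow>L. x ! v = s]) sl)))
       (halt_value p f R S L, Halt) its = combine v (map (\<lambda>s. best p f its Rs (v # S) [x\<leftarrow>L. x ! v = s]) sl)"
    then show ?thesis using assms Cons[of "v # S"] by (auto simp: combine_def)
  qed auto
qed simp

text \<open>A policy has to behave well on all histories, also on those that no play produces.
  \<open>tree_policy\<close> moves on as soon as a history leaves the tree; hence a selection means
  that the history is a path of the tree, and no item repeats along a path.\<close>

lemma tree_ok_policy:
  "tree_ok n S tr \<Longrightarrow> tree_policy tr os = Select v \<Longrightarrow> v < n \<and> v \<notin> S \<and> v \<notin> fst ` set os"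
proof (induction tr os arbitrary: S rule: tree_policy.induct)
  case (3 u ts x s os)
  then have "x = u" "s < length ts" "tree_policy (ts ! s) os = Select v"
    by (auto split: if_splits)
  moreover have "tree_ok n (insert u S) (ts ! s)" using 3 calculation by simp
  ultimately show ?case using "3.IH"[of "insert u S"] by simp
qed auto

section \<open>Global states as lists, and the backward induction\<close>

definition state_lists :: "sbmsm \<Rightarrow> nat list list" where
  "state_lists I = product_lists (map (\<lambda>v. [0..<nstates I v]) [0..<nitems I])"

definition numbered_states :: "sbmsm \<Rightarrow> (nat \<times> nat list) list" where
  "numbered_states I = map (\<lambda>v. (v, [0..<nstates I v])) [0..<nitems I]"

definition prob :: "sbmsm \<Rightarrow> nat \<Rightarrow> nat list \<Rightarrow> real" where
  "prob I t x = pmf (state_dist I t) (state_of x)"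

definition gain :: "sbmsm \<Rightarrow> nat \<Rightarrow> nat set \<Rightarrow> nat list \<Rightarrow> real" where
  "gain I t S x = reward I t S (state_of x)"

lemma in_state_lists:
  "x \<in> set (state_lists I) \<longleftrightarrow> length x = nitems I \<and> (\<forall>v<nitems I. x ! v < nstates I v)"
  unfolding state_lists_def product_lists_set by (auto simp: list_all2_conv_all_nth)

lemma distinct_state_lists: "distinct (state_lists I)"
  unfolding state_lists_def by (rule distinct_product_lists) auto

lemma state_of_nth: "v < length x \<Longrightarrow> state_of x v = x ! v"
  by (simp add: state_of_def)

lemma bij_betw_state_of: "bij_betw state_of (set (state_lists I)) (global_states I)"
proof (rule bij_betwI')
  fix x y assume xy: "x \<in> set (state_lists I)" "y \<in> set (state_lists I)"
  show "state_of x = state_of y \<longleftrightarrow> x = y"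
  proof
    assume eq: "state_of x = state_of y"
    show "x = y"
    proof (rule nth_equalityI)
      show "length x = length y" using xy by (simp add: in_state_lists)
      fix i assume "i < length x"
      then show "x ! i = y ! i" using fun_cong[OF eq, of i] xy by (simp add: state_of_nth in_state_lists)
    qed
  qed simp
next
  fix x assume "x \<in> set (state_lists I)"
  then show "state_of x \<in> global_states I"
    by (auto simp: global_states_def items_def in_state_lists state_of_def)
next
  fix h assume h: "h \<in> global_states I"
  let ?x = "map h [0..<nitems I]"
  have "?x \<in> set (state_lists I)" using h by (auto simp: global_states_def items_def in_state_lists)
  moreover have "h = state_of ?x"
  proof
    fix v show "h v = state_of ?x v"
      using h PiE_arb[of h "items I" _ v] by (cases "v < nitems I") (auto simp: state_of_def global_states_def items_def)
  qed
  ultimately show "\<exists>x\<in>set (state_lists I). h = state_of x" by blast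
qed

lemma finite_global_states: "finite (global_states I)"
  unfolding global_states_def items_def by (intro finite_PiE) auto

lemma length_state_lists: "length (state_lists I) = card (global_states I)"
  using bij_betw_same_card[OF bij_betw_state_of, of I] distinct_card[OF distinct_state_lists, of I] by simp

lemma sum_global_states: "(\<Sum>h\<in>global_states I. g h) = (\<Sum>x\<leftarrow>state_lists I. g (state_of x))"
  using sum.reindex_bij_betw[OF bij_betw_state_of, of g I]
  by (simp add: sum_list_distinct_conv_sum_set distinct_state_lists)

lemma set_state_dist:
  "valid_instance I \<Longrightarrow> t \<in> {1..rounds I} \<Longrightarrow> set_pmf (state_dist I t) \<subseteq> global_states I"
  by (simp add: valid_instance_def)

lemma expectation_state_dist:
  assumes "valid_instance I" "t \<in> {1..rounds I}"
  shows "measure_pmf.expectation (state_dist I t) g = (\<Sum>x\<leftarrow>state_lists I. prob I t x * g (state_of x))"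
proof -
  have "measure_pmf.expectation (state_dist I t) g
      = (\<Sum>h\<in>global_states I. pmf (state_dist I t) h * g h)"
    using set_state_dist[OF assms] finite_global_states
    by (subst integral_measure_pmf_real[of "global_states I"]) (auto simp: mult.commute)
  then show ?thesis unfolding sum_global_states by (simp add: prob_def)
qed

lemma prob_nonneg: "prob I t x \<ge> 0"
  by (simp add: prob_def)

text \<open>Bellman's recursion. For a valid instance and budgets up to that of the instance, the
  first component turns out to be \<open>opt_value I t i\<close>; see
  \<open>opt_value_eq\<close>.\<close>

function dp_best :: "sbmsm \<Rightarrow> nat \<Rightarrow> nat \<Rightarrow> real \<times> dtree" where
  "dp_best I t i = (if t > rounds I then (0, Halt)
     else best (prob I t) (gain I t) (numbered_states I)
       (map (\<lambda>j. fst (dp_best I (Suc t) j)) (rev [0..<Suc i])) [] (state_lists I))"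
  by pat_completeness auto
termination by (relation "Wellfounded.measure (\<lambda>(I, t, i). Suc (rounds I) - t)") auto

declare dp_best.simps [simp del]

lemma best_state_lists_upper:
  assumes "\<And>os v. length os < b \<Longrightarrow> \<pi> os = Select v \<Longrightarrow> v \<in> items I - fst ` set os"
  shows "(\<Sum>x\<leftarrow>state_lists I. prob I t x * (gain I t (fst ` set (play1 \<pi> (state_of x) b [])) x
      + R (b - length (play1 \<pi> (state_of x) b []))))
    \<le> fst (best (prob I t) (gain I t) (numbered_states I) (map R (rev [0..<Suc b])) [] (state_lists I))"
  unfolding numbered_states_def
  by (rule best_upper) (use assms in \<open>auto simp: in_state_lists state_of_nth items_def\<close>)

lemma best_state_lists_attained:
  assumes "\<And>os. length os < b \<Longrightarrow> \<pi> os = tree_policy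
    (snd (best (prob I t) (gain I t) (numbered_states I) (map R (rev [0..<Suc b])) [] (state_lists I))) os"
  shows "(\<Sum>x\<leftarrow>state_lists I. prob I t x * (gain I t (fst ` set (play1 \<pi> (state_of x) b [])) x
      + R (b - length (play1 \<pi> (state_of x) b []))))
    = fst (best (prob I t) (gain I t) (numbered_states I) (map R (rev [0..<Suc b])) [] (state_lists I))"
  unfolding numbered_states_def
  by (rule best_attained)
    (use assms in \<open>auto simp: in_state_lists state_of_nth items_def numbered_states_def simp del: upt_Suc\<close>)

lemma fst_numbered_states: "fst ` set (numbered_states I) \<subseteq> {..<nitems I}"
  by (auto simp: numbered_states_def)

lemma is_policy1_best:
  "is_policy1 I (tree_policy (snd (best p f (numbered_states I) Rs [] L)))"
  using tree_ok_policy[OF tree_ok_best[OF fst_numbered_states, of _ "[]"]]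
  by (auto simp: is_policy1_def items_def)

lemma optimal_policy1_best:
  assumes "valid_instance I" "t \<in> {1..rounds I}"
  shows "optimal_policy1 I t b (tree_policy (snd (best (prob I t) (gain I t) (numbered_states I)
      (map (opt_value I (t + 1)) (rev [0..<Suc b])) [] (state_lists I))))"
proof -
  have val: "value1 I t b \<pi> = (\<Sum>x\<leftarrow>state_lists I. prob I t x *
      (gain I t (fst ` set (play1 \<pi> (state_of x) b [])) x
      + opt_value I (t + 1) (b - length (play1 \<pi> (state_of x) b []))))" for \<pi>
    unfolding value1_def expectation_state_dist[OF assms] gain_def Let_def by simp
  show ?thesis
    unfolding optimal_policy1_def
  proof (intro conjI allI impI)
    fix \<pi>' assume "is_policy1 I \<pi>'"
    then show "value1 I t b \<pi>' \<le> value1 I t b (tree_policy (snd (best (prob I t) (gain I t) (numbered_states I)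
      (map (opt_value I (t + 1)) (rev [0..<Suc b])) [] (state_lists I))))"
      unfolding val
      by (subst best_state_lists_attained) (auto simp: is_policy1_def simp del: upt_Suc intro!: best_state_lists_upper)
  qed (rule is_policy1_best)
qed

section \<open>Reduction of several rounds to single rounds\<close>

lemma play_cong:
  "(\<And>s. s \<in> {t..rounds I} \<Longrightarrow> \<omega> s = \<omega>' s) \<Longrightarrow> play I \<pi> \<omega> b t os = play I \<pi> \<omega>' b t os"
proof (induction I \<pi> \<omega> b t os rule: play.induct)
  case (1 I \<pi> \<omega> b t os)
  show ?case
    by (subst (1 2) play.simps) (use 1 in \<open>auto split: action.split\<close>)
qed

text \<open>The selections of a round are final: play that starts at a later round adds no
  observation of an earlier one.\<close>

lemma play_append:
  "\<exists>os'. play I \<pi> \<omega> b t os = os @ os' \<and> (\<forall>(s, _)\<in>set os'. t \<le> s)"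
proof (induction I \<pi> \<omega> b t os rule: play.induct)
  case (1 I \<pi> \<omega> b t os)
  show ?case
  proof (cases "t > rounds I \<or> length os \<ge> b")
    case True
    then show ?thesis by (subst play.simps) auto
  next
    case False
    show ?thesis
    proof (cases "\<pi> t os")
      case (Select v)
      then have "play I \<pi> \<omega> b t os = play I \<pi> \<omega> b t (os @ [(t, v, \<omega> t v)])"
        using False by (subst play.simps) auto
      then show ?thesis using "1.IH"(1)[OF False Select] by fastforce
    next
      case Move
      then have "play I \<pi> \<omega> b t os = play I \<pi> \<omega> b (Suc t) os"
        using False by (subst play.simps) auto
      then show ?thesis using "1.IH"(2)[OF False Move] by fastforce
    qed
  qed
qed

text \<open>Freezing the observations \<open>os\<close> turns a multi-round policy into a
  single-round policy with the budget left over. The observations \<open>os1\<close> already made in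
  this round are kept general because the induction is on the budget remaining within the
  round.\<close>

lemma play_round:
  assumes "t \<le> rounds I"
  shows "play I \<pi> \<omega> b t (os @ map (Pair t) os1) = play I \<pi> \<omega> b (Suc t)
    (os @ map (Pair t) (play1 (\<lambda>os1. \<pi> t (os @ map (Pair t) os1)) (\<omega> t) (b - length os) os1))"
proof (induction "b - length os - length os1" arbitrary: os1 rule: less_induct)
  case less
  let ?\<pi> = "\<lambda>os1. \<pi> t (os @ map (Pair t) os1)"
  show ?case
  proof (cases "b - length os \<le> length os1")
    case True
    \<comment> \<open>Without budget both plays stop at once, including the one that has already
      moved to the next round.\<close>
    have "play1 ?\<pi> (\<omega> t) (b - length os) os1 = os1"
      using True by (subst play1.simps) simp
    then show ?thesis using True by (subst (1 2) play.simps) auto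
  next
    case False
    then have nb: "\<not> b \<le> length os + length os1" by simp
    show ?thesis
    proof (cases "?\<pi> os1")
      case Move
      then have "play1 ?\<pi> (\<omega> t) (b - length os) os1 = os1" by (subst play1.simps) simp
      then show ?thesis using Move assms nb by (subst play.simps) simp
    next
      case (Select v)
      have "play I \<pi> \<omega> b t (os @ map (Pair t) os1) = play I \<pi> \<omega> b t (os @ map (Pair t) (os1 @ [(v, \<omega> t v)]))"
        using Select assms nb by (subst play.simps) simp
      also have "\<dots> = play I \<pi> \<omega> b (Suc t)
         (os @ map (Pair t) (play1 ?\<pi> (\<omega> t) (b - length os) (os1 @ [(v, \<omega> t v)])))"
        using False by (intro less) simp
      also have "play1 ?\<pi> (\<omega> t) (b - length os) (os1 @ [(v, \<omega> t v)]) = play1 ?\<pi> (\<omega> t) (b - length os) os1"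
        using Select False by (subst (2) play1.simps) simp
      finally show ?thesis .
    qed
  qed
qed

section \<open>Continuation values after a fixed history\<close>

definition future :: "sbmsm \<Rightarrow> nat \<Rightarrow> nat \<Rightarrow> obs \<Rightarrow> policy \<Rightarrow> (nat \<Rightarrow> state) \<Rightarrow> real" where
  "future I t b os \<pi> \<omega> =
     (\<Sum>t'=t..rounds I. reward I t' (selected t' (play I \<pi> \<omega> b t os)) (\<omega> t'))"

text \<open>The past is an arbitrary fixed list \<open>os\<close> and only the rounds from
  \<open>t\<close> on are random. Independence makes this enough even for policies that remember
  everything.\<close>

definition future_value :: "sbmsm \<Rightarrow> nat \<Rightarrow> nat \<Rightarrow> obs \<Rightarrow> policy \<Rightarrow> real" where
  "future_value I t b os \<pi> =
     measure_pmf.expectation (Pi_pmf {t..rounds I} undefined (state_dist I)) (future I t b os \<pi>)"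

lemma future_cong:
  assumes "\<And>s. s \<in> {t..rounds I} \<Longrightarrow> \<omega> s = \<omega>' s"
  shows "future I t b os \<pi> \<omega> = future I t b os \<pi> \<omega>'"
proof -
  have "play I \<pi> \<omega> b t os = play I \<pi> \<omega>' b t os" using assms by (rule play_cong)
  then show ?thesis unfolding future_def using assms by (intro sum.cong) auto
qed

text \<open>\<open>value_from\<close> averages over all rounds, but play started at round
  \<open>t\<close> reads only the states of later or equal rounds, so the marginal distribution of
  these rounds suffices.\<close>

lemma value_from_eq:
  assumes "t \<ge> 1"
  shows "value_from I t b \<pi> = future_value I t b [] \<pi>"
proof -
  have "Pi_pmf {t..rounds I} undefined (state_dist I)
      = map_pmf (\<lambda>f x. if x \<in> {t..rounds I} then f x else undefined) (all_rounds I)"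
    unfolding all_rounds_def using assms by (intro Pi_pmf_subset) auto
  then show ?thesis
    unfolding value_from_def future_value_def
    by (simp add: future_def[symmetric]) (intro Bochner_Integration.integral_cong refl future_cong, simp)
qed

lemma selected_append: "selected t (os @ os') = selected t os \<union> selected t os'"
  by (auto simp: selected_def)

lemma selected_map_Pair: "selected t (map (Pair t) os) = fst ` set os"
  by (force simp: selected_def)

lemma selected_eq_empty: "(\<forall>(s, _)\<in>set os. s \<noteq> t) \<Longrightarrow> selected t os = {}"
  by (auto simp: selected_def)

lemma finite_set_Pi_state_dist:
  assumes "valid_instance I" "t \<ge> 1"
  shows "finite (set_pmf (Pi_pmf {t..rounds I} undefined (state_dist I)))"
proof -
  have "set_pmf (Pi_pmf {t..rounds I} undefined (state_dist I))
     \<subseteq> PiE_dflt {t..rounds I} undefined (set_pmf \<circ> state_dist I)"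
    by (rule set_Pi_pmf_subset') simp
  moreover have "finite (PiE_dflt {t..rounds I} undefined (set_pmf \<circ> state_dist I))"
    using assms finite_subset[OF set_state_dist finite_global_states]
    by (intro finite_PiE_dflt) auto
  ultimately show ?thesis by (rule finite_subset)
qed

text \<open>The Bellman equation of a fixed policy. Since \<open>os\<close> lies before round
  \<open>t\<close> and all later play lies after it, the selection of round \<open>t\<close> is
  exactly what the single-round play \<open>P x\<close> selects.\<close>

lemma future_value_rec:
  fixes \<pi> :: policy and b :: nat
  assumes I: "valid_instance I" and t: "t \<in> {1..rounds I}" and os: "\<forall>(s, _)\<in>set os. s < t"
  defines "P \<equiv> \<lambda>x. play1 (\<lambda>os1. \<pi> t (os @ map (Pair t) os1)) (state_of x) (b - length os) []"
  shows "future_value I t b os \<pi> = (\<Sum>x\<leftarrow>state_lists I. prob I t x *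
     (gain I t (fst ` set (P x)) x + future_value I (Suc t) b (os @ map (Pair t) (P x)) \<pi>))"
proof -
  let ?Q = "Pi_pmf {Suc t..rounds I} undefined (state_dist I)"
  have ins: "{t..rounds I} = insert t {Suc t..rounds I}" using t by auto
  have fin: "finite (set_pmf ?Q)" by (rule finite_set_Pi_state_dist) (use I in auto)
  have fut: "future I t b os \<pi> (fun_upd \<omega> t (state_of x))
      = gain I t (fst ` set (P x)) x + future I (Suc t) b (os @ map (Pair t) (P x)) \<pi> \<omega>" for \<omega> x
  proof -
    let ?\<omega> = "fun_upd \<omega> t (state_of x)"
    have pl: "play I \<pi> ?\<omega> b t os = play I \<pi> ?\<omega> b (Suc t) (os @ map (Pair t) (P x))"
      using play_round[of t I \<pi> ?\<omega> b os "[]"] t by (simp add: P_def)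
    obtain os' where os': "play I \<pi> ?\<omega> b (Suc t) (os @ map (Pair t) (P x)) = (os @ map (Pair t) (P x)) @ os'"
      "\<forall>(s, _)\<in>set os'. Suc t \<le> s" using play_append by blast
    have "selected t os = {}" "selected t os' = {}"
      using os os'(2) by (auto intro!: selected_eq_empty)
    then have "selected t (play I \<pi> ?\<omega> b t os) = fst ` set (P x)"
      unfolding pl os'(1) by (simp add: selected_append selected_map_Pair)
    then have "future I t b os \<pi> ?\<omega> = gain I t (fst ` set (P x)) x + future I (Suc t) b (os @ map (Pair t) (P x)) \<pi> ?\<omega>"
      unfolding future_def gain_def ins by (simp add: pl)
    also have "future I (Suc t) b (os @ map (Pair t) (P x)) \<pi> ?\<omega> = future I (Suc t) b (os @ map (Pair t) (P x)) \<pi> \<omega>"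
      by (rule future_cong) auto
    finally show ?thesis .
  qed
  \<comment> \<open>Independence enters here: round \<open>t\<close> is drawn separately from the
    later rounds.\<close>
  have "Pi_pmf {t..rounds I} undefined (state_dist I) = state_dist I t \<bind> (\<lambda>y. map_pmf (\<lambda>f. fun_upd f t y) ?Q)"
    unfolding ins by (subst Pi_pmf_insert') (auto simp: map_pmf_def)
  then have "future_value I t b os \<pi> = (\<Sum>h\<in>global_states I. pmf (state_dist I t) h *
      measure_pmf.expectation ?Q (\<lambda>\<omega>. future I t b os \<pi> (fun_upd \<omega> t h)))"
    unfolding future_value_def using fin set_state_dist[OF I t]
    by (simp add: pmf_expectation_bind[OF finite_global_states])
  also have "\<dots> = (\<Sum>x\<leftarrow>state_lists I. prob I t x * measure_pmf.expectation ?Q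
      (\<lambda>\<omega>. gain I t (fst ` set (P x)) x + future I (Suc t) b (os @ map (Pair t) (P x)) \<pi> \<omega>))"
    unfolding sum_global_states prob_def fut ..
  also have "\<dots> = (\<Sum>x\<leftarrow>state_lists I. prob I t x *
     (gain I t (fst ` set (P x)) x + future_value I (Suc t) b (os @ map (Pair t) (P x)) \<pi>))"
    unfolding future_value_def
    by (subst Bochner_Integration.integral_add) (auto intro: integrable_measure_pmf_finite[OF fin])
  finally show ?thesis .
qed

lemma future_value_last: "t > rounds I \<Longrightarrow> future_value I t b os \<pi> = 0"
  by (simp add: future_value_def future_def[abs_def])

text \<open>Remembering earlier rounds does not help: the bound depends on \<open>os\<close> only
  through its length. With the past frozen, the policy is a legitimate single-round policy, and by
  backward induction the later rounds are bounded in the same way.\<close>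

lemma future_value_upper:
  assumes I: "valid_instance I" and \<pi>: "is_policy I \<pi>" and b: "b \<le> budget I"
    and "t \<ge> 1" "\<forall>(s, _)\<in>set os. s < t"
  shows "future_value I t b os \<pi> \<le> fst (dp_best I t (b - length os))"
  using assms(4-)
proof (induction "Suc (rounds I) - t" arbitrary: t os)
  case 0
  then show ?case by (simp add: future_value_last dp_best.simps)
next
  case (Suc k)
  then have t: "t \<in> {1..rounds I}" by auto
  let ?\<pi> = "\<lambda>os1. \<pi> t (os @ map (Pair t) os1)"
  let ?P = "\<lambda>x. play1 ?\<pi> (state_of x) (b - length os) []"
  have "future_value I t b os \<pi> = (\<Sum>x\<leftarrow>state_lists I. prob I t x *
     (gain I t (fst ` set (?P x)) x + future_value I (Suc t) b (os @ map (Pair t) (?P x)) \<pi>))"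
    by (rule future_value_rec) (use I t Suc.prems in auto)
  also have "\<dots> \<le> (\<Sum>x\<leftarrow>state_lists I. prob I t x *
     (gain I t (fst ` set (?P x)) x + fst (dp_best I (Suc t) (b - length os - length (?P x)))))"
  proof (intro sum_list_mono mult_left_mono add_left_mono prob_nonneg)
    fix x
    have "future_value I (Suc t) b (os @ map (Pair t) (?P x)) \<pi>
       \<le> fst (dp_best I (Suc t) (b - length (os @ map (Pair t) (?P x))))"
      using Suc.prems Suc.hyps(2) by (intro Suc.hyps(1)) fastforce+
    then show "future_value I (Suc t) b (os @ map (Pair t) (?P x)) \<pi>
       \<le> fst (dp_best I (Suc t) (b - length os - length (?P x)))" by simp
  qed
  also have "\<dots> \<le> fst (best (prob I t) (gain I t) (numbered_states I)
      (map (\<lambda>j. fst (dp_best I (Suc t) j)) (rev [0..<Suc (b - length os)])) [] (state_lists I))"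
  proof (rule best_state_lists_upper)
    fix os1 :: obs1 and v
    assume os1: "length os1 < b - length os" "?\<pi> os1 = Select v"
    \<comment> \<open>\<open>is_policy\<close> speaks only of histories shorter than the budget of
      the instance; this is what \<open>b \<le> budget I\<close> provides.\<close>
    have "length (os @ map (Pair t) os1) < budget I" using os1 b by simp
    then have "v \<in> items I - selected t (os @ map (Pair t) os1)"
      using \<pi> t os1(2) unfolding is_policy_def by blast
    then show "v \<in> items I - fst ` set os1" by (simp add: selected_append selected_map_Pair)
  qed
  also have "\<dots> = fst (dp_best I t (b - length os))"
    using t by (subst (2) dp_best.simps) simp
  finally show ?case .
qed

text \<open>The policy of the table, but with an arbitrary initial budget \<open>i\<close>:
  \<open>opt_value\<close> has to be attained for every budget, not only for that of the
  instance.\<close>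

definition dp_policy :: "sbmsm \<Rightarrow> nat \<Rightarrow> policy" where
  "dp_policy I i t os = tree_policy (snd (dp_best I t (i - length (filter (\<lambda>(t', _, _). t' < t) os))))
     (map snd (filter (\<lambda>(t', _, _). t' = t) os))"

text \<open>Agreement with \<open>dp_policy\<close> is required in the existing rounds only, because
  a table says nothing meaningful about other rounds.\<close>

lemma future_value_attained:
  assumes I: "valid_instance I" and \<pi>: "\<And>t os. t \<in> {1..rounds I} \<Longrightarrow> \<pi> t os = dp_policy I b t os"
    and "t \<ge> 1" "\<forall>(s, _)\<in>set os. s < t"
  shows "future_value I t b os \<pi> = fst (dp_best I t (b - length os))"
  using assms(3-)
proof (induction "Suc (rounds I) - t" arbitrary: t os)
  case 0
  then show ?case by (simp add: future_value_last dp_best.simps)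
next
  case (Suc k)
  then have t: "t \<in> {1..rounds I}" by auto
  let ?\<pi> = "\<lambda>os1. \<pi> t (os @ map (Pair t) os1)"
  let ?P = "\<lambda>x. play1 ?\<pi> (state_of x) (b - length os) []"
  have "future_value I t b os \<pi> = (\<Sum>x\<leftarrow>state_lists I. prob I t x *
     (gain I t (fst ` set (?P x)) x + future_value I (Suc t) b (os @ map (Pair t) (?P x)) \<pi>))"
    by (rule future_value_rec) (use I t Suc.prems in auto)
  also have "\<dots> = (\<Sum>x\<leftarrow>state_lists I. prob I t x *
     (gain I t (fst ` set (?P x)) x + fst (dp_best I (Suc t) (b - length os - length (?P x)))))"
  proof (intro arg_cong[of _ _ sum_list] map_cong refl)
    fix x
    have "future_value I (Suc t) b (os @ map (Pair t) (?P x)) \<pi>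
       = fst (dp_best I (Suc t) (b - length (os @ map (Pair t) (?P x))))"
      using Suc.prems Suc.hyps(2) by (intro Suc.hyps(1)) fastforce+
    then show "prob I t x *
     (gain I t (fst ` set (?P x)) x + future_value I (Suc t) b (os @ map (Pair t) (?P x)) \<pi>) = prob I t x *
     (gain I t (fst ` set (?P x)) x + fst (dp_best I (Suc t) (b - length os - length (?P x))))" by simp
  qed
  also have "\<dots> = fst (best (prob I t) (gain I t) (numbered_states I)
      (map (\<lambda>j. fst (dp_best I (Suc t) j)) (rev [0..<Suc (b - length os)])) [] (state_lists I))"
  proof (rule best_state_lists_attained)
    fix os1 :: obs1
    \<comment> \<open>When the round begins all observations in \<open>os\<close> are earlier. Thus
      the budget looked up is \<open>b - length os\<close>, and the tree is walked along
      \<open>os1\<close> alone.\<close>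
    have "filter (\<lambda>(t', _, _). t' < t) os = os" "filter (\<lambda>(t', _, _). t' = t) os = []"
      using Suc.prems by (auto simp: filter_id_conv filter_empty_conv)
    moreover have "filter (\<lambda>(t', _, _). t' < t) (map (Pair t) os1) = []"
      "filter (\<lambda>(t', _, _). t' = t) (map (Pair t) os1) = map (Pair t) os1"
      by (auto simp: filter_id_conv filter_empty_conv)
    ultimately have "?\<pi> os1 = tree_policy (snd (dp_best I t (b - length os))) os1"
      using \<pi>[OF t] by (simp add: dp_policy_def o_def)
    also have "dp_best I t (b - length os) = best (prob I t) (gain I t) (numbered_states I)
      (map (\<lambda>j. fst (dp_best I (Suc t) j)) (rev [0..<Suc (b - length os)])) [] (state_lists I)"
      using t by (subst dp_best.simps) simp
    finally show "?\<pi> os1 = tree_policy (snd (best (prob I t) (gain I t) (numbered_states I)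
      (map (\<lambda>j. fst (dp_best I (Suc t) j)) (rev [0..<Suc (b - length os)])) [] (state_lists I))) os1" .
  qed
  also have "\<dots> = fst (dp_best I t (b - length os))"
    using t by (subst (2) dp_best.simps) simp
  finally show ?case .
qed

lemma is_policy_dp:
  assumes "\<And>t os. t \<in> {1..rounds I} \<Longrightarrow> \<pi> t os = dp_policy I b t os"
  shows "is_policy I \<pi>"
  unfolding is_policy_def
proof (intro ballI allI impI)
  fix t os v assume t: "t \<in> {1..rounds I}" and "\<pi> t os = Select v"
  then have sel: "dp_policy I b t os = Select v" using assms by simp
  let ?tr = "snd (dp_best I t (b - length (filter (\<lambda>(t', _, _). t' < t) os)))"
  have "tree_ok (nitems I) {} ?tr"
    by (subst dp_best.simps)
      (use tree_ok_best[OF fst_numbered_states, of _ "[]"] in \<open>simp del: best.simps upt_Suc\<close>)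
  from tree_ok_policy[OF this sel[unfolded dp_policy_def]]
  have "v < nitems I" "v \<notin> fst ` set (map snd (filter (\<lambda>(t', _, _). t' = t) os))" by auto
  moreover have "selected t os \<subseteq> fst ` set (map snd (filter (\<lambda>(t', _, _). t' = t) os))"
    by (force simp: selected_def)
  ultimately show "v \<in> items I - selected t os" by (auto simp: items_def)
qed

text \<open>The supremum is a maximum, attained by \<open>dp_policy I b\<close>.\<close>

lemma opt_value_eq:
  assumes "valid_instance I" "t \<ge> 1" "b \<le> budget I"
  shows "opt_value I t b = fst (dp_best I t b)"
  unfolding opt_value_def
proof (rule cSup_eq_maximum)
  have "value_from I t b (dp_policy I b) = fst (dp_best I t b)"
    using future_value_attained[OF assms(1) refl assms(2), of "[]" b] assms(2) by (simp add: value_from_eq)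
  moreover have "is_policy I (dp_policy I b)" by (rule is_policy_dp) simp
  ultimately show "fst (dp_best I t b) \<in> value_from I t b ` {\<pi>. is_policy I \<pi>}" by (metis imageI mem_Collect_eq)
next
  fix y assume "y \<in> value_from I t b ` {\<pi>. is_policy I \<pi>}"
  then show "y \<le> fst (dp_best I t b)"
    using future_value_upper[OF assms(1) _ assms(3,2), of _ "[]"] assms(2) by (auto simp: value_from_eq)
qed

definition dp_table :: "sbmsm \<Rightarrow> dtree list list" where
  "dp_table I = map (\<lambda>t. map (\<lambda>j. snd (dp_best I t j)) [0..<Suc (budget I)]) [1..<Suc (rounds I)]"

lemma is_table_dp: "is_table I (dp_table I)"
  by (auto simp: is_table_def dp_table_def)

lemma table_policy_dp:
  assumes "t \<in> {1..rounds I}"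
  shows "table_policy I (dp_table I) t os = dp_policy I (budget I) t os"
proof -
  have "dp_table I ! (t - 1) = map (\<lambda>j. snd (dp_best I t j)) [0..<Suc (budget I)]"
    using assms unfolding dp_table_def by (subst nth_map) (auto simp del: upt_Suc)
  then have "dp_table I ! (t - 1) ! j = snd (dp_best I t j)" if "j \<le> budget I" for j
    using that by (simp del: upt_Suc)
  then show ?thesis by (simp add: table_policy_def dp_policy_def)
qed

lemma optimal_policy_dp:
  assumes "valid_instance I"
  shows "optimal_policy I (table_policy I (dp_table I))"
  unfolding optimal_policy_def
proof (intro conjI allI impI)
  show "is_policy I (table_policy I (dp_table I))"
    by (rule is_policy_dp) (rule table_policy_dp)
  fix \<pi>' assume "is_policy I \<pi>'"
  then have "sigma I \<pi>' \<le> fst (dp_best I 1 (budget I))"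
    using future_value_upper[OF assms _ order_refl, of \<pi>' 1 "[]"] by (simp add: sigma_def value_from_eq)
  also have "\<dots> = sigma I (table_policy I (dp_table I))"
    using future_value_attained[OF assms table_policy_dp, where os = "[]" and t = 1]
    by (simp add: sigma_def value_from_eq)
  finally show "sigma I \<pi>' \<le> sigma I (table_policy I (dp_table I))" .
qed

section \<open>Programs and upper bounds on their cost\<close>

text \<open>Exact costs depend on the branches taken. With upper bounds the cost can stay schematic
  while the rules are resolved against the code; a single application of \<open>evb_mono\<close>
  then leaves one inequality between numbers at the end.\<close>

definition evb :: "(real \<Rightarrow> nat) \<Rightarrow> program \<Rightarrow> (data \<Rightarrow> data) \<Rightarrow> data list \<Rightarrow> expr \<Rightarrow> data \<Rightarrow> nat \<Rightarrow> bool" where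
  "evb w prog orc env e v C \<longleftrightarrow> (\<exists>c\<le>C. eval w prog orc env e v c)"

definition evbs :: "(real \<Rightarrow> nat) \<Rightarrow> program \<Rightarrow> (data \<Rightarrow> data) \<Rightarrow> data list \<Rightarrow> expr list \<Rightarrow> data list \<Rightarrow> nat \<Rightarrow> bool" where
  "evbs w prog orc env es vs C \<longleftrightarrow> (\<exists>c\<le>C. evals w prog orc env es vs c)"

lemma evb_mono: "evb w prog orc env e v C \<Longrightarrow> C \<le> C' \<Longrightarrow> evb w prog orc env e v C'"
  unfolding evb_def using order_trans by blast

text \<open>One rule for each index, so that unification alone looks up a variable. Index 1 is
  covered in both of its notations, \<open>1\<close> and \<open>Suc 0\<close>.\<close>

lemma evb_Var:
  "evb w prog orc (a0 # env) (Var 0) a0 1"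
  "evb w prog orc (a0 # a1 # env) (Var 1) a1 1"
  "evb w prog orc (a0 # a1 # env) (Var (Suc 0)) a1 1"
  "evb w prog orc (a0 # a1 # a2 # env) (Var 2) a2 1"
  "evb w prog orc (a0 # a1 # a2 # a3 # env) (Var 3) a3 1"
  "evb w prog orc (a0 # a1 # a2 # a3 # a4 # env) (Var 4) a4 1"
  "evb w prog orc (a0 # a1 # a2 # a3 # a4 # a5 # env) (Var 5) a5 1"
  "evb w prog orc (a0 # a1 # a2 # a3 # a4 # a5 # a6 # env) (Var 6) a6 1"
  "evb w prog orc (a0 # a1 # a2 # a3 # a4 # a5 # a6 # a7 # env) (Var 7) a7 1"
  "evb w prog orc (a0 # a1 # a2 # a3 # a4 # a5 # a6 # a7 # a8 # env) (Var 8) a8 1"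
  unfolding evb_def
  using eval_evals.Var[of 0 "a0 # env" w prog orc]
    eval_evals.Var[of 1 "a0 # a1 # env" w prog orc]
    eval_evals.Var[of 2 "a0 # a1 # a2 # env" w prog orc]
    eval_evals.Var[of 3 "a0 # a1 # a2 # a3 # env" w prog orc]
    eval_evals.Var[of 4 "a0 # a1 # a2 # a3 # a4 # env" w prog orc]
    eval_evals.Var[of 5 "a0 # a1 # a2 # a3 # a4 # a5 # env" w prog orc]
    eval_evals.Var[of 6 "a0 # a1 # a2 # a3 # a4 # a5 # a6 # env" w prog orc]
    eval_evals.Var[of 7 "a0 # a1 # a2 # a3 # a4 # a5 # a6 # a7 # env" w prog orc]
    eval_evals.Var[of 8 "a0 # a1 # a2 # a3 # a4 # a5 # a6 # a7 # a8 # env" w prog orc]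
  by auto

lemma evb_LeafE: "evb w prog orc env LeafE Leaf 1"
  unfolding evb_def using LeafE by blast

lemma evb_NumE: "w (of_int k) \<le> W \<Longrightarrow> evb w prog orc env (NumE k) (Num (of_int k)) (1 + W)"
  unfolding evb_def using eval_evals.NumE[of w prog orc env k] by (meson add_left_mono)

lemma evb_NodeE:
  "evb w prog orc env e1 v1 c1 \<Longrightarrow> evb w prog orc env e2 v2 c2 \<Longrightarrow>
   evb w prog orc env (NodeE e1 e2) (Node v1 v2) (1 + c1 + c2)"
  unfolding evb_def by (meson NodeE add_le_mono order_refl)

lemma evb_Fst: "evb w prog orc env e (Node a b) c \<Longrightarrow> evb w prog orc env (Fst e) a (1 + c)"
  unfolding evb_def using eval_evals.Fst[of w prog orc env e "Node a b"]
  by (metis add_left_mono fst_of.simps(1))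

lemma evb_Snd: "evb w prog orc env e (Node a b) c \<Longrightarrow> evb w prog orc env (Snd e) b (1 + c)"
  unfolding evb_def using eval_evals.Snd[of w prog orc env e "Node a b"]
  by (metis add_left_mono snd_of.simps(1))

text \<open>The rules for conditionals are split by the shape of the tested value; resolution then
  leaves no inequality with \<open>Leaf\<close> to prove.\<close>

lemma evb_If_Node:
  "evb w prog orc env e1 (Node a b) c1 \<Longrightarrow> evb w prog orc env e2 v c2 \<Longrightarrow>
   evb w prog orc env (IfE e1 e2 e3) v (1 + c1 + c2)"
  unfolding evb_def by (meson If_True add_le_mono data.distinct order_refl)

lemma evb_If_Num:
  "evb w prog orc env e1 (Num x) c1 \<Longrightarrow> evb w prog orc env e2 v c2 \<Longrightarrow>
   evb w prog orc env (IfE e1 e2 e3) v (1 + c1 + c2)"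
  unfolding evb_def by (meson If_True add_le_mono data.distinct order_refl)

lemma evb_If_Leaf:
  "evb w prog orc env e1 Leaf c1 \<Longrightarrow> evb w prog orc env e3 v c2 \<Longrightarrow>
   evb w prog orc env (IfE e1 e2 e3) v (1 + c1 + c2)"
  unfolding evb_def by (meson If_False add_le_mono order_refl)

lemma evb_LetE:
  "evb w prog orc env e1 v1 c1 \<Longrightarrow> evb w prog orc (v1 # env) e2 v2 c2 \<Longrightarrow>
   evb w prog orc env (LetE e1 e2) v2 (1 + c1 + c2)"
  unfolding evb_def by (meson LetE add_le_mono order_refl)

lemma evb_Arith:
  assumes "evb w prog orc env e1 (Num x) c1" "evb w prog orc env e2 (Num y) c2" "w x \<le> W" "w y \<le> W"
  shows "evb w prog orc env (Arith op e1 e2) (Num (apply_arith op x y)) (1 + c1 + c2 + 2 * W)"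
proof -
  obtain d1 d2 where d: "eval w prog orc env e1 (Num x) d1" "d1 \<le> c1"
    "eval w prog orc env e2 (Num y) d2" "d2 \<le> c2"
    using assms unfolding evb_def by blast
  show ?thesis
    unfolding evb_def
    by (rule exI[of _ "1 + d1 + d2 + w x + w y"])
      (use eval_evals.Arith[OF d(1,3), of op] d assms in auto)
qed

lemmas evb_Add = evb_Arith[where op = Add, unfolded apply_arith.simps]
lemmas evb_Sub = evb_Arith[where op = Sub, unfolded apply_arith.simps]
lemmas evb_Mul = evb_Arith[where op = Mul, unfolded apply_arith.simps]

lemma evb_Less:
  assumes "evb w prog orc env e1 (Num x) c1" "evb w prog orc env e2 (Num y) c2" "w x \<le> W" "w y \<le> W"
  shows "x < y \<Longrightarrow> evb w prog orc env (Less e1 e2) (Num 1) (1 + c1 + c2 + 2 * W)"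
    and "\<not> x < y \<Longrightarrow> evb w prog orc env (Less e1 e2) Leaf (1 + c1 + c2 + 2 * W)"
proof -
  obtain d1 d2 where d: "eval w prog orc env e1 (Num x) d1" "d1 \<le> c1"
    "eval w prog orc env e2 (Num y) d2" "d2 \<le> c2"
    using assms unfolding evb_def by blast
  have le: "1 + d1 + d2 + w x + w y \<le> 1 + c1 + c2 + 2 * W" using d assms by auto
  from eval_evals.Less[OF d(1,3)] le
  show "x < y \<Longrightarrow> evb w prog orc env (Less e1 e2) (Num 1) (1 + c1 + c2 + 2 * W)"
    and "\<not> x < y \<Longrightarrow> evb w prog orc env (Less e1 e2) Leaf (1 + c1 + c2 + 2 * W)"
    unfolding evb_def by auto
qed

lemma evbs_Nil: "evbs w prog orc env [] [] 0"
  unfolding evbs_def using Empty by blast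

lemma evbs_Cons:
  "evb w prog orc env e v c1 \<Longrightarrow> evbs w prog orc env es vs c2 \<Longrightarrow>
   evbs w prog orc env (e # es) (v # vs) (c1 + c2)"
  unfolding evb_def evbs_def by (meson Cons add_le_mono)

lemma evb_Call:
  "i < length prog \<Longrightarrow> evbs w prog orc env es vs c1 \<Longrightarrow> evb w prog orc vs (prog ! i) v c2 \<Longrightarrow>
   evb w prog orc env (Call i es) v (1 + c1 + c2)"
  unfolding evb_def evbs_def by (meson Call add_le_mono order_refl)

lemma evb_Query:
  assumes "evb w prog orc env e v c" "orc v = u" "data_size w v + data_size w u \<le> q"
  shows "evb w prog orc env (Query e) u (1 + c + q)"
proof -
  obtain d where d: "eval w prog orc env e v d" "d \<le> c" using assms unfolding evb_def by blast
  show ?thesis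
    unfolding evb_def
    by (rule exI[of _ "1 + d + data_size w v + data_size w (orc v)"])
      (use eval_evals.Query[OF d(1)] d assms in auto)
qed

lemmas evb_intros = evb_Var evb_LeafE evb_NodeE evb_Fst evb_Snd evb_LetE evbs_Nil evbs_Cons

text \<open>
  In a program \<open>main # code_common\<close> the functions below have the numbers 1 to 15, in this order. Their
  arguments are: 1 list, index; 2 item, state, \<open>L\<close>; 3 item, \<open>S\<close>; 4 round, \<open>R\<close>, \<open>S\<close>, \<open>L\<close>;
  5 numbered state sets, round, \<open>Rs\<close>, \<open>S\<close>, \<open>L\<close>; 6 the numbered state sets still to be tried and the
  best result so far, followed by the arguments of 5; 7 the local states still to be tried and the item,
  followed by the arguments of 5; 8 element, list of lists, tail; 9 list, list of lists; 10 list of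
  lists; 11 list of lists, first number; 12 list, accumulator; 13 numbered state sets, round, \<open>Rs\<close>, all
  states, accumulator; 14 budget; 15 rounds, numbered state sets, all states, budget.
\<close>

definition nth_code :: expr where
  "nth_code = IfE (Less (Var 1) (NumE 1)) (Fst (Var 0)) (Call 1 [Snd (Var 0), Arith Sub (Var 1) (NumE 1)])"

text \<open>The language compares numbers only by \<open>Less\<close>; equality is two failed
  comparisons, here and in \<open>member_code\<close>.\<close>

definition filter_code :: expr where
  "filter_code = IfE (Var 2)
     (LetE (Call 2 [Var 0, Var 1, Snd (Var 2)]) (LetE (Call 1 [Fst (Var 3), Var 1])
       (IfE (Less (Var 0) (Var 3)) (Var 1) (IfE (Less (Var 3) (Var 0)) (Var 1)
         (NodeE (Fst (Var 4)) (Var 1))))))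
     LeafE"

definition member_code :: expr where
  "member_code = IfE (Var 1)
     (IfE (Less (Var 0) (Fst (Var 1))) (Call 3 [Var 0, Snd (Var 1)])
       (IfE (Less (Fst (Var 1)) (Var 0)) (Call 3 [Var 0, Snd (Var 1)]) (NumE 1)))
     LeafE"

definition halt_code :: expr where
  "halt_code = IfE (Var 3)
     (Arith Add
       (Arith Mul (Query (NodeE (Var 0) (NodeE (Fst (Var 3)) LeafE)))
         (Arith Add (Query (NodeE (Var 0) (NodeE (Fst (Var 3)) (NodeE (Var 2) LeafE)))) (Var 1)))
       (Call 4 [Var 0, Var 1, Var 2, Snd (Var 3)]))
     (NumE 0)"

text \<open>The numbered state sets are passed twice to function 6: the first copy is consumed by
  the loop, the second is kept for the recursive calls. Inside \<open>LetE\<close> every argument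
  has moved up by one index.\<close>

definition best_code :: expr where
  "best_code = IfE (Var 4)
     (LetE (NodeE (Call 4 [Var 1, Fst (Var 2), Var 3, Var 4]) LeafE)
       (IfE (Snd (Var 3)) (Call 6 [Var 1, Var 0, Var 1, Var 2, Var 3, Var 4, Var 5]) (Var 0)))
     (NodeE (NumE 0) LeafE)"

definition choose_code :: expr where
  "choose_code = IfE (Var 0)
     (IfE (Call 3 [Fst (Fst (Var 0)), Var 5])
       (Call 6 [Snd (Var 0), Var 1, Var 2, Var 3, Var 4, Var 5, Var 6])
       (LetE (Call 7 [Snd (Fst (Var 0)), Fst (Fst (Var 0)), Var 2, Var 3, Snd (Var 4),
            NodeE (Fst (Fst (Var 0))) (Var 5), Var 6])
         (Call 6 [Snd (Var 1),
            IfE (Less (Fst (Var 2)) (Fst (Var 0)))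
              (NodeE (Fst (Var 0)) (NodeE (Fst (Fst (Var 1))) (Snd (Var 0)))) (Var 2),
            Var 3, Var 4, Var 5, Var 6, Var 7])))
     (Var 1)"

definition subtrees_code :: expr where
  "subtrees_code = IfE (Var 0)
     (LetE (Call 5 [Var 2, Var 3, Var 4, Var 5, Call 2 [Var 1, Fst (Var 0), Var 6]])
       (LetE (Call 7 [Snd (Var 1), Var 2, Var 3, Var 4, Var 5, Var 6, Var 7])
         (NodeE (Arith Add (Fst (Var 1)) (Fst (Var 0))) (NodeE (Snd (Var 1)) (Snd (Var 0))))))
     (NodeE (NumE 0) LeafE)"

definition cons_all_code :: expr where
  "cons_all_code = IfE (Var 1)
     (NodeE (NodeE (Var 0) (Fst (Var 1))) (Call 8 [Var 0, Snd (Var 1), Var 2]))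
     (Var 2)"

definition extend_code :: expr where
  "extend_code = IfE (Var 0) (Call 8 [Fst (Var 0), Var 1, Call 9 [Snd (Var 0), Var 1]]) LeafE"

text \<open>\<open>NodeE LeafE LeafE\<close> is the list whose only element is the empty list, that
  is, the empty product.\<close>

definition product_code :: expr where
  "product_code = IfE (Var 0) (Call 9 [Fst (Var 0), Call 10 [Snd (Var 0)]]) (NodeE LeafE LeafE)"

definition number_code :: expr where
  "number_code = IfE (Var 0)
     (NodeE (NodeE (Var 1) (Fst (Var 0))) (Call 11 [Snd (Var 0), Arith Add (Var 1) (NumE 1)]))
     LeafE"

definition rev_code :: expr where
  "rev_code = IfE (Var 0) (Call 12 [Snd (Var 0), NodeE (Fst (Var 0)) (Var 1)]) (Var 1)"

text \<open>Each suffix of the reward list is the reward list of a smaller budget, so one walk along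
  it yields a whole row of the table. The values come out by decreasing budget, as the preceding
  round needs them, whereas the accumulator reverses the trees into the increasing order of the
  table.\<close>

definition row_code :: expr where
  "row_code = IfE (Var 2)
     (LetE (Call 5 [Var 0, Var 1, Var 2, LeafE, Var 3])
       (LetE (Call 13 [Var 1, Var 2, Snd (Var 3), Var 4, NodeE (Snd (Var 0)) (Var 5)])
         (NodeE (NodeE (Fst (Var 1)) (Fst (Var 0))) (Snd (Var 0)))))
     (NodeE LeafE (Var 4))"

definition zeros_code :: expr where
  "zeros_code = NodeE (NumE 0)
     (IfE (Less (Var 0) (NumE 1)) LeafE (Call 14 [Arith Sub (Var 0) (NumE 1)]))"

definition rounds_code :: expr where
  "rounds_code = IfE (Var 0)
     (LetE (Call 15 [Snd (Var 0), Var 1, Var 2, Var 3])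
       (LetE (Call 13 [Var 2, Fst (Var 1), Fst (Var 0), Var 3, LeafE])
         (NodeE (Fst (Var 0)) (NodeE (Snd (Var 0)) (Snd (Var 1))))))
     (NodeE (Call 14 [Var 3]) LeafE)"

definition code_common :: program where
  "code_common = [nth_code, filter_code, member_code, halt_code, best_code, choose_code,
     subtrees_code, cons_all_code, extend_code, product_code, number_code, rev_code, row_code,
     zeros_code, rounds_code]"

abbreviation state_sets_expr :: "expr \<Rightarrow> expr" where
  "state_sets_expr e \<equiv> Fst (Snd (Snd e))"

definition table_main :: expr where
  "table_main = Snd (Call 15 [Fst (Var 0), Call 11 [state_sets_expr (Var 0), NumE 0],
     Call 10 [state_sets_expr (Var 0)], Fst (Snd (Var 0))])"

text \<open>The input lists the values by increasing budget and \<open>best\<close> consumes them by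
  decreasing budget, hence the reversal by function 12.\<close>

definition tree_main :: expr where
  "tree_main = Snd (Call 5 [Call 11 [state_sets_expr (Fst (Var 0)), NumE 0], Fst (Snd (Var 0)),
     Call 12 [Fst (Snd (Snd (Snd (Var 0)))), LeafE], LeafE, Call 10 [state_sets_expr (Fst (Var 0))]])"

section \<open>Encodings and the answers to queries\<close>

abbreviation enc_nats :: "nat list \<Rightarrow> data" where
  "enc_nats xs \<equiv> enc_list (map enc_nat xs)"

abbreviation enc_states :: "nat list list \<Rightarrow> data" where
  "enc_states L \<equiv> enc_list (map enc_nats L)"

abbreviation enc_reals :: "real list \<Rightarrow> data" where
  "enc_reals Rs \<equiv> enc_list (map Num Rs)"

definition enc_numbered :: "nat \<times> nat list \<Rightarrow> data" where
  "enc_numbered i = Node (enc_nat (fst i)) (enc_nats (snd i))"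

abbreviation enc_all_numbered :: "(nat \<times> nat list) list \<Rightarrow> data" where
  "enc_all_numbered its \<equiv> enc_list (map enc_numbered its)"

definition enc_result :: "real \<times> dtree \<Rightarrow> data" where
  "enc_result r = Node (Num (fst r)) (enc_tree (snd r))"

definition enc_subtrees :: "(real \<times> dtree) list \<Rightarrow> data" where
  "enc_subtrees cs = Node (Num (sum_list (map fst cs))) (enc_list (map enc_tree (map snd cs)))"

lemma dec_nat_enc [simp]: "dec_nat (enc_nat k) = k"
  by (simp add: enc_nat_def)

lemma dec_nats_enc [simp]: "dec_nats (enc_nats xs) = xs"
  by (induction xs) auto

lemma answer_prob:
  assumes "t \<in> {1..rounds I}" "x \<in> set (state_lists I)"
  shows "answer I (Node (enc_nat t) (Node (enc_nats x) Leaf)) = Num (prob I t x)"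
  using assms bij_betw_state_of[of I] by (auto simp: prob_def bij_betw_def Let_def)

lemma answer_gain:
  assumes "t \<in> {1..rounds I}" "x \<in> set (state_lists I)" "set S \<subseteq> items I"
  shows "answer I (Node (enc_nat t) (Node (enc_nats x) (Node (enc_nats S) Leaf))) = Num (gain I t (set S) x)"
  using assms bij_betw_state_of[of I] by (auto simp: gain_def bij_betw_def Let_def)

text \<open>Bounds every natural number that a program handles: rounds, budgets, items and local
  states. The last summand covers the literal 1.\<close>

definition num_bound :: "sbmsm \<Rightarrow> nat" where
  "num_bound I = rounds I + budget I + nitems I + (\<Sum>v<nitems I. nstates I v) + 1"

text \<open>Nonempty suffixes only: even for budget 0 the reward list has one entry.\<close>

fun tails :: "'a list \<Rightarrow> 'a list list" where
  "tails [] = []"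
| "tails (x # xs) = (x # xs) # tails xs"

text \<open>
  The locale abstracts from the two cost models: \<open>lv j x\<close> says that \<open>x\<close> arises from the numbers
  of the instance at nesting depth \<open>j\<close>, and \<open>W\<close> bounds the weight of every number that the
  algorithm meets.
\<close>

locale run =
  fixes w :: "real \<Rightarrow> nat" and I :: sbmsm and lv :: "nat \<Rightarrow> real \<Rightarrow> bool" and W :: nat and main :: expr
  assumes valid: "valid_instance I"
    and lv_mono: "lv i x \<Longrightarrow> i \<le> j \<Longrightarrow> lv j x"
    and lv_nat: "k \<le> num_bound I \<Longrightarrow> lv 1 (real k)"
    and lv_prob: "t \<in> {1..rounds I} \<Longrightarrow> z \<in> set (state_lists I) \<Longrightarrow> lv 1 (prob I t z)"
    and lv_gain: "t \<in> {1..rounds I} \<Longrightarrow> z \<in> set (state_lists I) \<Longrightarrow> S \<subseteq> items I \<Longrightarrow> lv 1 (gain I t S z)"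
    and lv_add: "lv j x \<Longrightarrow> lv j y \<Longrightarrow> lv (Suc j) (x + y)"
    and lv_mult: "lv i x \<Longrightarrow> lv j y \<Longrightarrow> lv (i + j) (x * y)"
    and lv_sum: "\<forall>x\<in>set xs. lv j x \<Longrightarrow> length xs \<le> card (global_states I) \<Longrightarrow> lv (Suc j) (sum_list xs)"
    and lv_weight: "lv j x \<Longrightarrow> j \<le> 4 * rounds I + 8 \<Longrightarrow> w x \<le> W"
begin

definition code :: program where
  "code = main # code_common"

abbreviation "evl \<equiv> evb w code (answer I)"
abbreviation "evls \<equiv> evbs w code (answer I)"
abbreviation "n \<equiv> nitems I"
abbreviation "h \<equiv> card (global_states I)"
abbreviation "N \<equiv> \<Sum>v<nitems I. nstates I v"
abbreviation "J \<equiv> 4 * rounds I + 8"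

text \<open>A query holds a round, a state and possibly a set of items, the last two being lists of
  at most \<open>n\<close> numbers; the answer is one more number.\<close>

definition Q :: nat where
  "Q = 20 + 4 * W + 2 * n * (W + 2)"

text \<open>Pays for one pass through any function body, calls excluded. The constants are rounded
  up generously.\<close>

definition K :: nat where
  "K = 100 + 100 * W + 10 * Q"

lemma length_code: "length code = 16"
  by (simp add: code_def code_common_def)

lemma code_nth:
  "code ! 0 = main" "code ! 1 = nth_code" "code ! 2 = filter_code" "code ! 3 = member_code"
  "code ! 4 = halt_code" "code ! 5 = best_code" "code ! 6 = choose_code" "code ! 7 = subtrees_code"
  "code ! 8 = cons_all_code" "code ! 9 = extend_code" "code ! 10 = product_code"
  "code ! 11 = number_code" "code ! 12 = rev_code" "code ! 13 = row_code"
  "code ! 14 = zeros_code" "code ! 15 = rounds_code"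
  by (simp_all add: code_def code_common_def)

lemma w_nat: "k \<le> num_bound I \<Longrightarrow> w (real k) \<le> W"
  using lv_weight[OF lv_nat] by simp

lemma ev_Call:
  "i < 16 \<Longrightarrow> evls env es vs c1 \<Longrightarrow> evl vs (code ! i) v c2 \<Longrightarrow> evl env (Call i es) v (1 + c1 + c2)"
  using evb_Call[of i code] by (simp add: length_code)

lemma ev_zero: "evl env (NumE 0) (Num 0) (1 + W)"
  using evb_NumE[of w 0 W code "answer I" env] w_nat[of 0] by simp

lemma ev_nat_0: "evl env (NumE 0) (enc_nat 0) (1 + W)"
  using ev_zero by (simp add: enc_nat_def)

lemma ev_nat_1: "evl env (NumE 1) (enc_nat 1) (1 + W)"
  using evb_NumE[of w 1 W code "answer I" env] w_nat[of 1] by (simp add: enc_nat_def num_bound_def)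

lemma ev_less_nat:
  assumes "evl env e1 (enc_nat a) c1" "evl env e2 (enc_nat b) c2" "a \<le> num_bound I" "b \<le> num_bound I"
  shows "a < b \<Longrightarrow> evl env (Less e1 e2) (Num 1) (1 + c1 + c2 + 2 * W)"
    and "\<not> a < b \<Longrightarrow> evl env (Less e1 e2) Leaf (1 + c1 + c2 + 2 * W)"
  using evb_Less[OF assms(1,2)[unfolded enc_nat_def] w_nat[OF assms(3)] w_nat[OF assms(4)]] by simp_all

lemma ev_pred:
  assumes "evl env e1 (enc_nat (Suc a)) c1" "Suc a \<le> num_bound I"
  shows "evl env (Arith Sub e1 (NumE 1)) (enc_nat a) (2 + c1 + 3 * W)"
  using evb_Sub[OF assms(1)[unfolded enc_nat_def] ev_nat_1[unfolded enc_nat_def]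
      w_nat[OF assms(2)] w_nat[of 1]]
  by (simp add: enc_nat_def num_bound_def algebra_simps)

lemma ev_succ:
  assumes "evl env e1 (enc_nat a) c1" "a \<le> num_bound I"
  shows "evl env (Arith Add e1 (NumE 1)) (enc_nat (Suc a)) (2 + c1 + 3 * W)"
  using evb_Add[OF assms(1)[unfolded enc_nat_def] ev_nat_1[unfolded enc_nat_def]
      w_nat[OF assms(2)] w_nat[of 1]]
  by (simp add: enc_nat_def num_bound_def algebra_simps)

lemma code_index:
  "1 < (16 :: nat)" "2 < (16 :: nat)" "3 < (16 :: nat)" "4 < (16 :: nat)" "5 < (16 :: nat)"
  "6 < (16 :: nat)" "7 < (16 :: nat)" "8 < (16 :: nat)" "9 < (16 :: nat)" "10 < (16 :: nat)"
  "11 < (16 :: nat)" "12 < (16 :: nat)" "13 < (16 :: nat)" "14 < (16 :: nat)" "15 < (16 :: nat)"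
  by simp_all

lemma K_ge: "100 + 100 * W + 10 * Q \<le> K"
  by (simp add: K_def)

section \<open>Lookup, membership and filtering\<close>

lemma ev_nth:
  "i < length xs \<Longrightarrow> i \<le> num_bound I \<Longrightarrow> evl [enc_nats xs, enc_nat i] (code ! 1) (enc_nat (xs ! i)) (Suc i * K)"
proof (induction i arbitrary: xs)
  case 0
  then obtain x ys where xs: "xs = x # ys" by (cases xs) auto
  show ?case
    unfolding xs code_nth nth_code_def list.map enc_list.simps nth_Cons_0
    apply (rule evb_mono)
     apply (rule evb_If_Num ev_less_nat(1) evb_intros ev_nat_1 | simp add: num_bound_def)+
    using K_ge by simp
next
  case (Suc i)
  then obtain x ys where xs: "xs = x # ys" by (cases xs) auto
  have IH: "evl [enc_nats ys, enc_nat i] (code ! 1) (enc_nat (ys ! i)) (Suc i * K)"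
    using Suc xs by simp
  show ?case
    unfolding xs code_nth(2) nth_code_def list.map enc_list.simps nth_Cons_Suc
    apply (rule evb_mono)
     apply (rule evb_If_Leaf ev_less_nat(2) evb_intros ev_nat_1 ev_Call ev_pred IH Suc.prems | simp add: num_bound_def)+
    using K_ge by simp
qed

lemma ev_member:
  "v \<le> num_bound I \<Longrightarrow> \<forall>u\<in>set S. u \<le> num_bound I \<Longrightarrow>
   evl [enc_nat v, enc_nats S] (code ! 3) (if v \<in> set S then enc_nat 1 else Leaf) (Suc (length S) * K)"
proof (induction S)
  case Nil
  show ?case
    unfolding code_nth member_code_def list.map enc_list.simps
    apply (rule evb_mono)
     apply (simp, rule evb_If_Leaf, (rule evb_intros)+)
    using K_ge by simp
next
  case (Cons u S)
  then have IH: "evl [enc_nat v, enc_nats S] (code ! 3) (if v \<in> set S then enc_nat 1 else Leaf) (Suc (length S) * K)"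
    and u: "u \<le> num_bound I" by auto
  consider "v < u" | "u < v" | "u = v" by linarith
  then show ?case
  proof cases
    case 1
    from 1 have eq: "(if v \<in> set (u # S) then enc_nat 1 else Leaf) = (if v \<in> set S then enc_nat 1 else Leaf)" by simp
    show ?thesis
      unfolding code_nth(4) member_code_def list.map enc_list.simps eq
      apply (rule evb_mono)
       apply (rule evb_If_Node, rule evb_Var)
       apply (rule evb_If_Num ev_less_nat(1) evb_intros ev_Call IH 1 u Cons.prems | simp)+
      using K_ge by simp
  next
    case 2
    then have nl: "\<not> v < u" by simp
    from 2 have eq: "(if v \<in> set (u # S) then enc_nat 1 else Leaf) = (if v \<in> set S then enc_nat 1 else Leaf)" by simp
    show ?thesis
      unfolding code_nth(4) member_code_def list.map enc_list.simps eq
      apply (rule evb_mono)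
       apply (rule evb_If_Node, rule evb_Var)
       apply (rule evb_If_Leaf, rule ev_less_nat(2))
            apply (rule evb_intros)+
          apply (rule u Cons.prems nl)+
       apply (rule evb_If_Num ev_less_nat(1) evb_intros ev_Call IH 2 u Cons.prems | simp)+
      using K_ge by simp
  next
    case 3
    then have nl: "\<not> v < u" "\<not> u < v" by simp_all
    from 3 have eq: "(if v \<in> set (u # S) then enc_nat 1 else Leaf) = enc_nat 1" by simp
    show ?thesis
      unfolding code_nth(4) member_code_def list.map enc_list.simps eq
      apply (rule evb_mono)
       apply (rule evb_If_Node, rule evb_Var)
       apply (rule evb_If_Leaf, rule ev_less_nat(2))
            apply (rule evb_intros)+
          apply (rule u Cons.prems nl)+
       apply (rule evb_If_Leaf, rule ev_less_nat(2))
            apply (rule evb_intros)+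
          apply (rule u Cons.prems nl)+
       apply (rule ev_nat_1)
      using K_ge by simp
  qed
qed


lemma nstates_le: "v < n \<Longrightarrow> nstates I v \<le> N"
  by (rule member_le_sum) auto

lemma state_le_num_bound: "x \<in> set (state_lists I) \<Longrightarrow> v < n \<Longrightarrow> x ! v \<le> num_bound I"
  using nstates_le[of v] by (fastforce simp: in_state_lists num_bound_def)

lemma ev_filter:
  "v < n \<Longrightarrow> s \<le> num_bound I \<Longrightarrow> set L \<subseteq> set (state_lists I) \<Longrightarrow>
   evl [enc_nat v, enc_nat s, enc_states L] (code ! 2) (enc_states [x\<leftarrow>L. x ! v = s]) (Suc (length L) * (Suc n * K))"
proof (induction L)
  case Nil
  show ?case
    unfolding code_nth filter_code_def list.map enc_list.simps filter.simps
    apply (rule evb_mono)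
     apply (rule evb_If_Leaf evb_intros)+
    using K_ge by simp
next
  case (Cons x L)
  then have IH: "evl [enc_nat v, enc_nat s, enc_states L] (code ! 2) (enc_states [x\<leftarrow>L. x ! v = s]) (Suc (length L) * (Suc n * K))"
    and x: "x \<in> set (state_lists I)" by auto
  have nth: "evl [enc_nats x, enc_nat v] (code ! 1) (enc_nat (x ! v)) (n * K)"
    using Cons.prems x
    by (intro evb_mono[OF ev_nth] mult_right_mono) (auto simp: in_state_lists num_bound_def)
  have xv: "x ! v \<le> num_bound I" using state_le_num_bound x Cons.prems by simp
  consider "x ! v < s" | "s < x ! v" | "x ! v = s" by linarith
  then show ?case
  proof cases
    case 1
    from 1 have eq: "[x\<leftarrow>x # L. x ! v = s] = [x\<leftarrow>L. x ! v = s]" by simp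
    show ?thesis
      unfolding code_nth(3) filter_code_def list.map enc_list.simps eq
      apply (rule evb_mono)
       apply (rule evb_If_Node, rule evb_Var)
       apply (rule evb_If_Num ev_less_nat(1) evb_intros ev_Call IH nth 1 xv Cons.prems | simp)+
      using K_ge by (simp add: algebra_simps)
  next
    case 2
    then have nl: "\<not> x ! v < s" by simp
    from 2 have eq: "[x\<leftarrow>x # L. x ! v = s] = [x\<leftarrow>L. x ! v = s]" by simp
    show ?thesis
      unfolding code_nth(3) filter_code_def list.map enc_list.simps eq
      apply (rule evb_mono)
       apply (rule evb_If_Node, rule evb_Var)
       apply (rule evb_intros ev_Call IH nth | simp)+
       apply (rule evb_If_Leaf, rule ev_less_nat(2))
            apply (rule evb_intros)+
          apply (rule xv Cons.prems nl)+
       apply (rule evb_If_Num ev_less_nat(1) evb_intros ev_Call IH nth 2 xv Cons.prems | simp)+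
      using K_ge by (simp add: algebra_simps)
  next
    case 3
    then have nl: "\<not> x ! v < s" "\<not> s < x ! v" by simp_all
    from 3 have eq: "[x\<leftarrow>x # L. x ! v = s] = x # [x\<leftarrow>L. x ! v = s]" by simp
    show ?thesis
      unfolding code_nth(3) filter_code_def list.map enc_list.simps eq
      apply (rule evb_mono)
       apply (rule evb_If_Node, rule evb_Var)
       apply (rule evb_intros ev_Call IH nth | simp)+
       apply (rule evb_If_Leaf, rule ev_less_nat(2))
            apply (rule evb_intros)+
          apply (rule xv Cons.prems nl)+
       apply (rule evb_If_Leaf, rule ev_less_nat(2))
            apply (rule evb_intros)+
          apply (rule xv Cons.prems nl)+
       apply (rule evb_intros)+
      using K_ge by (simp add: algebra_simps)
  qed
qed


section \<open>Cost of queries and depth of the numbers\<close>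

lemma data_size_nat: "k \<le> num_bound I \<Longrightarrow> data_size w (enc_nat k) \<le> 1 + W"
  using w_nat by (simp add: enc_nat_def)

lemma data_size_nats:
  "\<forall>k\<in>set xs. k \<le> num_bound I \<Longrightarrow> data_size w (enc_nats xs) \<le> 1 + length xs * (W + 2)"
proof (induction xs)
  case (Cons k xs)
  then show ?case using data_size_nat[of k] by simp
qed simp

lemma data_size_state:
  assumes "x \<in> set (state_lists I)"
  shows "data_size w (enc_nats x) \<le> 1 + n * (W + 2)"
proof -
  have "length x = n" using assms by (simp add: in_state_lists)
  moreover have "\<forall>k\<in>set x. k \<le> num_bound I"
    using state_le_num_bound[OF assms] \<open>length x = n\<close> by (metis in_set_conv_nth)
  ultimately show ?thesis using data_size_nats[of x] by simp
qed

lemma round_le: "t \<in> {1..rounds I} \<Longrightarrow> t \<le> num_bound I"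
  by (simp add: num_bound_def)

lemma ev_query_prob:
  assumes "evl env e (Node (enc_nat t) (Node (enc_nats x) Leaf)) c"
    and "t \<in> {1..rounds I}" "x \<in> set (state_lists I)"
  shows "evl env (Query e) (Num (prob I t x)) (1 + c + Q)"
proof (rule evb_Query[OF assms(1) answer_prob[OF assms(2,3)]])
  have "w (prob I t x) \<le> W" using lv_weight[OF lv_prob[OF assms(2,3)]] by simp
  then show "data_size w (Node (enc_nat t) (Node (enc_nats x) Leaf)) + data_size w (Num (prob I t x)) \<le> Q"
    using data_size_nat[OF round_le[OF assms(2)]] data_size_state[OF assms(3)] by (simp add: Q_def)
qed

lemma ev_query_gain:
  assumes "evl env e (Node (enc_nat t) (Node (enc_nats x) (Node (enc_nats S) Leaf))) c"
    and "t \<in> {1..rounds I}" "x \<in> set (state_lists I)" "set S \<subseteq> items I" "length S \<le> n"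
  shows "evl env (Query e) (Num (gain I t (set S) x)) (1 + c + Q)"
proof (rule evb_Query[OF assms(1) answer_gain[OF assms(2-4)]])
  have "w (gain I t (set S) x) \<le> W" using lv_weight[OF lv_gain[OF assms(2-4)]] by simp
  moreover have "data_size w (enc_nats S) \<le> 1 + n * (W + 2)"
    using data_size_nats[of S] mult_right_mono[OF assms(5), of "W + 2"] assms(4)
    by (force simp: items_def num_bound_def)
  ultimately show "data_size w (Node (enc_nat t) (Node (enc_nats x) (Node (enc_nats S) Leaf)))
      + data_size w (Num (gain I t (set S) x)) \<le> Q"
    using data_size_nat[OF round_le[OF assms(2)]] data_size_state[OF assms(3)] by (simp add: Q_def)
qed

lemma w_le: "lv j x \<Longrightarrow> j \<le> J \<Longrightarrow> w x \<le> W"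
  by (rule lv_weight)

lemma lv_halt_term:
  assumes "lv j R" "1 \<le> j" "t \<in> {1..rounds I}" "x \<in> set (state_lists I)" "set S \<subseteq> items I"
  shows "lv (j + 2) (prob I t x * (gain I t (set S) x + R))"
  using lv_mult[OF lv_prob[OF assms(3,4)] lv_add[OF lv_mono[OF lv_gain[OF assms(3-5)] assms(2)] assms(1)]]
  by simp

text \<open>Tracking the number \<open>m\<close> of summands keeps the depth from growing with every addition.\<close>

definition lv_terms :: "nat \<Rightarrow> nat \<Rightarrow> real \<Rightarrow> bool" where
  "lv_terms j m x \<longleftrightarrow> (\<exists>ys. length ys \<le> m \<and> (\<forall>y\<in>set ys. lv j y) \<and> x = sum_list ys)"

lemma lv_terms_0: "lv_terms j m 0"
  unfolding lv_terms_def by (rule exI[of _ "[]"]) simp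

lemma lv_terms_add: "lv_terms j m x \<Longrightarrow> lv_terms j k y \<Longrightarrow> lv_terms j (m + k) (x + y)"
proof -
  assume "lv_terms j m x" "lv_terms j k y"
  then obtain xs ys where "length xs \<le> m" "\<forall>y\<in>set xs. lv j y" "x = sum_list xs"
    "length ys \<le> k" "\<forall>y\<in>set ys. lv j y" "y = sum_list ys"
    unfolding lv_terms_def by blast
  then show ?thesis unfolding lv_terms_def by (intro exI[of _ "xs @ ys"]) auto
qed

lemma lv_terms_mono: "lv_terms j m x \<Longrightarrow> m \<le> k \<Longrightarrow> lv_terms j k x"
  unfolding lv_terms_def using order_trans by blast

text \<open>However the additions are nested, a sum of at most \<open>h\<close> terms costs a single
  level.\<close>

lemma lv_terms_lv: "lv_terms j m x \<Longrightarrow> m \<le> h \<Longrightarrow> lv (Suc j) x"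
  unfolding lv_terms_def using lv_sum by force

lemma lv_terms_sum_list:
  "(\<And>s. s \<in> set sl \<Longrightarrow> lv_terms j (l s) (g s)) \<Longrightarrow>
    lv_terms j (sum_list (map l sl)) (sum_list (map g sl))"
  by (induction sl) (auto intro: lv_terms_0 lv_terms_add)

lemma lv_terms_halt_value:
  assumes "lv j R" "1 \<le> j" "t \<in> {1..rounds I}" "set L \<subseteq> set (state_lists I)" "set S \<subseteq> items I"
  shows "lv_terms (j + 2) (length L) (halt_value (prob I t) (gain I t) R S L)"
  unfolding lv_terms_def halt_value_def
  by (intro exI[of _ "map (\<lambda>x. prob I t x * (gain I t (set S) x + R)) L"])
    (use assms lv_halt_term[OF assms(1-3) _ assms(5)] in auto)

section \<open>Correctness and cost of the recursion\<close>

lemma ev_halt: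
  assumes "t \<in> {1..rounds I}" "lv j R" "1 \<le> j" "j + 3 \<le> J" "set S \<subseteq> items I" "length S \<le> n"
  shows "set L \<subseteq> set (state_lists I) \<Longrightarrow> length L \<le> h \<Longrightarrow>
    evl [enc_nat t, Num R, enc_nats S, enc_states L] (code ! 4)
      (Num (halt_value (prob I t) (gain I t) R S L)) (Suc (length L) * K)"
proof (induction L)
  case Nil
  show ?case
    unfolding code_nth halt_code_def list.map enc_list.simps halt_value_def sum_list.Nil
    apply (rule evb_mono)
     apply (rule evb_If_Leaf evb_intros ev_zero)+
    using K_ge by simp
next
  case (Cons x L)
  let ?g = "gain I t (set S) x" and ?p = "prob I t x"
  from Cons have IH: "evl [enc_nat t, Num R, enc_nats S, enc_states L] (code ! 4)
      (Num (halt_value (prob I t) (gain I t) R S L)) (Suc (length L) * K)"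
    and x: "x \<in> set (state_lists I)" by auto
  \<comment> \<open>A term \<open>p * (g + R)\<close> lies two levels above \<open>R\<close>, and a
    partial sum of such terms one level higher; hence the bound on \<open>j + 3\<close>.\<close>
  have "lv (Suc (j + 2)) (halt_value (prob I t) (gain I t) R S L)"
    by (rule lv_terms_lv[OF lv_terms_halt_value]) (use assms Cons.prems in auto)
  then have w1: "w (halt_value (prob I t) (gain I t) R S L) \<le> W" using assms(4) by (simp add: w_le)
  have w2: "w ?p \<le> W" "w ?g \<le> W" "w R \<le> W"
    using w_le[OF lv_prob] w_le[OF lv_gain] w_le[OF assms(2)] assms x by auto
  have w3: "w (?p * (?g + R)) \<le> W"
    using w_le[OF lv_halt_term[OF assms(2,3,1) x assms(5)]] assms(4) by simp
  have w4: "w (?g + R) \<le> W"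
    using w_le[OF lv_add[OF lv_mono[OF lv_gain[OF assms(1) x assms(5)] assms(3)] assms(2)]] assms(4) by simp
  have eq: "halt_value (prob I t) (gain I t) R S (x # L) = ?p * (?g + R) + halt_value (prob I t) (gain I t) R S L"
    by (simp add: halt_value_def)
  show ?case
    unfolding code_nth(5) halt_code_def list.map enc_list.simps eq
    apply (rule evb_mono)
     apply (rule evb_If_Node, rule evb_Var)
     apply (rule evb_Add evb_Mul ev_query_prob ev_query_gain evb_intros ev_Call IH w1 w2 w3 w4 x assms | simp)+
    using K_ge by simp
qed

text \<open>The classes are disjoint, so an observation distributes the states without duplicating
  any. This one count bounds the work of the children, the number of summands of a value, and the
  size of a tree.\<close>

lemma sum_list_filter_length:
  "distinct sl \<Longrightarrow> (\<Sum>s\<leftarrow>sl. length [x\<leftarrow>L. x ! v = s]) \<le> length (L :: nat list list)"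
proof (induction L)
  case (Cons x L)
  have "(\<Sum>s\<leftarrow>sl. length [y\<leftarrow>x # L. y ! v = s])
      = (\<Sum>s\<leftarrow>sl. (if s = x ! v then 1 else 0) + length [y\<leftarrow>L. y ! v = s])"
    by (intro arg_cong[of _ _ sum_list] map_cong) auto
  also have "\<dots> = (\<Sum>s\<leftarrow>sl. if s = x ! v then 1 else 0) + (\<Sum>s\<leftarrow>sl. length [y\<leftarrow>L. y ! v = s])"
    by (simp add: sum_list_addf)
  also have "(\<Sum>s\<leftarrow>sl. if s = x ! v then 1 else 0) \<le> (1 :: nat)"
    using Cons.prems by (simp add: sum_list_distinct_conv_sum_set)
  finally show ?case using Cons by simp
qed simp

text \<open>Functions 5, 6 and 7 call each other. To allow a single induction in
  \<open>ev_best\<close>, the behaviour of function 5 on the shorter reward list is a hypothesis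
  here, and that of function 7 is one in \<open>ev_choose\<close>. The assumed cost is affine in the
  length of the list: the constant \<open>Y\<close> is paid once per class, while the linear parts
  add up over the classes.\<close>

lemma ev_subtrees:
  assumes IH: "\<And>L'. set L' \<subseteq> set (state_lists I) \<Longrightarrow> length L' \<le> h \<Longrightarrow>
      evl [enc_all_numbered its, enc_nat t, enc_reals Rs, enc_nats S, enc_states L'] (code ! 5)
        (enc_result (b L')) (Y + Z * length L')"
    and lvb: "\<And>L'. set L' \<subseteq> set (state_lists I) \<Longrightarrow> length L' \<le> h \<Longrightarrow> lv_terms j (length L') (fst (b L'))"
    and j: "j + 1 \<le> J" and v: "v < n" and L: "set L \<subseteq> set (state_lists I)" "length L \<le> h"
  shows "distinct sl \<Longrightarrow> \<forall>s\<in>set sl. s \<le> num_bound I \<Longrightarrow>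
    evl [enc_nats sl, enc_nat v, enc_all_numbered its, enc_nat t, enc_reals Rs, enc_nats S, enc_states L]
      (code ! 7) (enc_subtrees (map (\<lambda>s. b [x\<leftarrow>L. x ! v = s]) sl))
      (length sl * (Y + Suc (length L) * (Suc n * K) + K) + Z * (\<Sum>s\<leftarrow>sl. length [x\<leftarrow>L. x ! v = s]) + K)"
proof (induction sl)
  case Nil
  show ?case
    unfolding code_nth subtrees_code_def list.map enc_list.simps enc_subtrees_def sum_list.Nil
    apply (rule evb_mono)
     apply (rule evb_If_Leaf evb_intros ev_zero)+
    using K_ge by simp
next
  case (Cons s sl)
  let ?L = "\<lambda>s. [x\<leftarrow>L. x ! v = s]"
  have good: "set (?L s) \<subseteq> set (state_lists I)" "length (?L s) \<le> h" for s
    using L le_trans[OF length_filter_le] by auto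
  have sub: "evl [enc_nats sl, enc_nat v, enc_all_numbered its, enc_nat t, enc_reals Rs, enc_nats S, enc_states L]
      (code ! 7) (enc_subtrees (map (\<lambda>s. b (?L s)) sl))
      (length sl * (Y + Suc (length L) * (Suc n * K) + K) + Z * (\<Sum>s\<leftarrow>sl. length (?L s)) + K)"
    using Cons by simp
  have fil: "evl [enc_nat v, enc_nat s, enc_states L] (code ! 2) (enc_states (?L s)) (Suc (length L) * (Suc n * K))"
    using v L Cons.prems by (intro ev_filter) auto
  have w1: "w (fst (b (?L s))) \<le> W"
    using w_le[OF lv_terms_lv[OF lvb[OF good] good(2)]] j by simp
  have "lv_terms j (\<Sum>s\<leftarrow>sl. length (?L s)) (\<Sum>s\<leftarrow>sl. fst (b (?L s)))"
    using lvb[OF good] by (rule lv_terms_sum_list)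
  moreover have "(\<Sum>s\<leftarrow>sl. length (?L s)) \<le> h"
    using sum_list_filter_length[of sl v L] L Cons.prems by simp
  ultimately have "w (\<Sum>s\<leftarrow>sl. fst (b (?L s))) \<le> W"
    using w_le[OF lv_terms_lv] j by simp
  then have w2: "w (sum_list (map fst (map (\<lambda>s. b (?L s)) sl))) \<le> W" by (simp add: o_def)
  show ?case
    unfolding code_nth(8) subtrees_code_def list.map enc_list.simps enc_subtrees_def sum_list.Cons
    apply (rule evb_mono)
     apply (rule evb_If_Node, rule evb_Var)
     apply (rule evb_intros evb_Add ev_Call IH[OF good, unfolded enc_result_def]
       sub[unfolded enc_subtrees_def] fil w1 w2 | simp)+
    using K_ge by (simp add: algebra_simps)
qed

lemma ev_choose:
  assumes sub: "\<And>v sl. (v, sl) \<in> set its \<Longrightarrow> v \<notin> set S \<Longrightarrow>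
      evl [enc_nats sl, enc_nat v, enc_all_numbered its, enc_nat t, enc_reals Rs, enc_nats (v # S), enc_states L]
        (code ! 7) (enc_subtrees (cs v sl)) X"
    and lvc: "\<And>v sl. (v, sl) \<in> set its \<Longrightarrow> v \<notin> set S \<Longrightarrow> lv J (fst (combine v (cs v sl)))"
    and its: "fst ` set its \<subseteq> {..<n}" and S: "set S \<subseteq> {..<n}" "length S \<le> n"
  shows "set todo \<subseteq> set its \<Longrightarrow> lv J (fst acc) \<Longrightarrow>
    evl [enc_all_numbered todo, enc_result acc, enc_all_numbered its, enc_nat t, enc_reals (R # Rs),
        enc_nats S, enc_states L] (code ! 6)
      (enc_result (foldl (\<lambda>a (v, sl). if v \<in> set S then a else better a (combine v (cs v sl))) acc todo))
      (Suc (length todo) * (Suc n * K + K + X))"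
proof (induction todo arbitrary: acc)
  case Nil
  show ?case
    unfolding code_nth choose_code_def list.map enc_list.simps foldl_Nil
    apply (rule evb_mono)
     apply (rule evb_If_Leaf evb_intros)+
    using K_ge by simp
next
  case (Cons i todo)
  obtain v sl where i: "i = (v, sl)" by force
  have v: "v < n" "(v, sl) \<in> set its" using Cons.prems its i by force+
  let ?F = "foldl (\<lambda>a (v, sl). if v \<in> set S then a else better a (combine v (cs v sl)))"
  have IH: "lv J (fst acc) \<Longrightarrow> evl [enc_all_numbered todo, enc_result acc, enc_all_numbered its, enc_nat t,
        Node (Num R) (enc_reals Rs), enc_nats S, enc_states L] (code ! 6)
      (enc_result (?F acc todo)) (Suc (length todo) * (Suc n * K + K + X))" for acc
    using Cons by simp
  have mem: "evl [enc_nat v, enc_nats S] (code ! 3) (if v \<in> set S then enc_nat 1 else Leaf) (Suc n * K)"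
    using v S by (intro evb_mono[OF ev_member]) (auto simp: num_bound_def)
  show ?case
  proof (cases "v \<in> set S")
    case True
    then have mem: "evl [enc_nat v, enc_nats S] (code ! 3) (Num (real 1)) (Suc n * K)"
      using mem by (simp add: enc_nat_def)
    have eq: "?F acc (i # todo) = ?F acc todo" using True i by simp
    show ?thesis
      unfolding code_nth(7) choose_code_def list.map enc_list.simps enc_numbered_def i fst_conv snd_conv
        eq[unfolded i]
      apply (rule evb_mono)
       apply (rule evb_If_Node, rule evb_Var)
       apply (rule evb_If_Num evb_intros ev_Call mem IH[unfolded enc_numbered_def] Cons.prems | simp)+
      using K_ge by (simp add: algebra_simps)
  next
    case False
    then have mem: "evl [enc_nat v, enc_nats S] (code ! 3) Leaf (Suc n * K)"
      using mem by simp
    let ?c = "combine v (cs v sl)"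
    have lvb: "lv J (fst (better acc ?c))" using lvc[OF v(2) False] Cons.prems by (simp add: better_def)
    have eq: "?F acc (i # todo) = ?F (better acc ?c) todo" using False i by simp
    note sub' = sub[OF v(2) False, unfolded enc_subtrees_def list.map enc_list.simps]
    have ws: "w (fst acc) \<le> W" "w (sum_list (map fst (cs v sl))) \<le> W"
      using w_le[OF Cons.prems(2)] w_le[OF lvc[OF v(2) False]] by (simp_all add: combine_def)
    note IH' = IH[OF lvb]
    show ?thesis
    proof (cases "fst acc < fst ?c")
      case True
      then have less: "fst acc < sum_list (map fst (cs v sl))" by (simp add: combine_def)
      have b: "enc_result (better acc ?c) = Node (Num (sum_list (map fst (cs v sl))))
          (Node (enc_nat v) (enc_list (map enc_tree (map snd (cs v sl)))))"
        using True by (simp add: enc_result_def better_def combine_def)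
      have acc: "enc_result acc = Node (Num (fst acc)) (enc_tree (snd acc))"
        by (simp add: enc_result_def)
      show ?thesis
        unfolding code_nth(7) choose_code_def list.map enc_list.simps enc_numbered_def i fst_conv snd_conv
          eq[unfolded i] acc
        apply (rule evb_mono)
         apply (rule evb_If_Node, rule evb_Var)
         apply (rule evb_If_Leaf)
          apply (rule evb_intros ev_Call mem evb_If_Num evb_Less(1) ws less sub'[unfolded enc_numbered_def] IH'[unfolded enc_numbered_def b] | simp)+
        using K_ge by (simp add: algebra_simps)
    next
      case nless: False
      then have less: "\<not> fst acc < sum_list (map fst (cs v sl))" by (simp add: combine_def)
      have b: "better acc ?c = acc" using nless by (simp add: better_def)
      have acc: "enc_result acc = Node (Num (fst acc)) (enc_tree (snd acc))"
        by (simp add: enc_result_def)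
      show ?thesis
        unfolding code_nth(7) choose_code_def list.map enc_list.simps enc_numbered_def i fst_conv snd_conv
          eq[unfolded i] b acc
        apply (rule evb_mono)
         apply (rule evb_If_Node, rule evb_Var)
         apply (rule evb_If_Leaf)
          apply (rule evb_intros ev_Call mem evb_If_Leaf evb_Less(2) ws less sub'[unfolded enc_numbered_def] IH'[unfolded enc_numbered_def b acc] | simp)+
        using K_ge by (simp add: algebra_simps)
    qed
  qed
qed

text \<open>The work at one node apart from the linear part of the recursive calls, for
  \<open>L\<close> as long as possible.\<close>

definition Z :: nat where
  "Z = K + Suc h * K + Suc n * (Suc n * K + K + (N * (K + Suc h * (Suc n * K) + K) + K))"

lemma combine_levels:
  assumes "\<And>L'. set L' \<subseteq> set (state_lists I) \<Longrightarrow> lv_terms j (length L') (fst (b L'))"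
    and "set L \<subseteq> set (state_lists I)" "distinct sl"
  shows "lv_terms j (length L) (fst (combine v (map (\<lambda>s. b [x\<leftarrow>L. x ! v = s]) sl)))"
proof -
  have "lv_terms j (\<Sum>s\<leftarrow>sl. length [x\<leftarrow>L. x ! v = s]) (\<Sum>s\<leftarrow>sl. fst (b [x\<leftarrow>L. x ! v = s]))"
    by (rule lv_terms_sum_list, rule assms(1)) (use assms in auto)
  from lv_terms_mono[OF this sum_list_filter_length[OF assms(3)]]
  show ?thesis by (simp add: combine_def o_def)
qed

text \<open>The depth \<open>j + 2\<close> is the same at every node, because a selection only
  regroups the halting terms of its children. Depth therefore grows with the rounds and not with the
  selections.\<close>

lemma lv_terms_best:
  assumes "t \<in> {1..rounds I}" "1 \<le> j"
  shows "\<forall>R\<in>set Rs. lv j R \<Longrightarrow> set L \<subseteq> set (state_lists I) \<Longrightarrow> set S \<subseteq> {..<n} \<Longrightarrow>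
    lv_terms (j + 2) (length L) (fst (best (prob I t) (gain I t) (numbered_states I) Rs S L))"
proof (induction Rs arbitrary: S L)
  case Nil
  then show ?case by (simp add: lv_terms_0)
next
  case (Cons R Rs)
  let ?b = "\<lambda>v. best (prob I t) (gain I t) (numbered_states I) Rs (v # S)"
  have halt: "lv_terms (j + 2) (length L) (halt_value (prob I t) (gain I t) R S L)"
    using assms Cons.prems by (intro lv_terms_halt_value) (auto simp: items_def)
  show ?case
    using foldl_better_cases[of S "\<lambda>v sl. combine v (map (\<lambda>s. ?b v [x\<leftarrow>L. x ! v = s]) sl)"
        "(halt_value (prob I t) (gain I t) R S L, Halt)" "numbered_states I"]
  proof (elim disjE exE conjE)
    fix v sl
    assume v: "(v, sl) \<in> set (numbered_states I)"
      and eq: "foldl (\<lambda>a (v, sl). if v \<in> set S then a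
          else better a (combine v (map (\<lambda>s. ?b v [x\<leftarrow>L. x ! v = s]) sl)))
        (halt_value (prob I t) (gain I t) R S L, Halt) (numbered_states I)
        = combine v (map (\<lambda>s. ?b v [x\<leftarrow>L. x ! v = s]) sl)"
    have "distinct sl" "v < n" using v by (auto simp: numbered_states_def)
    then have "lv_terms (j + 2) (length L) (fst (combine v (map (\<lambda>s. ?b v [x\<leftarrow>L. x ! v = s]) sl)))"
      using Cons by (intro combine_levels) auto
    then show ?thesis using halt eq by (simp add: lv_terms_0)
  qed (use halt in \<open>simp add: lv_terms_0\<close>)
qed

text \<open>The step of the cost recurrence and the origin of the base \<open>n + 2\<close>: the
  loop over the items contributes \<open>n + 1\<close> copies of \<open>Z * m * g\<close>, and the
  local work is at most \<open>Z\<close>, hence at most one further copy. This last estimate needs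
  \<open>1 \<le> m\<close>, which is why \<open>best\<close> stops at an empty list.\<close>

lemma Z_bound:
  assumes "m \<le> h" "1 \<le> m" "l \<le> N" "1 \<le> g"
  shows "50 + Suc m * K + Suc n * (Suc n * K + K + (l * (K + Suc m * (Suc n * K) + K) + Z * m * g + K))
    \<le> K + Z * m * (Suc (Suc n) * g)"
proof -
  have "l * (K + Suc m * (Suc n * K) + K) \<le> N * (K + Suc h * (Suc n * K) + K)"
    using assms by (intro mult_le_mono add_le_mono) auto
  then have "50 + Suc m * K + Suc n * (Suc n * K + K + (l * (K + Suc m * (Suc n * K) + K) + K))
    \<le> K + Suc h * K + Suc n * (Suc n * K + K + (N * (K + Suc h * (Suc n * K) + K) + K))"
    using assms K_ge by (intro add_le_mono mult_le_mono order_refl) auto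
  also have "\<dots> = Z" by (simp add: Z_def)
  also have "Z \<le> Z * m * g" using mult_le_mono2[of 1 "m * g" Z] mult_le_mono[OF assms(2,4)] by (simp add: mult.assoc)
  finally show ?thesis by (simp add: algebra_simps)
qed

text \<open>The exponent is one more than the number of items still selectable, since
  \<open>S\<close> is distinct; the budget left does not enter. The summand \<open>K\<close> alone
  pays for an empty \<open>L\<close>.\<close>

lemma ev_best:
  assumes "t \<in> {1..rounds I}" "1 \<le> j" "j + 4 \<le> J"
  shows "Rs \<noteq> [] \<Longrightarrow> \<forall>R\<in>set Rs. lv j R \<Longrightarrow> distinct S \<Longrightarrow> set S \<subseteq> {..<n} \<Longrightarrow>
    set L \<subseteq> set (state_lists I) \<Longrightarrow> length L \<le> h \<Longrightarrow>
    evl [enc_all_numbered (numbered_states I), enc_nat t, enc_reals Rs, enc_nats S, enc_states L] (code ! 5)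
      (enc_result (best (prob I t) (gain I t) (numbered_states I) Rs S L))
      (K + Z * length L * Suc (Suc n) ^ (Suc n - length S))"
proof (induction Rs arbitrary: S L)
  case (Cons R Rs)
  let ?its = "numbered_states I"
  let ?b = "\<lambda>v. best (prob I t) (gain I t) ?its Rs (v # S)"
  have S: "set S \<subseteq> items I" "length S \<le> n"
    using Cons.prems card_mono[of "{..<n}" "set S"] by (auto simp: items_def distinct_card)
  show ?case
  proof (cases L)
    case Nil
    show ?thesis
      unfolding code_nth(6) best_code_def Nil list.map enc_list.simps
      apply (rule evb_mono)
       apply (simp add: enc_result_def, rule evb_If_Leaf)
        apply (rule evb_intros ev_zero)+
      using K_ge by simp
  next
    case L: (Cons x L')
    have halt: "evl [enc_nat t, Num R, enc_nats S, enc_states L] (code ! 4)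
      (Num (halt_value (prob I t) (gain I t) R S L)) (Suc (length L) * K)"
      using Cons.prems assms S by (intro ev_halt[where j = j]) auto
    show ?thesis
    proof (cases "Rs = []")
      case True
      have r: "enc_result (best (prob I t) (gain I t) ?its (R # Rs) S L)
          = Node (Num (halt_value (prob I t) (gain I t) R S L)) Leaf"
        using True L by (simp add: enc_result_def)
      show ?thesis
        unfolding code_nth(6) best_code_def r unfolding L True list.map enc_list.simps
        apply (rule evb_mono)
         apply (rule evb_If_Node, rule evb_Var)
         apply (rule evb_intros ev_Call halt[unfolded L list.map enc_list.simps] evb_If_Leaf | simp)+
        using Z_bound[of "length L" 0 "Suc (Suc n) ^ (n - length S)"] L Cons.prems S
        by (simp add: Suc_diff_le)
    next
      case False
      let ?h = "halt_value (prob I t) (gain I t) R S L"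
      let ?g = "Suc (Suc n) ^ (n - length S)"
      let ?X = "N * (K + Suc (length L) * (Suc n * K) + K) + Z * length L * ?g + K"
      have good: "set L \<subseteq> set (state_lists I)" "length L \<le> h" using Cons.prems by auto
      obtain R' Rs' where Rs: "Rs = R' # Rs'" using False by (cases Rs) auto
      have lvb: "lv_terms (j + 2) (length L') (fst (?b v L'))"
        if "v < n" "set L' \<subseteq> set (state_lists I)" for v L'
        using Cons.prems that by (intro lv_terms_best assms) auto
      have cho: "evl [enc_all_numbered ?its, enc_result (?h, Halt), enc_all_numbered ?its, enc_nat t, enc_reals (R # Rs),
          enc_nats S, enc_states L] (code ! 6)
        (enc_result (foldl (\<lambda>a (v, sl). if v \<in> set S then a
            else better a (combine v (map (\<lambda>s. ?b v [x\<leftarrow>L. x ! v = s]) sl))) (?h, Halt) ?its))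
        (Suc (length ?its) * (Suc n * K + K + ?X))"
      proof (rule ev_choose)
        fix v sl assume v: "(v, sl) \<in> set ?its" "v \<notin> set S"
        have v': "v < n" "sl = [0..<nstates I v]" using v by (auto simp: numbered_states_def)
        have sums: "(\<Sum>s\<leftarrow>sl. length [x\<leftarrow>L. x ! v = s]) \<le> length L"
          by (rule sum_list_filter_length) (simp add: v')
        have "evl [enc_nats sl, enc_nat v, enc_all_numbered ?its, enc_nat t, enc_reals Rs, enc_nats (v # S), enc_states L]
          (code ! 7) (enc_subtrees (map (\<lambda>s. ?b v [x\<leftarrow>L. x ! v = s]) sl))
          (length sl * (K + Suc (length L) * (Suc n * K) + K)
            + Z * ?g * (\<Sum>s\<leftarrow>sl. length [x\<leftarrow>L. x ! v = s]) + K)"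
        proof (rule ev_subtrees[where j = "j + 2"])
          fix L' assume L': "set L' \<subseteq> set (state_lists I)" "length L' \<le> h"
          show "evl [enc_all_numbered ?its, enc_nat t, enc_reals Rs, enc_nats (v # S), enc_states L'] (code ! 5)
            (enc_result (?b v L')) (K + Z * ?g * length L')"
            using Cons.IH[OF False, of "v # S" L'] Cons.prems v v' L' by (simp add: ac_simps)
          show "lv_terms (j + 2) (length L') (fst (?b v L'))" using lvb v' L' by simp
        qed (use assms v' good nstates_le[of v] in \<open>auto simp: num_bound_def\<close>)
        then show "evl [enc_nats sl, enc_nat v, enc_all_numbered ?its, enc_nat t, enc_reals Rs, enc_nats (v # S), enc_states L]
          (code ! 7) (enc_subtrees (map (\<lambda>s. ?b v [x\<leftarrow>L. x ! v = s]) sl)) ?X"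
        proof (rule evb_mono)
          have "length sl \<le> N" using v' nstates_le[of v] by simp
          then show "length sl * (K + Suc (length L) * (Suc n * K) + K)
            + Z * ?g * (\<Sum>s\<leftarrow>sl. length [x\<leftarrow>L. x ! v = s]) + K \<le> ?X"
            using mult_le_mono2[OF sums, of "Z * ?g"]
            by (intro add_le_mono mult_right_mono) (simp_all add: ac_simps)
        qed
        have "lv_terms (j + 2) (length L) (fst (combine v (map (\<lambda>s. ?b v [x\<leftarrow>L. x ! v = s]) sl)))"
          using lvb v' good by (intro combine_levels) auto
        from lv_mono[OF lv_terms_lv[OF this good(2)]]
        show "lv J (fst (combine v (map (\<lambda>s. ?b v [x\<leftarrow>L. x ! v = s]) sl)))" using assms by simp
      next
        have "lv_terms (j + 2) (length L) ?h"
          using Cons.prems assms S by (intro lv_terms_halt_value) auto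
        from lv_mono[OF lv_terms_lv[OF this good(2)]]
        show "lv J (fst (?h, Halt))" using assms by simp
      qed (use Cons.prems S fst_numbered_states in auto)
      have eq: "best (prob I t) (gain I t) ?its (R # Rs) S L = foldl (\<lambda>a (v, sl). if v \<in> set S then a
            else better a (combine v (map (\<lambda>s. ?b v [x\<leftarrow>L. x ! v = s]) sl))) (?h, Halt) ?its"
        using False L by (simp only: best.simps if_False list.distinct)
      have cost: "50 + Suc (length L) * K + Suc n * (Suc n * K + K + ?X)
         \<le> K + Z * length L * Suc (Suc n) ^ (Suc n - length S)"
        using Z_bound[of "length L" N ?g] good L S by (simp add: Suc_diff_le)
      have init: "enc_result (?h, Halt) = Node (Num ?h) Leaf" by (simp add: enc_result_def)
      have len: "length ?its = n" by (simp add: numbered_states_def)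
      note cho' = cho[folded eq, unfolded init len]
      show ?thesis
        unfolding code_nth(6) best_code_def
        apply (rule evb_mono)
         apply (unfold list.map enc_list.simps L Rs)
         apply (rule evb_If_Node, rule evb_Var)
         apply (rule evb_LetE)
          apply (rule evb_intros ev_Call code_index halt[unfolded L list.map enc_list.simps])+
         apply (rule evb_If_Node)
          apply (rule evb_intros)+
         apply (rule evb_intros ev_Call code_index cho'[unfolded list.map enc_list.simps L Rs])+
        using cost unfolding L by simp
    qed
  qed
qed simp

section \<open>Enumeration of the global states and list utilities\<close>

lemma ev_cons_all:
  "evl [enc_nat x, enc_states L, enc_states M] (code ! 8) (enc_states (map (Cons x) L @ M)) (Suc (length L) * K)"
proof (induction L)
  case Nil
  show ?case
    unfolding code_nth cons_all_code_def list.map enc_list.simps append_Nil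
    apply (rule evb_mono)
     apply (rule evb_If_Leaf evb_intros)+
    using K_ge by simp
next
  case (Cons y L)
  show ?case
    unfolding code_nth(9) cons_all_code_def list.map enc_list.simps append_Cons
    apply (rule evb_mono)
     apply (rule evb_If_Node evb_intros ev_Call Cons.IH | simp)+
    using K_ge by simp
qed

lemma ev_extend:
  "length L \<le> h \<Longrightarrow> evl [enc_nats xs, enc_states L] (code ! 9)
    (enc_states (concat (map (\<lambda>x. map (Cons x) L) xs))) (Suc (length xs) * (Suc (Suc h) * K))"
proof (induction xs)
  case Nil
  show ?case
    unfolding code_nth extend_code_def list.map enc_list.simps concat.simps
    apply (rule evb_mono)
     apply (rule evb_If_Leaf evb_intros)+
    using K_ge by simp
next
  case (Cons x xs)
  have "evl [enc_nat x, enc_states L, enc_states (concat (map (\<lambda>x. map (Cons x) L) xs))] (code ! 8)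
      (enc_states (map (Cons x) L @ concat (map (\<lambda>x. map (Cons x) L) xs))) (Suc h * K)"
    using Cons.prems by (intro evb_mono[OF ev_cons_all] mult_right_mono) auto
  note step = this
  show ?case
    unfolding code_nth(10) extend_code_def list.map(2) enc_list.simps concat.simps
    apply (rule evb_mono)
     apply (rule evb_If_Node evb_intros ev_Call Cons.IH[OF Cons.prems] step | simp)+
    using K_ge by (simp add: algebra_simps)
qed

text \<open>No factor is empty, so a further factor never shortens the product, and \<open>h\<close>
  bounds every intermediate list as well as the final one.\<close>

lemma ev_product:
  "length (product_lists xss) \<le> h \<Longrightarrow> \<forall>xs\<in>set xss. xs \<noteq> [] \<and> length xs \<le> N \<Longrightarrow>
   evl [enc_states xss] (code ! 10) (enc_states (product_lists xss))
     (Suc (length xss) * (Suc (Suc N) * (Suc (Suc h) * K)))"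
proof (induction xss)
  case Nil
  show ?case
    unfolding code_nth product_code_def list.map enc_list.simps product_lists.simps
    apply (rule evb_mono)
     apply (rule evb_If_Leaf evb_intros)+
    using K_ge by simp
next
  case (Cons xs xss)
  have "length (product_lists xss) \<le> length xs * length (product_lists xss)"
    using Cons.prems by (cases xs) simp_all
  also have "\<dots> = length (product_lists (xs # xss))"
    by (simp add: length_concat o_def sum_list_triv)
  finally have le: "length (product_lists xss) \<le> h" using Cons.prems(1) by simp
  have IH: "evl [enc_states xss] (code ! 10) (enc_states (product_lists xss))
     (Suc (length xss) * (Suc (Suc N) * (Suc (Suc h) * K)))"
    using Cons le by simp
  have step: "evl [enc_nats xs, enc_states (product_lists xss)] (code ! 9)
    (enc_states (concat (map (\<lambda>x. map (Cons x) (product_lists xss)) xs))) (Suc N * (Suc (Suc h) * K))"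
    using Cons.prems le by (intro evb_mono[OF ev_extend] mult_right_mono) auto
  show ?case
    unfolding code_nth(11) product_code_def list.map(2) enc_list.simps product_lists.simps
    apply (rule evb_mono)
     apply (rule evb_If_Node evb_intros ev_Call IH step | simp)+
    using K_ge by (simp add: algebra_simps)
qed

lemma ev_number:
  "i + length xss \<le> num_bound I \<Longrightarrow> evl [enc_states xss, enc_nat i] (code ! 11)
    (enc_all_numbered (zip [i..<i + length xss] xss)) (Suc (length xss) * K)"
proof (induction xss arbitrary: i)
  case Nil
  show ?case
    unfolding code_nth number_code_def list.map enc_list.simps zip.simps(1)
    apply (rule evb_mono)
     apply (rule evb_If_Leaf evb_intros)+
    using K_ge by simp
next
  case (Cons xs xss)
  have eq: "zip [i..<i + length (xs # xss)] (xs # xss) = (i, xs) # zip [Suc i..<Suc i + length xss] xss"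
    by (simp add: upt_conv_Cons del: upt_Suc)
  have IH: "evl [enc_states xss, enc_nat (Suc i)] (code ! 11)
    (enc_all_numbered (zip [Suc i..<Suc i + length xss] xss)) (Suc (length xss) * K)"
    using Cons.prems by (intro Cons.IH) simp
  have i: "i \<le> num_bound I" using Cons.prems by simp
  show ?case
    unfolding code_nth(12) number_code_def eq list.map(2) enc_list.simps enc_numbered_def fst_conv snd_conv
    apply (rule evb_mono)
     apply (rule evb_If_Node evb_intros ev_Call ev_succ i IH[unfolded enc_numbered_def] | simp)+
    using K_ge by (simp add: algebra_simps)
qed

lemma ev_rev:
  "evl [enc_list xs, enc_list ys] (code ! 12) (enc_list (rev xs @ ys)) (Suc (length xs) * K)"
proof (induction xs arbitrary: ys)
  case Nil
  show ?case
    unfolding code_nth rev_code_def enc_list.simps rev.simps append_Nil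
    apply (rule evb_mono)
     apply (rule evb_If_Leaf evb_intros)+
    using K_ge by simp
next
  case (Cons x xs)
  have IH: "evl [enc_list xs, Node x (enc_list ys)] (code ! 12) (enc_list (rev (x # xs) @ ys)) (Suc (length xs) * K)"
    using Cons.IH[of "x # ys"] by simp
  show ?case
    unfolding code_nth(13) rev_code_def enc_list.simps(2)
    apply (rule evb_mono)
     apply (rule evb_If_Node evb_intros ev_Call IH | simp)+
    using K_ge by simp
qed

section \<open>Rows of the table and the loop over the rounds\<close>

definition best_cost :: nat where
  "best_cost = K + Z * h * Suc (Suc n) ^ Suc n"

lemma ev_best_all:
  assumes "t \<in> {1..rounds I}" "1 \<le> j" "j + 4 \<le> J" "Rs \<noteq> []" "\<forall>R\<in>set Rs. lv j R"
  shows "evl [enc_all_numbered (numbered_states I), enc_nat t, enc_reals Rs, Leaf, enc_states (state_lists I)] (code ! 5)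
      (enc_result (best (prob I t) (gain I t) (numbered_states I) Rs [] (state_lists I))) best_cost"
  using ev_best[OF assms, of "[]" "state_lists I"] length_state_lists[of I]
  by (simp add: best_cost_def)

lemma ev_row:
  assumes "t \<in> {1..rounds I}" "1 \<le> j" "j + 4 \<le> J"
  defines "b \<equiv> \<lambda>Rs. best (prob I t) (gain I t) (numbered_states I) Rs [] (state_lists I)"
  shows "\<forall>R\<in>set Rs. lv j R \<Longrightarrow>
    evl [enc_all_numbered (numbered_states I), enc_nat t, enc_reals Rs, enc_states (state_lists I), enc_list acc]
      (code ! 13)
      (Node (enc_reals (map (fst \<circ> b) (tails Rs)))
        (enc_list (rev (map (enc_tree \<circ> snd \<circ> b) (tails Rs)) @ acc)))
      (Suc (length Rs) * (K + best_cost))"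
proof (induction Rs arbitrary: acc)
  case Nil
  show ?case
    unfolding code_nth row_code_def tails.simps list.map enc_list.simps rev.simps append_Nil
    apply (rule evb_mono)
     apply (rule evb_If_Leaf evb_intros)+
    using K_ge by simp
next
  case (Cons R Rs)
  let ?r = "b (R # Rs)"
  have best: "evl [enc_all_numbered (numbered_states I), enc_nat t, Node (Num R) (enc_reals Rs), Leaf,
      enc_states (state_lists I)] (code ! 5) (Node (Num (fst ?r)) (enc_tree (snd ?r))) best_cost"
    using ev_best_all[OF assms(1-3), of "R # Rs"] Cons.prems by (simp add: b_def enc_result_def)
  have IH: "evl [enc_all_numbered (numbered_states I), enc_nat t, enc_reals Rs, enc_states (state_lists I),
       Node (enc_tree (snd ?r)) (enc_list acc)]
      (code ! 13)
      (Node (enc_reals (map (fst \<circ> b) (tails Rs)))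
        (enc_list (rev (map (enc_tree \<circ> snd \<circ> b) (tails (R # Rs))) @ acc)))
      (Suc (length Rs) * (K + best_cost))"
    using Cons.IH[of "enc_tree (snd ?r) # acc"] Cons.prems by (simp add: comp_def)
  have eq: "enc_reals (map (fst \<circ> b) (tails (R # Rs)))
      = Node (Num (fst ?r)) (enc_reals (map (fst \<circ> b) (tails Rs)))"
    by simp
  show ?case
    unfolding code_nth(14) row_code_def eq list.map(2)[of Num] enc_list.simps(2)
    apply (rule evb_mono)
     apply (rule evb_If_Node evb_intros ev_Call best IH | rule code_index)+
    using K_ge by simp
qed

lemma ev_zeros:
  "b \<le> num_bound I \<Longrightarrow> evl [enc_nat b] (code ! 14) (enc_reals (replicate (Suc b) 0)) (Suc b * K)"
proof (induction b)
  case 0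
  show ?case
    unfolding code_nth zeros_code_def replicate.simps list.map enc_list.simps
    apply (rule evb_mono)
     apply (rule evb_intros ev_zero evb_If_Num ev_less_nat(1) ev_nat_1 | simp add: num_bound_def)+
    using K_ge by simp
next
  case (Suc b)
  then have IH: "evl [enc_nat b] (code ! 14) (enc_reals (replicate (Suc b) 0)) (Suc b * K)" by simp
  have nl: "\<not> Suc b < 1" by simp
  have one: "1 \<le> num_bound I" by (simp add: num_bound_def)
  show ?case
    unfolding code_nth(15) zeros_code_def replicate.simps(2)[of "Suc b"] list.map(2)[of Num] enc_list.simps(2)
    apply (rule evb_mono)
     apply (rule evb_intros ev_zero evb_If_Leaf ev_less_nat(2) ev_nat_1 nl one Suc.prems ev_Call ev_pred IH
        | rule code_index)+
    using K_ge by simp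
qed

text \<open>Dropping the head of a list indexed by decreasing budgets lowers the budget by one; the
  suffixes are thus the reward lists of all budgets.\<close>

lemma map_tails_values:
  "map f (tails (map g (rev [0..<k]))) = map (\<lambda>i. f (map g (rev [0..<Suc i]))) (rev [0..<k])"
  by (induction k) simp_all

lemma dp_best_eq_best:
  assumes "t \<in> {1..rounds I}"
  shows "dp_best I t i = best (prob I t) (gain I t) (numbered_states I)
     (map (\<lambda>j. fst (dp_best I (Suc t) j)) (rev [0..<Suc i])) [] (state_lists I)"
  using assms by (subst dp_best.simps) simp

text \<open>A round adds two levels for the terms and one for their sum; the rate 4 leaves slack.
  Even at round 1 the depth stays below \<open>J\<close>.\<close>

lemma lv_dp_best:
  assumes "t \<ge> 1" "t \<le> Suc (rounds I)"
  shows "lv (4 * (Suc (rounds I) - t) + 1) (fst (dp_best I t i))"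
  using assms
proof (induction "Suc (rounds I) - t" arbitrary: t i)
  case 0
  then show ?case using lv_nat[of 0] by (simp add: dp_best.simps)
next
  case (Suc k)
  then have t: "t \<in> {1..rounds I}" by auto
  let ?j = "4 * (Suc (rounds I) - Suc t) + 1"
  have "lv_terms (?j + 2) (length (state_lists I)) (fst (dp_best I t i))"
    unfolding dp_best_eq_best[OF t]
  proof (rule lv_terms_best[OF t])
    show "\<forall>R\<in>set (map (\<lambda>j. fst (dp_best I (Suc t) j)) (rev [0..<Suc i])). lv ?j R"
      using Suc.hyps(1)[of "Suc t"] Suc.hyps(2) Suc.prems t by auto
  qed auto
  then have "lv (Suc (?j + 2)) (fst (dp_best I t i))"
    by (rule lv_terms_lv) (simp add: length_state_lists)
  moreover have "Suc (?j + 2) = 4 * (Suc (rounds I) - t)" using t by auto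
  ultimately show ?case using lv_mono by (metis le_add1)
qed

abbreviation row_values :: "nat \<Rightarrow> real list" where
  "row_values t \<equiv> map (\<lambda>j. fst (dp_best I t j)) (rev [0..<Suc (budget I)])"

definition enc_row :: "nat \<Rightarrow> data" where
  "enc_row t = enc_list (map (enc_tree \<circ> (\<lambda>j. snd (dp_best I t j))) [0..<Suc (budget I)])"

lemma enc_dp_table: "enc_table (dp_table I) = enc_list (map enc_row [Suc 0..<Suc (rounds I)])"
  by (simp add: enc_table_def dp_table_def enc_row_def[abs_def] comp_def del: upt_Suc)

lemma ev_dp_row:
  assumes t: "t \<in> {1..rounds I}"
  shows "evl [enc_all_numbered (numbered_states I), enc_nat t, enc_reals (row_values (Suc t)), enc_states (state_lists I), Leaf]
      (code ! 13)
      (Node (enc_reals (row_values t)) (enc_row t))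
      (Suc (Suc (budget I)) * (K + best_cost))"
proof -
  let ?j = "4 * (Suc (rounds I) - Suc t) + 1"
  let ?b = "\<lambda>Rs. best (prob I t) (gain I t) (numbered_states I) Rs [] (state_lists I)"
  have lv: "\<forall>R\<in>set (row_values (Suc t)). lv ?j R" using lv_dp_best[of "Suc t"] t by auto
  have j: "?j + 4 \<le> J" using t by auto
  have "map f (tails (row_values (Suc t)))
     = map (\<lambda>i. f (map (\<lambda>j. fst (dp_best I (Suc t) j)) (rev [0..<Suc i]))) (rev [0..<Suc (budget I)])" for f :: "real list \<Rightarrow> 'z"
    by (rule map_tails_values)
  then have "map (fst \<circ> ?b) (tails (row_values (Suc t))) = row_values t"
    and "map (enc_tree \<circ> snd \<circ> ?b) (tails (row_values (Suc t)))
      = map (enc_tree \<circ> (\<lambda>j. snd (dp_best I t j))) (rev [0..<Suc (budget I)])"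
    unfolding dp_best_eq_best[OF t] by (simp_all add: comp_def del: upt_Suc)
  then show ?thesis
    using ev_row[OF t _ j lv, of "[]"] by (simp add: enc_row_def rev_map del: upt_Suc)
qed

definition rounds_cost :: "nat \<Rightarrow> nat" where
  "rounds_cost m = Suc m * (K + Suc (Suc (budget I)) * (K + best_cost))"

text \<open>The program recurses on the list of rounds before treating its head, so the last round
  is treated first; \<open>m\<close> counts the final rounds already covered.\<close>

lemma ev_rounds:
  "m \<le> rounds I \<Longrightarrow> evl [enc_nats [Suc (rounds I) - m..<Suc (rounds I)], enc_all_numbered (numbered_states I),
      enc_states (state_lists I), enc_nat (budget I)] (code ! 15)
    (Node (enc_reals (row_values (Suc (rounds I) - m)))
      (enc_list (map enc_row [Suc (rounds I) - m..<Suc (rounds I)])))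
    (rounds_cost m)"
proof (induction m)
  case 0
  \<comment> \<open>Beyond the last round every budget is worth 0.\<close>
  have z: "evl [enc_nat (budget I)] (code ! 14) (enc_reals (row_values (Suc (rounds I)))) (Suc (budget I) * K)"
  proof -
    have "row_values (Suc (rounds I)) = replicate (Suc (budget I)) 0"
      by (simp add: dp_best.simps map_replicate_const del: upt_Suc replicate.simps)
    then show ?thesis using ev_zeros[of "budget I"] by (simp add: num_bound_def del: upt_Suc)
  qed
  have r: "[Suc (rounds I)..<Suc (rounds I)] = []" "Suc (rounds I) - 0 = Suc (rounds I)" by simp_all
  show ?case
    unfolding code_nth(16) rounds_code_def r list.map(1) enc_list.simps
    apply (rule evb_mono)
     apply (rule evb_If_Leaf evb_intros ev_Call code_index z)+
    using K_ge by (simp add: rounds_cost_def algebra_simps)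
next
  case (Suc m)
  let ?t = "Suc (rounds I) - Suc m"
  have t: "?t \<in> {1..rounds I}" using Suc.prems by auto
  have S: "Suc (rounds I) - m = Suc ?t" using Suc.prems by auto
  have range: "[?t..<Suc (rounds I)] = ?t # [Suc ?t..<Suc (rounds I)]"
    using t by (simp add: upt_conv_Cons del: upt_Suc)
  note IH = Suc.IH[OF Suc_leD[OF Suc.prems], unfolded S]
  note row = ev_dp_row[OF t]
  show ?case
    unfolding code_nth(16) rounds_code_def range list.map(2)[of enc_nat] list.map(2)[of enc_row] enc_list.simps(2)
    apply (rule evb_mono)
     apply (rule evb_If_Node evb_intros ev_Call code_index IH row)+
    using K_ge by (simp add: rounds_cost_def algebra_simps)
qed

section \<open>Complete runs\<close>

lemma enc_instance_eq:
  "enc_instance I = Node (enc_nats [Suc 0..<Suc (rounds I)]) (Node (enc_nat (budget I))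
     (Node (enc_states (map (\<lambda>v. [0..<nstates I v]) [0..<n])) Leaf))"
  by (simp add: enc_instance_def comp_def del: upt_Suc)

text \<open>A distribution has nonempty support and all of it lies in the product of the local state
  sets, so none of these is empty.\<close>

lemma nstates_pos: "v < n \<Longrightarrow> nstates I v > 0"
proof -
  assume v: "v < n"
  have "1 \<in> {1..rounds I}" using valid by (simp add: valid_instance_def)
  then obtain s where "s \<in> global_states I"
    using set_state_dist[OF valid, of 1] set_pmf_not_empty[of "state_dist I 1"] by blast
  then have "s v \<in> {..<nstates I v}"
    unfolding global_states_def items_def by (rule PiE_mem) (simp add: v)
  then show ?thesis by simp
qed

definition setup_cost :: nat where
  "setup_cost = Suc n * K + Suc n * (Suc (Suc N) * (Suc (Suc h) * K))"

lemma ev_number_all: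
  "evl [enc_states (map (\<lambda>v. [0..<nstates I v]) [0..<n]), enc_nat 0] (code ! 11)
    (enc_all_numbered (numbered_states I)) (Suc n * K)"
proof -
  have "zip [0..<n] (map (\<lambda>v. [0..<nstates I v]) [0..<n]) = numbered_states I"
    by (simp add: numbered_states_def zip_map2 zip_same_conv_map)
  then show ?thesis
    using ev_number[of 0 "map (\<lambda>v. [0..<nstates I v]) [0..<n]"] by (simp add: num_bound_def)
qed

lemma ev_product_all:
  "evl [enc_states (map (\<lambda>v. [0..<nstates I v]) [0..<n])] (code ! 10)
    (enc_states (state_lists I)) (Suc n * (Suc (Suc N) * (Suc (Suc h) * K)))"
  using ev_product[of "map (\<lambda>v. [0..<nstates I v]) [0..<n]"] nstates_pos nstates_le length_state_lists[of I]
  by (simp add: state_lists_def)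

lemma run_table:
  assumes "main = table_main"
  shows "evl [enc_instance I] (Call 0 [Var 0]) (enc_table (dp_table I))
    (K + setup_cost + rounds_cost (rounds I))"
proof -
  have "Suc (rounds I) - rounds I = Suc 0" by simp
  note rounds = ev_rounds[OF order_refl, unfolded this]
  have m: "code ! 0 = table_main" using code_nth(1) assms by (rule trans)
  have "evl [enc_instance I] (code ! 0) (enc_table (dp_table I)) (50 + 2 * W + setup_cost + rounds_cost (rounds I))"
    unfolding m table_main_def enc_instance_eq enc_dp_table
    apply (rule evb_mono)
     apply (rule evb_intros ev_Call code_index ev_number_all ev_product_all ev_nat_0
        rounds)+
    by (simp add: setup_cost_def)
  then show ?thesis
    using K_ge by (intro evb_mono[OF ev_Call[OF _ evbs_Cons[OF evb_Var(1) evbs_Nil]]]) auto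
qed

text \<open>The given values \<open>R(t + 1, i)\<close> do not count towards the size of the
  instance, so their weights need a bound of their own. It comes from \<open>opt_value_eq\<close>:
  they are values of the backward induction and have bounded depth.\<close>

lemma run_tree:
  assumes "main = tree_main" and t: "t \<in> {1..rounds I}" and b: "b \<le> budget I"
  shows "evl [enc_SRm (I, t, b)] (Call 0 [Var 0])
    (enc_tree (snd (best (prob I t) (gain I t) (numbered_states I)
      (map (opt_value I (t + 1)) (rev [0..<Suc b])) [] (state_lists I))))
    (K + setup_cost + Suc (Suc b) * K + best_cost)"
proof -
  let ?Rs = "map (opt_value I (t + 1)) (rev [0..<Suc b])"
  let ?j = "4 * (Suc (rounds I) - Suc t) + 1"
  have "opt_value I (t + 1) i = fst (dp_best I (Suc t) i)" if "i \<le> b" for i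
    using opt_value_eq[OF valid, of "t + 1" i] b that by simp
  then have lv: "\<forall>R\<in>set ?Rs. lv ?j R" using lv_dp_best[of "Suc t"] t by auto
  have j: "?j + 4 \<le> J" using t by auto
  have enc: "enc_SRm (I, t, b) = Node (enc_instance I) (Node (enc_nat t) (Node (enc_nat b)
     (Node (enc_list (map (\<lambda>i. Num (opt_value I (t + 1) i)) [0..<Suc b])) Leaf)))"
    by (simp add: enc_SRm_def del: upt_Suc)
  have rev: "evl [enc_list (map (\<lambda>i. Num (opt_value I (t + 1) i)) [0..<Suc b]), Leaf] (code ! 12)
     (enc_reals ?Rs) (Suc (Suc b) * K)"
    using ev_rev[of "map (\<lambda>i. Num (opt_value I (t + 1) i)) [0..<Suc b]" "[]"]
    by (simp add: rev_map comp_def del: upt_Suc)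
  have best: "evl [enc_all_numbered (numbered_states I), enc_nat t, enc_reals ?Rs, Leaf, enc_states (state_lists I)] (code ! 5)
      (enc_result (best (prob I t) (gain I t) (numbered_states I) ?Rs [] (state_lists I))) best_cost"
    by (rule ev_best_all[OF t _ j _ lv]) simp_all
  have m: "code ! 0 = tree_main" using code_nth(1) assms(1) by (rule trans)
  have "evl [enc_SRm (I, t, b)] (code ! 0)
    (enc_tree (snd (best (prob I t) (gain I t) (numbered_states I) ?Rs [] (state_lists I))))
    (50 + 2 * W + setup_cost + Suc (Suc b) * K + best_cost)"
    unfolding m tree_main_def enc enc_instance_eq
    apply (rule evb_mono)
     apply (rule evb_intros ev_Call code_index ev_number_all ev_product_all ev_nat_0 rev best[unfolded enc_result_def])+
    by (simp add: setup_cost_def)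
  then show ?thesis
    using K_ge by (intro evb_mono[OF ev_Call[OF _ evbs_Cons[OF evb_Var(1) evbs_Nil]]]) auto
qed

section \<open>Size of the output\<close>

lemma data_size_enc_list: "data_size w (enc_list xs) = 1 + (\<Sum>x\<leftarrow>xs. 1 + data_size w x)"
  by (induction xs) auto

definition tree_size :: nat where
  "tree_size = 5 + W + 2 * N"

text \<open>Nodes on the same level of the tree have disjoint classes, so at most
  \<open>length L\<close> of them are proper nodes, and there are no more levels than rewards.
  \<open>tree_size\<close> pays for one proper node together with halting children for all its local
  states.\<close>

lemma data_size_best:
  "set S \<subseteq> {..<n} \<Longrightarrow> data_size w (enc_tree (snd (best p f (numbered_states I) Rs S L)))
     \<le> 1 + length Rs * length L * tree_size"
proof (induction Rs arbitrary: S L)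
  case (Cons R Rs)
  let ?b = "\<lambda>v. best p f (numbered_states I) Rs (v # S)"
  show ?case
    using foldl_better_cases[of S "\<lambda>v sl. combine v (map (\<lambda>s. ?b v [x\<leftarrow>L. x ! v = s]) sl)"
        "(halt_value p f R S L, Halt)" "numbered_states I"]
  proof (elim disjE exE conjE)
    fix v sl
    assume v: "(v, sl) \<in> set (numbered_states I)"
      and eq: "foldl (\<lambda>a (v, sl). if v \<in> set S then a
          else better a (combine v (map (\<lambda>s. ?b v [x\<leftarrow>L. x ! v = s]) sl)))
        (halt_value p f R S L, Halt) (numbered_states I)
        = combine v (map (\<lambda>s. ?b v [x\<leftarrow>L. x ! v = s]) sl)"
    have sl: "distinct sl" "v < n" "length sl \<le> N"
      using v nstates_le by (auto simp: numbered_states_def)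
    show ?thesis
    proof (cases "L = [] \<or> Rs = []")
      case False
      then have L: "1 \<le> length L" by (cases L) auto
      have "(\<Sum>s\<leftarrow>sl. 1 + data_size w (enc_tree (snd (?b v [x\<leftarrow>L. x ! v = s]))))
        \<le> (\<Sum>s\<leftarrow>sl. 2 + length Rs * tree_size * length [x\<leftarrow>L. x ! v = s])"
      proof (rule sum_list_mono)
        fix s
        show "1 + data_size w (enc_tree (snd (?b v [x\<leftarrow>L. x ! v = s])))
          \<le> 2 + length Rs * tree_size * length [x\<leftarrow>L. x ! v = s]"
          using Cons.IH[of "v # S" "[x\<leftarrow>L. x ! v = s]"] Cons.prems sl by (simp add: ac_simps)
      qed
      also have "\<dots> = 2 * length sl + length Rs * tree_size * (\<Sum>s\<leftarrow>sl. length [x\<leftarrow>L. x ! v = s])"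
        by (induction sl) (simp_all add: algebra_simps)
      also have "\<dots> \<le> 2 * N + length Rs * tree_size * length L"
        using sl sum_list_filter_length[OF sl(1)] by (intro add_le_mono mult_le_mono) auto
      finally have "(\<Sum>s\<leftarrow>sl. 1 + data_size w (enc_tree (snd (?b v [x\<leftarrow>L. x ! v = s]))))
        \<le> 2 * N + length Rs * tree_size * length L" .
      moreover have "data_size w (enc_nat v) \<le> 1 + W"
        using sl by (intro data_size_nat) (simp add: num_bound_def)
      moreover have "5 + W + 2 * N \<le> tree_size * length L"
        using mult_le_mono2[OF L, of tree_size] by (simp add: tree_size_def)
      ultimately show ?thesis
        using False eq by (simp add: combine_def data_size_enc_list comp_def algebra_simps)
    qed auto
  qed auto
qed simp

lemma data_size_table:
  "data_size w (enc_table (dp_table I))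
    \<le> 1 + rounds I * (2 + Suc (budget I) * (2 + Suc (budget I) * h * tree_size))"
proof -
  have tr: "data_size w (enc_tree (snd (dp_best I t j))) \<le> 1 + Suc (budget I) * h * tree_size"
    if "j \<le> budget I" for t j
  proof -
    have "data_size w (enc_tree (snd (dp_best I t j))) \<le> 1 + Suc j * h * tree_size"
      using data_size_best[of "[]" "prob I t" "gain I t" "map (\<lambda>i. fst (dp_best I (Suc t) i)) (rev [0..<Suc j])" "state_lists I"]
      by (subst dp_best.simps) (simp add: length_state_lists del: upt_Suc)
    also have "\<dots> \<le> 1 + Suc (budget I) * h * tree_size"
      using that by (intro add_le_mono mult_le_mono) auto
    finally show ?thesis .
  qed
  have row: "data_size w (enc_list (map enc_tree (map (\<lambda>j. snd (dp_best I t j)) [0..<Suc (budget I)])))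
    \<le> 1 + Suc (budget I) * (2 + Suc (budget I) * h * tree_size)" for t
  proof -
    have "(\<Sum>j\<leftarrow>[0..<Suc (budget I)]. 1 + data_size w (enc_tree (snd (dp_best I t j))))
      \<le> (\<Sum>j\<leftarrow>[0..<Suc (budget I)]. 2 + Suc (budget I) * h * tree_size)"
      by (rule sum_list_mono) (use tr[of _ t] in \<open>fastforce simp del: upt_Suc\<close>)
    then show ?thesis by (simp add: data_size_enc_list comp_def sum_list_triv del: upt_Suc)
  qed
  have "(\<Sum>t\<leftarrow>[1..<Suc (rounds I)]. 1 + data_size w (enc_list (map enc_tree (map (\<lambda>j. snd (dp_best I t j)) [0..<Suc (budget I)]))))
    \<le> (\<Sum>t\<leftarrow>[1..<Suc (rounds I)]. 2 + Suc (budget I) * (2 + Suc (budget I) * h * tree_size))"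
    by (rule sum_list_mono) (use row in \<open>fastforce simp del: upt_Suc\<close>)
  then show ?thesis
    by (simp add: enc_table_def dp_table_def data_size_enc_list comp_def sum_list_triv del: upt_Suc)
qed

end

section \<open>Weights of the numbers that occur\<close>

text \<open>On the real RAM every number weighs 1, so no depth has to be tracked.\<close>

lemma run_unit_weight:
  "valid_instance I \<Longrightarrow> run unit_weight I (\<lambda>_ _. True) 1"
  by unfold_locales (auto simp: unit_weight_def)

lemma bit_weight_Rats:
  assumes "x \<in> \<rat>"
  obtains a b :: int where "b > 0" "coprime a b" "x = a / b"
    "bit_weight x = floorlog 2 (nat \<bar>a\<bar>) + floorlog 2 (nat b)"
proof -
  from assms obtain r where r: "x = of_rat r" by (auto elim: Rats_cases)
  then have the: "(THE q. of_rat q = x) = r" by auto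
  obtain a b where q: "quotient_of r = (a, b)" by force
  show ?thesis
  proof
    show "b > 0" using quotient_of_denom_pos[OF q] .
    show "coprime a b" using quotient_of_coprime[OF q] .
    show "x = a / b" using quotient_of_div[OF q] r by (simp add: of_rat_divide)
    show "bit_weight x = floorlog 2 (nat \<bar>a\<bar>) + floorlog 2 (nat b)"
      by (simp add: bit_weight_def the q)
  qed
qed

lemma denominator_bit_weight:
  fixes x :: real and s :: nat
  assumes "x \<in> \<rat>" "bit_weight x \<le> s"
  shows "\<exists>d :: nat. 0 < d \<and> d \<le> 2 ^ s \<and> x * d \<in> \<int>" and "\<bar>x\<bar> \<le> 2 ^ s"
proof -
  obtain a b :: int where ab: "b > 0" "x = a / b"
    "bit_weight x = floorlog 2 (nat \<bar>a\<bar>) + floorlog 2 (nat b)"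
    using bit_weight_Rats[OF assms(1)] .
  have a: "nat \<bar>a\<bar> < 2 ^ s" and b: "nat b < 2 ^ s"
    by (rule floorlog_leD; use assms(2) ab(3) in linarith)+
  have "x * nat b = a" using ab by simp
  then show "\<exists>d :: nat. 0 < d \<and> d \<le> 2 ^ s \<and> x * d \<in> \<int>"
    using ab b by (intro exI[of _ "nat b"]) auto
  have "\<bar>x\<bar> \<le> \<bar>real_of_int a\<bar>"
    using ab mult_left_mono[of 1 "real_of_int b" "\<bar>real_of_int a\<bar>"] by (simp add: divide_le_eq)
  also have "\<dots> = real (nat \<bar>a\<bar>)" by simp
  also have "\<dots> \<le> real (2 ^ s)" using a by (intro of_nat_mono) simp
  finally show "\<bar>x\<bar> \<le> 2 ^ s" by simp
qed

text \<open>The numbers of depth \<open>j\<close> for the bit model: \<open>D\<close> is a common denominator of the numbers of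
  the instance, and \<open>2 ^ m\<close> bounds them.\<close>

definition rat_level :: "nat \<Rightarrow> nat \<Rightarrow> nat \<Rightarrow> real \<Rightarrow> bool" where
  "rat_level D m j x \<longleftrightarrow> x * real D ^ j \<in> \<int> \<and> \<bar>x\<bar> \<le> 2 ^ (m * j)"

text \<open>In lowest terms the denominator divides \<open>D ^ j\<close>, so it is at most
  \<open>2 ^ (d * j)\<close>; the numerator is the denominator times the absolute value. The final 2
  is one bit for each, since the powers of two themselves are included.\<close>

lemma rat_level_bit_weight:
  assumes "rat_level D m j x" "0 < D" "D \<le> 2 ^ d"
  shows "bit_weight x \<le> (m + 2 * d) * j + 2"
proof -
  obtain z :: int where z: "x * real D ^ j = z" using assms(1) unfolding rat_level_def by (auto elim: Ints_cases)
  then have x: "x = z / real D ^ j" using assms(2) by (simp add: field_simps)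
  then have "x \<in> \<rat>" by simp
  then obtain a b :: int where ab: "b > 0" "coprime a b" "x = a / b"
    "bit_weight x = floorlog 2 (nat \<bar>a\<bar>) + floorlog 2 (nat b)"
    using bit_weight_Rats by blast
  have Dj: "D ^ j \<le> 2 ^ (d * j)"
    using power_mono[OF assms(3), of j] by (simp add: power_mult)
  have "real_of_int (a * int D ^ j) = real_of_int (z * b)"
    using z ab by (simp add: field_simps)
  then have "a * int D ^ j = z * b" by linarith
  then have "b dvd a * int D ^ j" by simp
  then have "b dvd int D ^ j" using ab(2) by (metis coprime_commute coprime_dvd_mult_right_iff)
  then have b: "b \<le> int D ^ j" using assms(2) by (intro zdvd_imp_le) auto
  then have b': "real_of_int b \<le> real (D ^ j)" by (metis of_int_le_iff of_int_of_nat_eq of_nat_power)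
  from b have "nat b \<le> D ^ j" by (simp add: nat_le_iff)
  then have "nat b \<le> 2 ^ (d * j)" using Dj by linarith
  also have "\<dots> < 2 ^ (d * j + 1)" by simp
  finally have "nat b < 2 ^ (d * j + 1)" .
  then have fb: "floorlog 2 (nat b) \<le> d * j + 1" by (intro floorlog_leI) auto
  have "\<bar>real_of_int a\<bar> = \<bar>x\<bar> * real_of_int b" using ab by (simp add: abs_mult)
  also have "\<dots> \<le> 2 ^ (m * j) * real (D ^ j)"
    using assms(1) b' ab(1) unfolding rat_level_def by (intro mult_mono) auto
  also have "\<dots> \<le> 2 ^ (m * j) * real (2 ^ (d * j))"
    using Dj by (intro mult_left_mono of_nat_mono) auto
  also have "\<dots> = real (2 ^ ((m + d) * j))" by (simp add: power_add algebra_simps)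
  finally have "real (nat \<bar>a\<bar>) \<le> real (2 ^ ((m + d) * j))" by simp
  then have "nat \<bar>a\<bar> \<le> 2 ^ ((m + d) * j)" by linarith
  also have "(2 :: nat) ^ ((m + d) * j) < 2 ^ ((m + d) * j + 1)" by simp
  finally have "nat \<bar>a\<bar> < 2 ^ ((m + d) * j + 1)" .
  then have "floorlog 2 (nat \<bar>a\<bar>) \<le> (m + d) * j + 1" by (intro floorlog_leI) auto
  with fb show ?thesis unfolding ab(4) by (simp add: algebra_simps)
qed

lemma rat_level_mono:
  assumes "rat_level D m i x" "i \<le> j"
  shows "rat_level D m j x"
proof -
  have "x * real D ^ j = (x * real D ^ i) * real D ^ (j - i)"
    using assms(2) by (simp add: power_add[symmetric] mult.assoc)
  moreover have "(2 :: real) ^ (m * i) \<le> 2 ^ (m * j)" using assms(2) by (intro power_increasing) auto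
  ultimately show ?thesis using assms(1) unfolding rat_level_def
    by (metis Ints_mult Ints_of_nat Ints_power order_trans)
qed

lemma rat_level_add:
  assumes "rat_level D m j x" "rat_level D m j y" "m \<ge> 1"
  shows "rat_level D m (Suc j) (x + y)"
proof -
  have "\<bar>x + y\<bar> \<le> 2 * 2 ^ (m * j)" using assms unfolding rat_level_def by linarith
  also have "\<dots> \<le> 2 ^ m * 2 ^ (m * j)" using assms(3) power_increasing[of 1 m "2 :: real"] by simp
  finally have "\<bar>x + y\<bar> \<le> 2 ^ (m * Suc j)" by (simp add: power_add)
  moreover have "(x + y) * real D ^ Suc j = (x * real D ^ j + y * real D ^ j) * real D"
    by (simp add: algebra_simps)
  ultimately show ?thesis using assms unfolding rat_level_def
    by (metis Ints_add Ints_mult Ints_of_nat)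
qed

lemma rat_level_mult:
  assumes "rat_level D m i x" "rat_level D m j y"
  shows "rat_level D m (i + j) (x * y)"
proof -
  have "\<bar>x * y\<bar> \<le> 2 ^ (m * i) * 2 ^ (m * j)"
    using assms unfolding rat_level_def abs_mult by (intro mult_mono) auto
  then have "\<bar>x * y\<bar> \<le> 2 ^ (m * (i + j))" by (simp add: power_add algebra_simps)
  moreover have "x * y * real D ^ (i + j) = (x * real D ^ i) * (y * real D ^ j)"
    by (simp add: power_add)
  ultimately show ?thesis using assms unfolding rat_level_def by (metis Ints_mult)
qed

text \<open>All summands have the common denominator \<open>D ^ j\<close>, so adding them does not
  enlarge it. The extra level pays for the magnitude only, which grows by a factor of at most
  \<open>2 ^ m\<close>.\<close>

lemma rat_level_sum_list:
  assumes "\<forall>x\<in>set xs. rat_level D m j x" "length xs \<le> 2 ^ m"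
  shows "rat_level D m (Suc j) (sum_list xs)"
proof -
  have "\<bar>sum_list xs\<bar> \<le> length xs * 2 ^ (m * j) \<and> sum_list xs * real D ^ j \<in> \<int>"
    using assms(1)
  proof (induction xs)
    case (Cons x xs)
    then have "rat_level D m j x" by simp
    then have "\<bar>x\<bar> \<le> 2 ^ (m * j)" "x * real D ^ j \<in> \<int>" unfolding rat_level_def by auto
    moreover have "\<bar>x + sum_list xs\<bar> \<le> \<bar>x\<bar> + \<bar>sum_list xs\<bar>" by (rule abs_triangle_ineq)
    ultimately show ?case using Cons by (auto simp: algebra_simps intro: Ints_add)
  qed simp
  then have abs: "\<bar>sum_list xs\<bar> \<le> real (length xs) * 2 ^ (m * j)" and int: "sum_list xs * real D ^ j \<in> \<int>"
    by auto
  note abs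
  also have "real (length xs) * 2 ^ (m * j) \<le> real (2 ^ m) * 2 ^ (m * j)"
    using assms(2) by (intro mult_right_mono of_nat_mono) auto
  also have "\<dots> = 2 ^ (m * Suc j)" by (simp add: power_add)
  finally have "\<bar>sum_list xs\<bar> \<le> 2 ^ (m * Suc j)" .
  moreover have "sum_list xs * real D ^ Suc j = (sum_list xs * real D ^ j) * real D" by simp
  with int have "sum_list xs * real D ^ Suc j \<in> \<int>" by (metis Ints_mult Ints_of_nat)
  ultimately show ?thesis unfolding rat_level_def by blast
qed

lemma rat_level_of_nat: "k \<le> 2 ^ m \<Longrightarrow> rat_level D m 1 (real k)"
proof -
  assume "k \<le> 2 ^ m"
  then have "real k \<le> real (2 ^ m)" by (rule of_nat_mono)
  then show ?thesis unfolding rat_level_def by auto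
qed

section \<open>A common denominator for the instance\<close>

definition number_set :: "sbmsm \<Rightarrow> real set" where
  "number_set I = (\<lambda>(t, h). pmf (state_dist I t) h) ` ({1..rounds I} \<times> global_states I)
     \<union> (\<lambda>(t, h, S). reward I t S h) ` ({1..rounds I} \<times> global_states I \<times> Pow (items I))"

lemma finite_number_set: "finite (number_set I)"
  unfolding number_set_def using finite_global_states by (auto simp: items_def)

lemma card_number_set: "card (number_set I) \<le> rounds I * card (global_states I) * (1 + 2 ^ nitems I)"
proof -
  let ?A = "{1..rounds I} \<times> global_states I" and ?B = "{1..rounds I} \<times> global_states I \<times> Pow (items I)"
  have fin: "finite ?A" "finite ?B" using finite_global_states by (auto simp: items_def)
  have "card (number_set I) \<le> card ?A + card ?B"
    unfolding number_set_def
    by (rule order_trans[OF card_Un_le]) (intro add_le_mono card_image_le fin)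
  also have "\<dots> = rounds I * card (global_states I) * (1 + 2 ^ nitems I)"
    by (simp add: card_cartesian_product card_Pow items_def algebra_simps)
  finally show ?thesis .
qed

lemma weight_number_set: "x \<in> number_set I \<Longrightarrow> w x \<le> instance_size w I"
proof -
  assume "x \<in> number_set I"
  moreover have "finite ((\<lambda>(t, h). w (pmf (state_dist I t) h)) ` ({1..rounds I} \<times> global_states I))"
    "finite ((\<lambda>(t, h, S). w (reward I t S h)) ` ({1..rounds I} \<times> global_states I \<times> Pow (items I)))"
    using finite_global_states by (auto simp: items_def)
  note fin = this
  ultimately show ?thesis
    unfolding number_set_def instance_size_def
  proof (elim UnE)
    assume "x \<in> (\<lambda>(t, h). pmf (state_dist I t) h) ` ({1..rounds I} \<times> global_states I)"
    then have "w x \<in> (\<lambda>(t, h). w (pmf (state_dist I t) h)) ` ({1..rounds I} \<times> global_states I)" by force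
    from Max_ge[OF fin(1) this] show "w x \<le> data_size w (enc_instance I) +
      Max ((\<lambda>(t, h). w (pmf (state_dist I t) h)) ` ({1..rounds I} \<times> global_states I)) +
      Max ((\<lambda>(t, h, S). w (reward I t S h)) ` ({1..rounds I} \<times> global_states I \<times> Pow (items I)))" by linarith
  next
    assume "x \<in> (\<lambda>(t, h, S). reward I t S h) ` ({1..rounds I} \<times> global_states I \<times> Pow (items I))"
    then have "w x \<in> (\<lambda>(t, h, S). w (reward I t S h)) ` ({1..rounds I} \<times> global_states I \<times> Pow (items I))" by force
    from Max_ge[OF fin(2) this] show "w x \<le> data_size w (enc_instance I) +
      Max ((\<lambda>(t, h). w (pmf (state_dist I t) h)) ` ({1..rounds I} \<times> global_states I)) +
      Max ((\<lambda>(t, h, S). w (reward I t S h)) ` ({1..rounds I} \<times> global_states I \<times> Pow (items I)))" by linarith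
  qed
qed

text \<open>The product of the individual denominators serves: each contributes at most
  \<open>s\<close> bits.\<close>

lemma common_denominator:
  fixes A :: "real set"
  assumes "finite A" "\<forall>x\<in>A. \<exists>d :: nat. 0 < d \<and> d \<le> 2 ^ s \<and> x * d \<in> \<int>"
  shows "\<exists>D :: nat. 0 < D \<and> D \<le> 2 ^ (s * card A) \<and> (\<forall>x\<in>A. x * real D \<in> \<int>)"
  using assms
proof (induction A)
  case empty
  show ?case by (rule exI[of _ 1]) simp
next
  case (insert x A)
  then obtain D :: nat where D: "0 < D" "D \<le> 2 ^ (s * card A)" "\<forall>x\<in>A. x * real D \<in> \<int>" by auto
  from insert obtain d :: nat where d: "0 < d" "d \<le> 2 ^ s" "x * d \<in> \<int>" by auto
  have "d * D \<le> 2 ^ s * 2 ^ (s * card A)" using d D by (intro mult_le_mono)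
  moreover have "y * real (d * D) \<in> \<int>" if "y \<in> insert x A" for y
  proof (cases "y = x")
    case True
    have "x * real (d * D) = (x * d) * real D" by simp
    then show ?thesis using d True Ints_mult Ints_of_nat by metis
  next
    case False
    have "y * real (d * D) = (y * real D) * real d" by simp
    then show ?thesis using D that False Ints_mult Ints_of_nat by (metis insertE)
  qed
  ultimately show ?case using d D insert.hyps
    by (intro exI[of _ "d * D"]) (auto simp: power_add)
qed

text \<open>The bound \<open>(m + 2 * d) * j + 2\<close> of \<open>rat_level_bit_weight\<close> at
  the largest depth \<open>j\<close> that occurs.\<close>

definition bit_bound :: "sbmsm \<Rightarrow> nat" where
  "bit_bound I = (let s = instance_size bit_weight I; h = card (global_states I)
     in ((s + num_bound I + h + 1) + 2 * (s * (rounds I * h * (1 + 2 ^ nitems I)))) * (4 * rounds I + 8) + 2)"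

lemma run_bit_weight:
  assumes "valid_instance I" "rational_instance I"
  shows "\<exists>lv. run bit_weight I lv (bit_bound I)"
proof -
  let ?s = "instance_size bit_weight I" and ?h = "card (global_states I)"
  define d where "d = ?s * (rounds I * ?h * (1 + 2 ^ nitems I))"
  \<comment> \<open>Each summand serves one requirement: the size for the numbers of the instance,
    \<open>num_bound I\<close> for the natural numbers, \<open>?h\<close> for the number of
    summands, and 1 for the sum of two numbers.\<close>
  define m where "m = ?s + num_bound I + ?h + 1"
  have rat: "x \<in> \<rat>" "bit_weight x \<le> ?s" if "x \<in> number_set I" for x
    using assms(2) weight_number_set[OF that] that
    by (auto simp: number_set_def rational_instance_def)
  have dens: "\<forall>x\<in>number_set I. \<exists>d :: nat. 0 < d \<and> d \<le> 2 ^ ?s \<and> x * d \<in> \<int>"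
    using denominator_bit_weight(1)[OF rat] by simp
  obtain D :: nat where D: "0 < D" "D \<le> 2 ^ (?s * card (number_set I))" "\<forall>x\<in>number_set I. x * real D \<in> \<int>"
    using common_denominator[OF finite_number_set dens] by blast
  have "D \<le> 2 ^ d" unfolding d_def
    by (rule order_trans[OF D(2)]) (intro power_increasing mult_le_mono2 card_number_set, simp)
  note D = D(1) this D(3)
  have num: "rat_level D m 1 x" if "x \<in> number_set I" for x
  proof -
    have "\<bar>x\<bar> \<le> 2 ^ ?s" by (rule denominator_bit_weight(2)[OF rat[OF that]])
    also have "\<dots> \<le> 2 ^ m" by (intro power_increasing) (auto simp: m_def)
    finally show ?thesis using D(3) that by (simp add: rat_level_def)
  qed
  have small: "k \<le> 2 ^ m" if "k \<le> m" for k :: nat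
    using that less_exp[of m] by linarith
  have "run bit_weight I (rat_level D m) (bit_bound I)"
  proof
    show "valid_instance I" by fact
    show "rat_level D m i x \<Longrightarrow> i \<le> j \<Longrightarrow> rat_level D m j x" for i j x by (rule rat_level_mono)
    show "k \<le> num_bound I \<Longrightarrow> rat_level D m 1 (real k)" for k
      by (intro rat_level_of_nat small) (simp add: m_def)
    show "rat_level D m 1 (prob I t z)" if "t \<in> {1..rounds I}" "z \<in> set (state_lists I)" for t z
      using that bij_betwE[OF bij_betw_state_of] unfolding prob_def number_set_def
      by (intro num[unfolded number_set_def] UnI1 image_eqI[of _ _ "(t, state_of z)"]) auto
    show "rat_level D m 1 (gain I t S z)" if "t \<in> {1..rounds I}" "z \<in> set (state_lists I)" "S \<subseteq> items I" for t z S
      using that bij_betwE[OF bij_betw_state_of] unfolding gain_def number_set_def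
      by (intro num[unfolded number_set_def] UnI2 image_eqI[of _ _ "(t, state_of z, S)"]) auto
    show "rat_level D m j x \<Longrightarrow> rat_level D m j y \<Longrightarrow> rat_level D m (Suc j) (x + y)" for j x y
      by (rule rat_level_add) (auto simp: m_def)
    show "rat_level D m i x \<Longrightarrow> rat_level D m j y \<Longrightarrow> rat_level D m (i + j) (x * y)" for i j x y
      by (rule rat_level_mult)
    show "\<forall>x\<in>set xs. rat_level D m j x \<Longrightarrow> length xs \<le> ?h \<Longrightarrow> rat_level D m (Suc j) (sum_list xs)" for xs j
      by (rule rat_level_sum_list) (use small[of ?h] in \<open>auto simp: m_def\<close>)
    show "bit_weight x \<le> bit_bound I" if "rat_level D m j x" "j \<le> 4 * rounds I + 8" for j x
    proof -
      have "bit_weight x \<le> (m + 2 * d) * j + 2" using rat_level_bit_weight[OF that(1) D(1,2)] .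
      also have "\<dots> \<le> (m + 2 * d) * (4 * rounds I + 8) + 2" using that(2) by (intro add_le_mono mult_le_mono2) auto
      also have "\<dots> = bit_bound I" by (simp add: bit_bound_def m_def d_def Let_def)
      finally show ?thesis .
    qed
  qed
  then show ?thesis by blast
qed

section \<open>Bounds of the form \<open>F(n) \<cdot> |I| ^ k\<close>\<close>

text \<open>These functions are closed under products, because the factors \<open>a\<close> add up;
  they dominate both \<open>2 ^ n\<close> and \<open>(n + 2) ^ (n + 1)\<close>; and repeated
  squaring computes them, starting from the literal \<open>2 ^ a\<close>.\<close>

definition double_exp :: "nat \<Rightarrow> nat \<Rightarrow> nat" where
  "double_exp a k = 2 ^ (a * 2 ^ k)"

lemma double_exp_Suc: "double_exp a (Suc k) = double_exp a k * double_exp a k"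
  by (simp add: double_exp_def flip: power_add)

definition double_exp_prog :: "nat \<Rightarrow> program" where
  "double_exp_prog a = [IfE (Less (Var 0) (NumE 1)) (NumE (2 ^ a))
     (LetE (Call 0 [Arith Sub (Var 0) (NumE 1)]) (Arith Mul (Var 0) (Var 0)))]"

lemma evb_double_exp:
  "\<exists>C. evb unit_weight (double_exp_prog a) (\<lambda>_. Leaf) [Num (real k)] (double_exp_prog a ! 0)
     (Num (real (double_exp a k))) C"
proof (induction k)
  case 0
  have w: "unit_weight x \<le> 1" for x by (simp add: unit_weight_def)
  have l: "real 0 < real_of_int 1" by simp
  have n: "evb unit_weight (double_exp_prog a) (\<lambda>_. Leaf) env (NumE (2 ^ a)) (Num (real (double_exp a 0))) (1 + 1)" for env
    using evb_NumE[of unit_weight "2 ^ a" 1] w by (simp add: double_exp_def)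
  have p: "double_exp_prog a ! 0 = IfE (Less (Var 0) (NumE 1)) (NumE (2 ^ a))
     (LetE (Call 0 [Arith Sub (Var 0) (NumE 1)]) (Arith Mul (Var 0) (Var 0)))"
    by (simp add: double_exp_prog_def)
  show ?case
    unfolding p by (rule exI) (rule evb_If_Num evb_Less(1)[where W = 1] evb_intros n evb_NumE[where W = 1] w l)+
next
  case (Suc k)
  then obtain C where IH: "evb unit_weight (double_exp_prog a) (\<lambda>_. Leaf) [Num (real k)] (double_exp_prog a ! 0)
     (Num (real (double_exp a k))) C" by blast
  have w: "unit_weight x \<le> 1" for x by (simp add: unit_weight_def)
  have l: "\<not> real (Suc k) < real_of_int 1" by simp
  have m: "real (Suc k) - real_of_int 1 = real k" by simp
  have s: "evb unit_weight (double_exp_prog a) (\<lambda>_. Leaf) [Num (real (Suc k))] (Arith Sub (Var 0) (NumE 1)) (Num (real k)) (1 + 1 + (1 + 1) + 2 * 1)"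
    unfolding m[symmetric] by (rule evb_Sub evb_intros evb_NumE w)+
  have p: "double_exp_prog a ! 0 = IfE (Less (Var 0) (NumE 1)) (NumE (2 ^ a))
     (LetE (Call 0 [Arith Sub (Var 0) (NumE 1)]) (Arith Mul (Var 0) (Var 0)))"
    by (simp add: double_exp_prog_def)
  have len: "0 < length (double_exp_prog a)" by (simp add: double_exp_prog_def)
  have call: "evb unit_weight (double_exp_prog a) (\<lambda>_. Leaf) [Num (real (Suc k))]
      (Call 0 [Arith Sub (Var 0) (NumE 1)]) (Num (real (double_exp a k))) (1 + (1 + 1 + (1 + 1) + 2 * 1 + 0) + C)"
    by (rule evb_Call[OF len evbs_Cons[OF s evbs_Nil] IH])
  show ?case
    unfolding p double_exp_Suc of_nat_mult
    by (rule exI) (rule evb_If_Leaf evb_Less(2)[where W = 1] call evb_intros evb_Mul[where W = 1] evb_NumE[where W = 1] w l)+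
qed

lemma computable_double_exp: "computable (double_exp a)"
  unfolding computable_def
proof (intro exI[of _ "double_exp_prog a"] allI)
  fix k
  obtain C where "evb unit_weight (double_exp_prog a) (\<lambda>_. Leaf) [Num (real k)] (double_exp_prog a ! 0)
     (Num (real (double_exp a k))) C" using evb_double_exp by blast
  then have "evb unit_weight (double_exp_prog a) (\<lambda>_. Leaf) [Num (real k)] (Call 0 [Var 0])
     (Num (real (double_exp a k))) (1 + (1 + 0) + C)"
    by (intro evb_Call[OF _ evbs_Cons[OF evb_Var(1) evbs_Nil]]) (simp_all add: double_exp_prog_def)
  then show "\<exists>c. runs unit_weight (double_exp_prog a) (\<lambda>_. Leaf) (Num (real k)) (Num (real (double_exp a k))) c"
    unfolding evb_def runs_def by blast
qed

section \<open>Closure properties of the bounds\<close>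

definition fpt_bounded :: "(real \<Rightarrow> nat) \<Rightarrow> sbmsm set \<Rightarrow> (sbmsm \<Rightarrow> nat) \<Rightarrow> bool" where
  "fpt_bounded w C X \<longleftrightarrow> (\<exists>a k. \<forall>I\<in>C. X I \<le> double_exp a (nitems I) * instance_size w I ^ k)"

lemma length_le_data_size: "length xs \<le> data_size w (enc_list xs)"
  by (induction xs) auto

lemma sum_length_le_data_size:
  "(\<Sum>xs\<leftarrow>xss. length xs) \<le> data_size w (enc_list (map enc_list xss))"
  using length_le_data_size[of _ w] by (induction xss) (auto intro: add_le_mono le_SucI)

lemma instance_size_ge:
  shows instance_size_ge_2: "2 \<le> instance_size w I"
    and rounds_le_size: "rounds I \<le> instance_size w I"
    and nitems_le_size: "nitems I \<le> instance_size w I"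
    and nstates_le_size: "(\<Sum>v<nitems I. nstates I v) \<le> instance_size w I"
proof -
  let ?r = "enc_list (map enc_nat [1..<Suc (rounds I)])"
  let ?h = "enc_list (map (\<lambda>v. enc_list (map enc_nat [0..<nstates I v])) [0..<nitems I])"
  have s: "data_size w ?r + data_size w ?h + 2 \<le> instance_size w I"
    by (simp add: instance_size_def enc_instance_def)
  show "2 \<le> instance_size w I" using s by linarith
  show "rounds I \<le> instance_size w I"
    using s length_le_data_size[of "map enc_nat [1..<Suc (rounds I)]" w] by (simp del: upt_Suc)
  show "nitems I \<le> instance_size w I"
    using s length_le_data_size[of "map (\<lambda>v. enc_list (map enc_nat [0..<nstates I v])) [0..<nitems I]" w] by simp
  have "(\<Sum>v<nitems I. nstates I v) = (\<Sum>xs\<leftarrow>map (\<lambda>v. map enc_nat [0..<nstates I v]) [0..<nitems I]. length xs)"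
    by (simp add: comp_def interv_sum_list_conv_sum_set_nat atLeast0LessThan)
  also have "\<dots> \<le> data_size w (enc_list (map enc_list (map (\<lambda>v. map enc_nat [0..<nstates I v]) [0..<nitems I])))"
    by (rule sum_length_le_data_size)
  also have "\<dots> = data_size w ?h" by (simp add: comp_def)
  finally show "(\<Sum>v<nitems I. nstates I v) \<le> instance_size w I" using s by linarith
qed

lemma double_exp_ge_1: "1 \<le> double_exp a k"
  by (simp add: double_exp_def)

lemma fpt_bounded_mono:
  "fpt_bounded w C Y \<Longrightarrow> (\<And>I. I \<in> C \<Longrightarrow> X I \<le> Y I) \<Longrightarrow> fpt_bounded w C X"
  unfolding fpt_bounded_def using order_trans by meson

lemma fpt_bounded_size: "fpt_bounded w C (instance_size w)"
  unfolding fpt_bounded_def by (intro exI[of _ 0] exI[of _ 1]) (simp add: double_exp_def)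

lemma fpt_bounded_mult:
  assumes "fpt_bounded w C X" "fpt_bounded w C Y"
  shows "fpt_bounded w C (\<lambda>I. X I * Y I)"
proof -
  obtain a k b l where
    "\<forall>I\<in>C. X I \<le> double_exp a (nitems I) * instance_size w I ^ k"
    "\<forall>I\<in>C. Y I \<le> double_exp b (nitems I) * instance_size w I ^ l"
    using assms unfolding fpt_bounded_def by blast
  then have "\<forall>I\<in>C. X I * Y I \<le> (double_exp a (nitems I) * instance_size w I ^ k) *
      (double_exp b (nitems I) * instance_size w I ^ l)"
    by (auto intro: mult_le_mono)
  also have "(\<lambda>I. (double_exp a (nitems I) * instance_size w I ^ k) * (double_exp b (nitems I) * instance_size w I ^ l))
     = (\<lambda>I. double_exp (a + b) (nitems I) * instance_size w I ^ (k + l))"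
    by (simp add: double_exp_def power_add algebra_simps)
  finally show ?thesis unfolding fpt_bounded_def by blast
qed

text \<open>A constant \<open>c\<close> is at most \<open>2 ^ c\<close>, and the size is at least
  2.\<close>

lemma fpt_bounded_const: "fpt_bounded w C (\<lambda>_. c)"
proof -
  have "c \<le> double_exp 0 (nitems I) * instance_size w I ^ c" for I
    using order_trans[OF less_imp_le[OF less_exp[of c]] power_mono[OF instance_size_ge_2[of w I], of c]]
    by (simp add: double_exp_def)
  then show ?thesis unfolding fpt_bounded_def by blast
qed

text \<open>Sums reduce to products by \<open>x + y \<le> (x + 1) * (y + 1)\<close>. Adding 1 at
  most doubles a positive bound, which one further power of the size absorbs.\<close>

lemma fpt_bounded_add:
  assumes "fpt_bounded w C X" "fpt_bounded w C Y"
  shows "fpt_bounded w C (\<lambda>I. X I + Y I)"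
proof -
  have "fpt_bounded w C (\<lambda>I. (X I + 1) * (Y I + 1))" if "fpt_bounded w C (\<lambda>I. X I + 1)" "fpt_bounded w C (\<lambda>I. Y I + 1)"
    using that by (rule fpt_bounded_mult)
  moreover have "fpt_bounded w C (\<lambda>I. X I + 1)" if X: "fpt_bounded w C X" for X
  proof -
    obtain a k where "\<forall>I\<in>C. X I \<le> double_exp a (nitems I) * instance_size w I ^ k"
      using X unfolding fpt_bounded_def by blast
    moreover have "double_exp a (nitems I) * instance_size w I ^ k + 1
        \<le> double_exp a (nitems I) * instance_size w I ^ Suc k" for I
    proof -
      have "1 * 1 \<le> double_exp a (nitems I) * instance_size w I ^ k"
        using instance_size_ge_2[of w I] by (intro mult_le_mono double_exp_ge_1) simp
      moreover have "2 * (double_exp a (nitems I) * instance_size w I ^ k)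
          \<le> instance_size w I * (double_exp a (nitems I) * instance_size w I ^ k)"
        by (intro mult_le_mono1 instance_size_ge_2)
      ultimately show ?thesis unfolding power_Suc by (simp only: mult_1 mult.left_commute)
    qed
    ultimately have "\<forall>I\<in>C. X I + 1 \<le> double_exp a (nitems I) * instance_size w I ^ Suc k"
      by (meson add_le_mono1 order_trans)
    then show ?thesis unfolding fpt_bounded_def by blast
  qed
  ultimately have "fpt_bounded w C (\<lambda>I. (X I + 1) * (Y I + 1))" using assms by blast
  then show ?thesis by (rule fpt_bounded_mono) simp
qed

lemma fpt_bounded_Suc: "fpt_bounded w C X \<Longrightarrow> fpt_bounded w C (\<lambda>I. Suc (X I))"
  using fpt_bounded_add[OF _ fpt_bounded_const[of w C 1], of X] by simp

lemma fpt_bounded_poly: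
  fixes p :: "nat poly"
  assumes "fpt_bounded w C X"
  shows "fpt_bounded w C (\<lambda>I. poly p (X I))"
proof (induction p)
  case (pCons a p)
  show ?case
    unfolding poly_pCons by (intro fpt_bounded_add fpt_bounded_const fpt_bounded_mult assms pCons.IH)
qed (simp add: fpt_bounded_const)

lemma fpt_bounded_exp_nitems: "fpt_bounded w C (\<lambda>I. 2 ^ nitems I)"
proof -
  have "2 ^ nitems I \<le> double_exp 1 (nitems I) * instance_size w I ^ 0" for I
    using less_exp[of "nitems I"] by (simp add: double_exp_def power_increasing)
  then show ?thesis unfolding fpt_bounded_def by blast
qed

lemma square_le_exp: "Suc k * Suc k \<le> 4 * 2 ^ k"
proof (induction k)
  case (Suc k)
  have "Suc k \<le> 2 ^ k" using less_exp[of k] by (simp only: Suc_le_eq)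
  then have "2 * k + 3 \<le> 4 * 2 ^ k" by linarith
  then show ?case using Suc by simp
qed simp

text \<open>From \<open>n + 2 \<le> 2 ^ (n + 1)\<close> the exponent of 2 is at most
  \<open>(n + 1) * (n + 1)\<close>, hence at most \<open>4 * 2 ^ n\<close>.\<close>

lemma fpt_bounded_power_nitems: "fpt_bounded w C (\<lambda>I. Suc (Suc (nitems I)) ^ Suc (nitems I))"
proof -
  have "Suc (Suc k) ^ Suc k \<le> double_exp 4 k" for k
  proof -
    have "Suc (Suc k) \<le> 2 ^ Suc k" using less_exp[of "Suc k"] by (simp only: Suc_le_eq)
    then have "Suc (Suc k) ^ Suc k \<le> (2 ^ Suc k) ^ Suc k" by (intro power_mono) auto
    also have "\<dots> = 2 ^ (Suc k * Suc k)" by (simp only: power_mult)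
    also have "\<dots> \<le> double_exp 4 k"
      unfolding double_exp_def by (intro power_increasing square_le_exp) simp
    finally show ?thesis .
  qed
  then have "\<forall>I\<in>C. Suc (Suc (nitems I)) ^ Suc (nitems I) \<le> double_exp 4 (nitems I) * instance_size w I ^ 0"
    by simp
  then show ?thesis unfolding fpt_bounded_def by blast
qed

text \<open>The program and the constants are fixed before the instance. The map \<open>inst\<close>
  extracts the underlying instance, so that one lemma covers both problems.\<close>

lemma fpt_bounded_solvable:
  assumes "fpt_bounded w C X"
    and "\<And>x. x \<in> P \<Longrightarrow> inst x \<in> C"
    and "\<And>x. x \<in> P \<Longrightarrow> \<exists>y c. evb w prog (orc x) [inp x] (Call 0 [Var 0]) y c \<and> correct x y \<and>
        c + data_size w y \<le> X (inst x)"
  shows "solvable_fpt w P orc inp (\<lambda>x. nitems (inst x)) (\<lambda>x. instance_size w (inst x)) correct"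
proof -
  obtain a k where X: "\<forall>I\<in>C. X I \<le> double_exp a (nitems I) * instance_size w I ^ k"
    using assms(1) unfolding fpt_bounded_def by blast
  show ?thesis
    unfolding solvable_fpt_def
  proof (intro exI[of _ prog] exI[of _ "double_exp a"] exI[of _ k] conjI ballI computable_double_exp)
    fix x assume x: "x \<in> P"
    obtain y c where y: "evb w prog (orc x) [inp x] (Call 0 [Var 0]) y c" "correct x y"
      "c + data_size w y \<le> X (inst x)" using assms(3)[OF x] by blast
    obtain c' where "c' \<le> c" "runs w prog (orc x) (inp x) y c'"
      using y(1) unfolding evb_def runs_def by blast
    moreover from this have "c' + data_size w y \<le> double_exp a (nitems (inst x)) * instance_size w (inst x) ^ k"
      using y(3) X assms(2)[OF x] by fastforce
    ultimately show "\<exists>y c. runs w prog (orc x) (inp x) y c \<and> correct x y \<and>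
        c + data_size w y \<le> double_exp a (nitems (inst x)) * instance_size w (inst x) ^ k"
      using y(2) by blast
  qed
qed

lemma fpt_bounded_rounds: "fpt_bounded w C rounds"
  by (rule fpt_bounded_mono[OF fpt_bounded_size]) (rule rounds_le_size)

lemma fpt_bounded_nitems: "fpt_bounded w C nitems"
  by (rule fpt_bounded_mono[OF fpt_bounded_size]) (rule nitems_le_size)

lemma fpt_bounded_nstates: "fpt_bounded w C (\<lambda>I. \<Sum>v<nitems I. nstates I v)"
  by (rule fpt_bounded_mono[OF fpt_bounded_size]) (rule nstates_le_size)

text \<open>The encoding of a budget can be much shorter than its value, so its size gives no bound
  on the number of columns; \<open>B < n * T\<close> does.\<close>

lemma fpt_bounded_budget:
  assumes "\<And>I. I \<in> C \<Longrightarrow> valid_instance I"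
  shows "fpt_bounded w C budget"
  by (rule fpt_bounded_mono[OF fpt_bounded_mult[OF fpt_bounded_nitems fpt_bounded_rounds]])
    (use assms in \<open>auto simp: valid_instance_def less_imp_le\<close>)

section \<open>Collecting the costs\<close>

context
  fixes w :: "real \<Rightarrow> nat" and C :: "sbmsm set" and W :: "sbmsm \<Rightarrow> nat"
  assumes W: "fpt_bounded w C W"
    and h: "fpt_bounded w C (\<lambda>I. card (global_states I))"
    and instances: "\<And>I. I \<in> C \<Longrightarrow> valid_instance I"
    and run: "\<And>I. I \<in> C \<Longrightarrow> \<exists>lv. run w I lv (W I)"
begin

lemmas fpt_bounded_basic = fpt_bounded_const fpt_bounded_rounds fpt_bounded_nitems
  fpt_bounded_nstates fpt_bounded_budget[OF instances] fpt_bounded_power_nitems W h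

lemmas fpt_bounded_intros = fpt_bounded_basic fpt_bounded_Suc fpt_bounded_add fpt_bounded_mult

text \<open>The cost constants depend only on \<open>I\<close> and \<open>W I\<close>, but their
  defining equations are available only for an actual \<open>run\<close>. For this reason each of
  the following bounds interprets the locale, with any \<open>lv\<close>.\<close>

lemma fpt_bounded_K: "fpt_bounded w C (\<lambda>I. run.K I (W I))"
proof (rule fpt_bounded_mono)
  show "fpt_bounded w C (\<lambda>I. 100 + 100 * W I + 10 * (20 + 4 * W I + 2 * nitems I * (W I + 2)))"
    by (intro fpt_bounded_intros)
  fix I assume "I \<in> C"
  then obtain lv where "run w I lv (W I)" using run by blast
  then interpret run w I lv "W I" .
  show "run.K I (W I) \<le> 100 + 100 * W I + 10 * (20 + 4 * W I + 2 * nitems I * (W I + 2))"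
    by (simp add: K_def Q_def)
qed

lemma fpt_bounded_Z: "fpt_bounded w C (\<lambda>I. run.Z I (W I))"
proof (rule fpt_bounded_mono)
  let ?K = "\<lambda>I. run.K I (W I)" and ?h = "\<lambda>I. card (global_states I)"
    and ?N = "\<lambda>I. \<Sum>v<nitems I. nstates I v"
  show "fpt_bounded w C (\<lambda>I. ?K I + Suc (?h I) * ?K I + Suc (nitems I) * (Suc (nitems I) * ?K I + ?K I
    + (?N I * (?K I + Suc (?h I) * (Suc (nitems I) * ?K I) + ?K I) + ?K I)))"
    by (intro fpt_bounded_intros fpt_bounded_K)
  fix I assume "I \<in> C"
  then obtain lv where "run w I lv (W I)" using run by blast
  then interpret run w I lv "W I" .
  show "run.Z I (W I) \<le> ?K I + Suc (?h I) * ?K I + Suc (nitems I) * (Suc (nitems I) * ?K I + ?K I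
    + (?N I * (?K I + Suc (?h I) * (Suc (nitems I) * ?K I) + ?K I) + ?K I))"
    by (simp only: Z_def)
qed

lemma fpt_bounded_best_cost: "fpt_bounded w C (\<lambda>I. run.best_cost I (W I))"
proof (rule fpt_bounded_mono)
  show "fpt_bounded w C (\<lambda>I. run.K I (W I) +
      run.Z I (W I) * card (global_states I) * Suc (Suc (nitems I)) ^ Suc (nitems I))"
    by (intro fpt_bounded_intros fpt_bounded_K fpt_bounded_Z)
  fix I assume "I \<in> C"
  then obtain lv where "run w I lv (W I)" using run by blast
  then interpret run w I lv "W I" .
  show "run.best_cost I (W I) \<le> run.K I (W I) +
      run.Z I (W I) * card (global_states I) * Suc (Suc (nitems I)) ^ Suc (nitems I)"
    by (simp only: best_cost_def)
qed

lemma fpt_bounded_setup_cost: "fpt_bounded w C (\<lambda>I. run.setup_cost I (W I))"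
proof (rule fpt_bounded_mono)
  let ?K = "\<lambda>I. run.K I (W I)"
  show "fpt_bounded w C (\<lambda>I. Suc (nitems I) * ?K I + Suc (nitems I) *
      (Suc (Suc (\<Sum>v<nitems I. nstates I v)) * (Suc (Suc (card (global_states I))) * ?K I)))"
    by (intro fpt_bounded_intros fpt_bounded_K)
  fix I assume "I \<in> C"
  then obtain lv where "run w I lv (W I)" using run by blast
  then interpret run w I lv "W I" .
  show "run.setup_cost I (W I) \<le> Suc (nitems I) * ?K I + Suc (nitems I) *
      (Suc (Suc (\<Sum>v<nitems I. nstates I v)) * (Suc (Suc (card (global_states I))) * ?K I))"
    by (simp only: setup_cost_def)
qed

lemma fpt_bounded_rounds_cost: "fpt_bounded w C (\<lambda>I. run.rounds_cost I (W I) (rounds I))"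
proof (rule fpt_bounded_mono)
  show "fpt_bounded w C (\<lambda>I. Suc (rounds I) *
      (run.K I (W I) + Suc (Suc (budget I)) * (run.K I (W I) + run.best_cost I (W I))))"
    by (intro fpt_bounded_intros fpt_bounded_K fpt_bounded_best_cost)
  fix I assume "I \<in> C"
  then obtain lv where "run w I lv (W I)" using run by blast
  then interpret run w I lv "W I" .
  show "run.rounds_cost I (W I) (rounds I) \<le> Suc (rounds I) *
      (run.K I (W I) + Suc (Suc (budget I)) * (run.K I (W I) + run.best_cost I (W I)))"
    by (simp only: rounds_cost_def)
qed

lemma fpt_bounded_tree_size: "fpt_bounded w C (\<lambda>I. run.tree_size I (W I))"
proof (rule fpt_bounded_mono)
  show "fpt_bounded w C (\<lambda>I. 5 + W I + 2 * (\<Sum>v<nitems I. nstates I v))"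
    by (intro fpt_bounded_intros)
  fix I assume "I \<in> C"
  then obtain lv where "run w I lv (W I)" using run by blast
  then interpret run w I lv "W I" .
  show "run.tree_size I (W I) \<le> 5 + W I + 2 * (\<Sum>v<nitems I. nstates I v)"
    by (simp only: tree_size_def)
qed

lemma SBMSm_fpt: "SBMSm_fpt w C"
proof -
  let ?X = "\<lambda>I. run.K I (W I) + run.setup_cost I (W I) + run.rounds_cost I (W I) (rounds I)
    + (1 + rounds I * (2 + Suc (budget I) * (2 + Suc (budget I) * card (global_states I) * run.tree_size I (W I))))"
  have "fpt_bounded w C ?X"
    by (intro fpt_bounded_intros fpt_bounded_K fpt_bounded_setup_cost fpt_bounded_rounds_cost fpt_bounded_tree_size)
  then have "solvable_fpt w C answer enc_instance (\<lambda>I. nitems I) (\<lambda>I. instance_size w I)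
    (\<lambda>I y. \<exists>tbl. y = enc_table tbl \<and> is_table I tbl \<and> optimal_policy I (table_policy I tbl))"
  proof (rule fpt_bounded_solvable[where inst = "\<lambda>I. I" and prog = "table_main # code_common"])
    fix I assume I: "I \<in> C"
    then obtain lv where "run w I lv (W I)" using run by blast
    then interpret run w I lv "W I" table_main .
    show "\<exists>y c. evb w (table_main # code_common) (answer I) [enc_instance I] (Call 0 [Var 0]) y c \<and>
        (\<exists>tbl. y = enc_table tbl \<and> is_table I tbl \<and> optimal_policy I (table_policy I tbl)) \<and>
        c + data_size w y \<le> ?X I"
      using run_table[OF refl, unfolded code_def] data_size_table is_table_dp optimal_policy_dp[OF valid]
        add_left_mono by blast
  qed
  then show ?thesis unfolding SBMSm_fpt_def by simp
qed

lemma SRm_fpt: "SRm_fpt w C"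
proof -
  let ?X = "\<lambda>I. run.K I (W I) + run.setup_cost I (W I) + Suc (Suc (budget I)) * run.K I (W I) + run.best_cost I (W I)
    + (1 + Suc (budget I) * card (global_states I) * run.tree_size I (W I))"
  let ?P = "{(I, t, b). I \<in> C \<and> t \<in> {1..rounds I} \<and> b \<le> budget I}"
  have "fpt_bounded w C ?X"
    by (intro fpt_bounded_intros fpt_bounded_K fpt_bounded_setup_cost fpt_bounded_best_cost fpt_bounded_tree_size)
  then have "solvable_fpt w ?P (\<lambda>(I, t, b). answer I) enc_SRm (\<lambda>x. nitems (fst x)) (\<lambda>x. instance_size w (fst x))
    (\<lambda>(I, t, b) y. \<exists>tr. y = enc_tree tr \<and> optimal_policy1 I t b (tree_policy tr))"
  proof (rule fpt_bounded_solvable[where prog = "tree_main # code_common"])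
    fix x assume "x \<in> ?P"
    then obtain I t b where x: "x = (I, t, b)" and I: "I \<in> C" and t: "t \<in> {1..rounds I}" and b: "b \<le> budget I"
      by auto
    then obtain lv where "run w I lv (W I)" using run by blast
    then interpret run w I lv "W I" tree_main .
    let ?T = "snd (best (prob I t) (gain I t) (numbered_states I)
      (map (opt_value I (t + 1)) (rev [0..<Suc b])) [] (state_lists I))"
    have "data_size w (enc_tree ?T) \<le> 1 + Suc b * card (global_states I) * run.tree_size I (W I)"
      using data_size_best[of "[]" "prob I t" "gain I t" "map (opt_value I (t + 1)) (rev [0..<Suc b])" "state_lists I"]
      by (simp add: length_state_lists del: upt_Suc)
    also have "\<dots> \<le> 1 + Suc (budget I) * card (global_states I) * run.tree_size I (W I)"
      using b by (intro add_le_mono mult_le_mono) auto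
    finally have size: "data_size w (enc_tree ?T) \<le> \<dots>" .
    show "\<exists>y c. evb w (tree_main # code_common) ((\<lambda>(I, t, b). answer I) x) [enc_SRm x] (Call 0 [Var 0]) y c \<and>
        (\<lambda>(I, t, b) y. \<exists>tr. y = enc_tree tr \<and> optimal_policy1 I t b (tree_policy tr)) x y \<and>
        c + data_size w y \<le> ?X (fst x)"
      unfolding x prod.case fst_conv
    proof (intro exI conjI)
      show "evb w (tree_main # code_common) (answer I) [enc_SRm (I, t, b)] (Call 0 [Var 0]) (enc_tree ?T)
        (K + setup_cost + Suc (Suc b) * K + best_cost)"
        using run_tree[OF refl t b, unfolded code_def] .
      show "enc_tree ?T = enc_tree ?T" ..
      show "optimal_policy1 I t b (tree_policy ?T)" by (rule optimal_policy1_best[OF valid t])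
      show "K + setup_cost + Suc (Suc b) * K + best_cost + data_size w (enc_tree ?T) \<le> ?X I"
        using b by (intro add_le_mono size order_refl mult_le_mono) auto
    qed
  qed auto
  then show ?thesis unfolding SRm_fpt_def by (simp add: case_prod_beta' case_prod_unfold)
qed

end

theorem theorem1:
  fixes C :: "sbmsm set" and w :: "real \<Rightarrow> nat"
  assumes "\<And>I. I \<in> C \<Longrightarrow> valid_instance I"
    and "w = unit_weight \<or> w = bit_weight \<and> (\<forall>I\<in>C. rational_instance I)"
    and "\<exists>p :: nat poly. \<forall>I\<in>C. instance_size w I \<le> poly p (nitems I + rounds I)"
    and "\<exists>p :: nat poly. \<forall>I\<in>C. card (global_states I) \<le> poly p (instance_size w I)"
  shows "SRm_fpt w C \<and> SBMSm_fpt w C"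
proof -
  obtain p :: "nat poly" where "\<forall>I\<in>C. card (global_states I) \<le> poly p (instance_size w I)"
    using assms(4) by blast
  then have h: "fpt_bounded w C (\<lambda>I. card (global_states I))"
    by (intro fpt_bounded_mono[OF fpt_bounded_poly[OF fpt_bounded_size]]) auto
  \<comment> \<open>The two cost models differ only in the bound on the weights: 1 on the real RAM
    and \<open>bit_bound\<close> for rationals.\<close>
  obtain W where W: "fpt_bounded w C W" "\<And>I. I \<in> C \<Longrightarrow> \<exists>lv. run w I lv (W I)"
  proof (cases "w = unit_weight")
    case True
    then show ?thesis using that[of "\<lambda>_. 1"] run_unit_weight[OF assms(1)] fpt_bounded_const by blast
  next
    case False
    then have w: "w = bit_weight" "\<And>I. I \<in> C \<Longrightarrow> rational_instance I" using assms(2) by auto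
    have "fpt_bounded w C bit_bound"
      unfolding bit_bound_def num_bound_def Let_def w(1)[symmetric]
      by (intro fpt_bounded_add fpt_bounded_mult fpt_bounded_const fpt_bounded_size fpt_bounded_exp_nitems h
        fpt_bounded_budget[OF assms(1)] fpt_bounded_rounds fpt_bounded_nitems fpt_bounded_nstates)
    then show ?thesis using that[of bit_bound] run_bit_weight[OF assms(1) w(2)] w(1) by blast
  qed
  show ?thesis using SRm_fpt[OF W(1) h assms(1) W(2)] SBMSm_fpt[OF W(1) h assms(1) W(2)] by blast
qed

end
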